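(* Let $X_n$, $n\ge 1$, be a standard stationary Gaussian sequence with correlation function $\rho(n)=\mathbb{E}\{X_1X_{n+1}\}$. Let $S, S_n$, $n\ge1$, be independent non-negative random variables with common distribution function $F$ having upper endpoint $1$, independent of the $X_n$'s and of a standard normal random variable $X$ (with $S$ independent of $X$). Suppose that there exist $\nu\in(0,1)$ and non-negative random variables $S_\gamma,S_\tau$ that are regularly varying at $1$ with non-negative indices $\gamma$ and $\tau$, respectively, such that $$\mathbb{P}\{S_\tau>u\}\ge\mathbb{P}\{S>u\}\ge\mathbb{P}\{S_\gamma>u\}\qquad\text{for all }u\in(\nu,1).$$ Suppose also that for some $\epsilon>0$, with $\Delta_\epsilon=2(\gamma-\tau)+\epsilon$, $$\lim_{n\to\infty}\rho(n)(\ln n)^{1+\Delta_\epsilon}=0.$$ Set $Y=SX$, $Y_n=S_nX_n$, and let $u_n(x)=a_nx+b_n$ with $a_n>0$, $b_n\in\mathbb{R}$ be such that $\lim_{n\to\infty}n\,\mathbb{P}\{Y>u_n(x)\}=\exp(-x)$ for every $x\in\mathbb{R}$. Fix $\mathbf{x}=(x_1,x_2)\in\mathbb{R}^2$ and let $\mathbf{N}_n=\mathbf{N}_n(\cdot,\mathbf{x})$ be the bivariate exceedances point process on $\bigcup_{d=1}^2((0,1]\times\{d\})$ built from $Y_1,\dots,Y_n$ and the levels $u_n(x_1)$, $u_n(x_2)$ (defined in the context). Then, as $n\to\infty$, $\mathbf{N}_n$ converges in distribution to a Poisson process $\mathcal{N}$ on $\bigcup_{d=1}^2((0,1]\times\{d\})$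 with intensity measure $$\mu(\mathbf{B})=\sum_{d=1}^2\exp(-x_d)\,m(B_d),\qquad \mathbf{B}=\bigcup_{d=1}^2(B_d\times\{d\}),$$ where $m$ denotes Lebesgue measure on $(0,1]$.
   Context: A standard stationary Gaussian sequence is a (jointly) Gaussian sequence $X_n$, $n\ge1$, in which each $X_n$ is $N(0,1)$ distributed and $\rho(n)=\mathbb{E}\{X_1X_{n+1}\}=\mathbb{E}\{X_jX_{n+j}\}$ for all $j\ge1$. A random variable $S_\alpha$, $\alpha\ge0$, is regularly varying at $1$ with index $\alpha$ if its distribution function has upper endpoint equal to $1$ and $$\lim_{u\to\infty}\frac{\mathbb{P}\{S_\alpha>1-x/u\}}{\mathbb{P}\{S_\alpha>1-1/u\}}=x^\alpha,\qquad x>0.$$ Bivariate exceedances point process: with $\xi_1(i)=Y_i$ and $\xi_2(i)=-Y_i$, for Borel sets $B_1,B_2\subset(0,1]$ and $\mathbf{B}=\bigcup_{d=1}^2(B_d\times\{d\})$, $$\mathbf{N}_n(\mathbf{B},\mathbf{x})=\sum_{d=1}^2\sum_{i=1}^n \mathbb{I}\left(\xi_d(i)>u_n(x_d),\ \tfrac{i}{n}\in B_d\right),$$ where $\mathbb{I}(\cdot)$ is the indicator function. *)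

theory Defs
  imports "HOL-Probability.Probability"
begin

section \<open>Gaussian sequences\<close>

text \<open>Degenerate normal laws (variance zero) count as Gaussian.\<close>

definition gaussian_law :: "real measure \<Rightarrow> bool" where
  "gaussian_law L \<longleftrightarrow>
     (\<exists>m. L = return borel m \<or> (\<exists>\<sigma>>0. L = density lborel (normal_density m \<sigma>)))"

definition jointly_gaussian :: "'a measure \<Rightarrow> 'i set \<Rightarrow> ('i \<Rightarrow> 'a \<Rightarrow> real) \<Rightarrow> bool" where
  "jointly_gaussian M I X \<longleftrightarrow>
     (\<forall>i\<in>I. X i \<in> borel_measurable M) \<and>
     (\<forall>J c. finite J \<and> J \<subseteq> I \<longrightarrow> gaussian_law (distr M borel (\<lambda>\<omega>. \<Sum>i\<in>J. c i * X i \<omega>)))"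

text \<open>Sequences indexed by \<open>n \<ge> 1\<close> are functions on \<open>nat\<close> whose value at \<open>0\<close> is ignored.\<close>

definition standard_stationary_gaussian ::
    "'a measure \<Rightarrow> (nat \<Rightarrow> 'a \<Rightarrow> real) \<Rightarrow> (nat \<Rightarrow> real) \<Rightarrow> bool" where
  "standard_stationary_gaussian M X \<rho> \<longleftrightarrow>
     jointly_gaussian M {1..} X \<and>
     (\<forall>n\<ge>1. distributed M lborel (X n) std_normal_density) \<and>
     (\<forall>n\<ge>1. \<forall>j\<ge>1. (\<integral>\<omega>. X j \<omega> * X (n + j) \<omega> \<partial>M) = \<rho> n)"


section \<open>Distribution functions with finite upper endpoint\<close>

definition upper_endpoint :: "(real \<Rightarrow> real) \<Rightarrow> ereal" where
  "upper_endpoint F = Sup (ereal ` {x. F x < 1})"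

definition regularly_varying_at_1 :: "'a measure \<Rightarrow> ('a \<Rightarrow> real) \<Rightarrow> real \<Rightarrow> bool" where
  "regularly_varying_at_1 M S \<alpha> \<longleftrightarrow>
     S \<in> borel_measurable M \<and>
     upper_endpoint (cdf (distr M borel S)) = 1 \<and>
     (\<forall>x>0. ((\<lambda>u. \<P>(\<omega> in M. S \<omega> > 1 - x / u) / \<P>(\<omega> in M. S \<omega> > 1 - 1 / u))
               \<longlongrightarrow> x powr \<alpha>) at_top)"


section \<open>Independence of random elements of different types\<close>

text \<open>The library's \<open>indep_var\<close> forces both random elements to have the same type.\<close>

definition (in prob_space) indep_elements ::
    "'b measure \<Rightarrow> ('a \<Rightarrow> 'b) \<Rightarrow> 'c measure \<Rightarrow> ('a \<Rightarrow> 'c) \<Rightarrow> bool" where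
  "indep_elements K V L W \<longleftrightarrow>
     random_variable K V \<and> random_variable L W \<and>
     indep_set {V -` A \<inter> space M | A. A \<in> sets K} {W -` B \<inter> space M | B. B \<in> sets L}"


section \<open>Convergence in distribution\<close>

definition borel_of :: "'a topology \<Rightarrow> 'a measure" where
  "borel_of T = sigma (topspace T) {U. openin T U}"

definition converges_in_distribution ::
    "'b topology \<Rightarrow> 'a measure \<Rightarrow> (nat \<Rightarrow> 'a \<Rightarrow> 'b) \<Rightarrow> 'c measure \<Rightarrow> ('c \<Rightarrow> 'b) \<Rightarrow> bool" where
  "converges_in_distribution T M Z P W \<longleftrightarrow>
     (\<forall>n. Z n \<in> M \<rightarrow>\<^sub>M borel_of T) \<and> W \<in> P \<rightarrow>\<^sub>M borel_of T \<and>
     (\<forall>G. continuous_map T euclideanreal G \<and> bounded (G ` topspace T) \<longrightarrow>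
        (\<lambda>n. \<integral>\<omega>. G (Z n \<omega>) \<partial>M) \<longlonglongrightarrow> (\<integral>\<omega>. G (W \<omega>) \<partial>P))"


section \<open>Point processes\<close>

definition point_measures :: "'a::topological_space set \<Rightarrow> 'a measure set" where
  "point_measures E = {m. sets m = sets (restrict_space borel E) \<and>
     (\<forall>A\<in>sets m. emeasure m A \<in> insert \<infinity> (range of_nat)) \<and>
     (\<forall>K. compact K \<and> K \<subseteq> E \<longrightarrow> emeasure m K < \<infinity>)}"

text \<open>The vague topology is the coarsest one making \<open>m \<mapsto> \<integral>f dm\<close> continuous for all
  continuous \<open>f\<close> with compact support in \<open>E\<close>; compactness is relative to \<open>E\<close>, so for
  \<open>E = (0,1] \<times> {1,2}\<close> the support stays away from \<open>{0} \<times> {1,2}\<close>.\<close>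

definition compactly_supported :: "'a::topological_space set \<Rightarrow> ('a \<Rightarrow> real) set" where
  "compactly_supported E =
     {f. continuous_on E f \<and> (\<exists>K. compact K \<and> K \<subseteq> E \<and> (\<forall>z\<in>E - K. f z = 0))}"

definition vague_topology :: "'a::topological_space set \<Rightarrow> 'a measure topology" where
  "vague_topology E = topology_generated_by
     {{m \<in> point_measures E. (\<integral>z. f z \<partial>m) \<in> U} | f U. f \<in> compactly_supported E \<and> open U}"

lemma topspace_vague_topology: "topspace (vague_topology E) = point_measures E"
proof -
  have "(\<lambda>_. 0) \<in> compactly_supported E"
    by (auto simp: compactly_supported_def intro: exI[of _ "{}"])
  then have "point_measures E \<in>
     {{m \<in> point_measures E. (\<integral>z. f z \<partial>m) \<in> U} | f U. f \<in> compactly_supported E \<and> open U}"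
    by (intro CollectI exI[of _ "\<lambda>_. 0"] exI[of _ UNIV]) auto
  then show ?thesis
    unfolding vague_topology_def topology_generated_by_topspace by blast
qed

definition poisson_process ::
    "'a::topological_space set \<Rightarrow> 'w measure \<Rightarrow> ('w \<Rightarrow> 'a measure) \<Rightarrow> 'a measure \<Rightarrow> bool" where
  "poisson_process E P N \<mu> \<longleftrightarrow>
     prob_space P \<and> sets \<mu> = sets (restrict_space borel E) \<and>
     (\<forall>w\<in>space P. N w \<in> point_measures E) \<and>
     (\<forall>B\<in>sets \<mu>. (\<lambda>w. emeasure (N w) B) \<in> borel_measurable P) \<and>
     (\<forall>B\<in>sets \<mu>. emeasure \<mu> B < \<infinity> \<longrightarrow>
        (\<forall>k::nat. \<P>(w in P. emeasure (N w) B = of_nat k) =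
           measure \<mu> B ^ k / fact k * exp (- measure \<mu> B))) \<and>
     (\<forall>\<B>. finite \<B> \<and> \<B> \<subseteq> sets \<mu> \<and> disjoint \<B> \<longrightarrow>
        prob_space.indep_vars P (\<lambda>_. borel) (\<lambda>B w. emeasure (N w) B) \<B>)"


section \<open>The bivariate exceedances point process\<close>

definition biv_space :: "(real \<times> nat) set" where
  "biv_space = {0<..1} \<times> {1, 2}"

lemma sets_biv_space_borel: "B \<in> sets (restrict_space borel biv_space) \<Longrightarrow> B \<in> sets borel"
proof -
  have "biv_space \<in> sets ((borel :: real measure) \<Otimes>\<^sub>M (borel :: nat measure))"
    unfolding biv_space_def by (intro pair_measureI) auto
  then have "biv_space \<in> sets borel"
    by (simp only: borel_prod)
  then show "B \<in> sets (restrict_space borel biv_space) \<Longrightarrow> B \<in> sets borel"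
    by (auto simp: sets_restrict_space_iff)
qed

text \<open>A set \<open>B\<close> in the bivariate space is \<open>(B\<^sub>1 \<times> {1}) \<union> (B\<^sub>2 \<times> {2})\<close> with
  \<open>B\<^sub>d = component B d\<close>.\<close>

definition component :: "(real \<times> nat) set \<Rightarrow> nat \<Rightarrow> real set" where
  "component B d = {t. (t, d) \<in> B}"

definition biv_measure :: "((real \<times> nat) set \<Rightarrow> ennreal) \<Rightarrow> (real \<times> nat) measure" where
  "biv_measure \<phi> = measure_of biv_space (sets (restrict_space borel biv_space)) \<phi>"

definition \<xi> :: "nat \<Rightarrow> real \<Rightarrow> real" where
  "\<xi> d y = (if d = 1 then y else - y)"

definition exceedance_process ::
    "(nat \<Rightarrow> 'a \<Rightarrow> real) \<Rightarrow> (nat \<Rightarrow> real \<Rightarrow> real) \<Rightarrow> (nat \<Rightarrow> real) \<Rightarrow> nat \<Rightarrow> 'a \<Rightarrow> (real \<times> nat) measure"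
  where
  "exceedance_process Y u x n \<omega> = biv_measure (\<lambda>B. \<Sum>d\<in>{1,2}. \<Sum>i\<in>{1..n}.
     if \<xi> d (Y i \<omega>) > u n (x d) \<and> real i / real n \<in> component B d then 1 else 0)"

definition biv_intensity :: "(nat \<Rightarrow> real) \<Rightarrow> (real \<times> nat) measure" where
  "biv_intensity x = biv_measure (\<lambda>B. \<Sum>d\<in>{1,2}.
     ennreal (exp (- x d)) * emeasure lborel (component B d))"

text \<open>The two set functions are countably additive, so the constructions above are not
  affected by the convention that \<open>measure_of\<close> yields the zero measure otherwise.\<close>

lemma emeasure_biv_measure:
  assumes \<phi>: "\<And>B. B \<in> sets (restrict_space borel biv_space) \<Longrightarrow> \<phi> B = (\<Sum>j\<in>J. c j * emeasure (L j) B)"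
    and L: "\<And>j. j \<in> J \<Longrightarrow> sets (L j) = sets borel"
    and B: "B \<in> sets (restrict_space borel biv_space)"
  shows "emeasure (biv_measure \<phi>) B = \<phi> B"
proof -
  let ?S = "sets (restrict_space borel biv_space)"
  have sp: "space (restrict_space borel biv_space) = biv_space"
    by (simp add: space_restrict_space)
  have sa: "sigma_algebra biv_space ?S"
    using sets.sigma_algebra_axioms[of "restrict_space borel biv_space"] by (simp only: sp)
  have pos: "positive ?S \<phi>"
    by (simp add: positive_def \<phi>)
  have "countably_additive ?S \<phi>"
  proof (rule countably_additiveI)
    fix A :: "nat \<Rightarrow> (real \<times> nat) set"
    assume A: "range A \<subseteq> ?S" "disjoint_family A" "(\<Union>i. A i) \<in> ?S"
    have "(\<Sum>i. \<phi> (A i)) = (\<Sum>i. \<Sum>j\<in>J. c j * emeasure (L j) (A i))"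
      using A by (intro suminf_cong \<phi>) auto
    also have "\<dots> = (\<Sum>j\<in>J. \<Sum>i. c j * emeasure (L j) (A i))"
      by (intro suminf_sum) auto
    also have "\<dots> = (\<Sum>j\<in>J. c j * emeasure (L j) (\<Union>i. A i))"
    proof (intro sum.cong refl)
      fix j assume "j \<in> J"
      then have "range A \<subseteq> sets (L j)"
        using A sets_biv_space_borel L by blast
      then show "(\<Sum>i. c j * emeasure (L j) (A i)) = c j * emeasure (L j) (\<Union>i. A i)"
        using suminf_emeasure[OF _ A(2), of "L j"] by simp
    qed
    finally show "(\<Sum>i. \<phi> (A i)) = \<phi> (\<Union>i. A i)"
      using \<phi>[OF A(3)] by simp
  qed
  from emeasure_measure_of_sigma[OF sa pos this B] show ?thesis
    unfolding biv_measure_def .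
qed

lemma sets_biv_measure [simp]: "sets (biv_measure \<phi>) = sets (restrict_space borel biv_space)"
proof -
  have "sigma_algebra (space (restrict_space borel biv_space)) (sets (restrict_space borel biv_space))"
    by (rule sets.sigma_algebra_axioms)
  then have "sigma_algebra biv_space (sets (restrict_space borel biv_space))"
    by (simp add: space_restrict_space)
  then show ?thesis
    unfolding biv_measure_def by (rule sigma_algebra.sets_measure_of_eq)
qed

lemma emeasure_biv_intensity:
  assumes "B \<in> sets (restrict_space borel biv_space)"
  shows "emeasure (biv_intensity x) B =
    (\<Sum>d\<in>{1,2}. ennreal (exp (- x d)) * emeasure lborel (component B d))"
  unfolding biv_intensity_def
proof (rule emeasure_biv_measure[where J = "{1,2::nat}" and c = "\<lambda>d. ennreal (exp (- x d))"
      and L = "\<lambda>d. distr lborel borel (\<lambda>t. (t, d))", OF _ _ assms])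
  fix B assume "B \<in> sets (restrict_space borel biv_space)"
  then have B: "B \<in> sets borel" by (rule sets_biv_space_borel)
  have "emeasure (distr lborel borel (\<lambda>t. (t, d))) B = emeasure lborel (component B d)" for d :: nat
  proof -
    have "(\<lambda>t::real. (t, d)) \<in> borel_measurable lborel"
      by (simp add: borel_measurable_continuous_onI continuous_on_Pair)
    then show ?thesis
      using B by (simp add: emeasure_distr component_def vimage_def)
  qed
  then show "(\<Sum>d\<in>{1,2}. ennreal (exp (- x d)) * emeasure lborel (component B d)) =
      (\<Sum>j\<in>{1,2}. ennreal (exp (- x j)) * emeasure (distr lborel borel (\<lambda>t. (t, j))) B)"
    by simp
qed simp

lemma emeasure_exceedance_process:
  assumes "B \<in> sets (restrict_space borel biv_space)"
  shows "emeasure (exceedance_process Y u x n \<omega>) B = (\<Sum>d\<in>{1,2}. \<Sum>i\<in>{1..n}.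
     if \<xi> d (Y i \<omega>) > u n (x d) \<and> real i / real n \<in> component B d then 1 else 0)"
  unfolding exceedance_process_def
proof (rule emeasure_biv_measure[where J = "{1,2::nat} \<times> {1..n}"
      and c = "\<lambda>(d, i). if \<xi> d (Y i \<omega>) > u n (x d) then 1 else 0"
      and L = "\<lambda>(d, i). return borel (real i / real n, d)", OF _ _ assms])
  fix B assume "B \<in> sets (restrict_space borel biv_space)"
  then have B: "B \<in> sets borel" by (rule sets_biv_space_borel)
  show "(\<Sum>d\<in>{1,2}. \<Sum>i\<in>{1..n}.
       if \<xi> d (Y i \<omega>) > u n (x d) \<and> real i / real n \<in> component B d then 1 else 0) =
     (\<Sum>j\<in>{1,2} \<times> {1..n}. (case j of (d, i) \<Rightarrow> if \<xi> d (Y i \<omega>) > u n (x d) then 1 else 0) *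
        emeasure (case j of (d, i) \<Rightarrow> return borel (real i / real n, d)) B)"
    unfolding sum.cartesian_product
    by (intro sum.cong refl) (auto simp: B component_def)
qed auto

end

theory Submission
  imports Defs
begin

text \<open>
  If \<open>X'\<close> is an independent copy of the Gaussian sequence \<open>X\<close>, then replacing every \<open>X'\<^sub>j\<close> by
  \<open>X'\<^sub>j + r\<^sub>i\<^sub>j (X\<^sub>i - X'\<^sub>i)\<close>, with \<open>r\<^sub>i\<^sub>j\<close> the correlation of \<open>X\<^sub>i\<close> and \<open>X\<^sub>j\<close>, does not change its law. So,
  conditionally on an exceedance at \<open>i\<close>, the remaining exceedances are those of a copy that is
  independent of \<open>(S\<^sub>i, X\<^sub>i)\<close>, except for the \<open>j\<close> at which this shift moves \<open>X'\<^sub>j\<close> across its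
  threshold. At short lags both \<open>i\<close> and \<open>j\<close> would have to exceed, which is unlikely because all
  correlations are bounded away from \<open>1\<close> in absolute value; at long lags the shift is \<open>o(1 / u\<^sub>n)\<close>
  because \<open>\<rho>(n) ln n \<longlonglongrightarrow> 0\<close>, so that being within the shift of the threshold has probability
  \<open>o(1 / n)\<close>. Therefore the vector \<open>W\<close> of exceedance counts in finitely many cells satisfies the
  identity \<open>E (W\<^sub>b h(W)) = \<mu>\<^sub>b E h(W + e\<^sub>b)\<close> up to \<open>o(1)\<close>, which together with tightness
  characterises independent Poisson counts.

  For the vague topology, the counts in the cells of fine dyadic partitions form neighbourhoods of
  each finite point measure. Hence a bounded continuous functional is squeezed between functions of
  such counts, and convergence in distribution follows from convergence of the counts.
\<close>

section \<open>Characteristic functions determine finite-dimensional laws\<close>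

text \<open>The coupling preserves the law because X'_j - r_ij X'_i is the regression residual,
  uncorrelated with coordinate i, and r_ij X_i supplies again exactly the component that was
  removed. The argument works without an asymptotic formula for the tail of S X. Two crude estimates
  take its place. Mass of S near 1 and S \<le> 1 put the squared level between 2 c0 ln n, for any c0
  < 1, and 4 ln n. Given the scale, a normal variable falls within \<delta> of a high threshold t
  with probability at most a constant times \<delta> t times the probability of exceeding t. Shift
  and threshold are both of order sqrt (ln n), apart from the factor r_ij in the shift, so the
  relative error is of order |r_ij| ln n; this explains the rate that is needed. Regular variation
  supplies it: the tail comparison at 1 forces \<tau> \<le> \<gamma>, hence 1 + \<Delta> \<ge> 1.
  Short lags are those up to n^\<kappa> with \<kappa> = (1 - \<theta>) / 8, where \<theta> < 1
  bounds all correlations: of order n^(1+\<kappa>) pairs, each costing at most about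
  n^(-1-2\<kappa>). The remaining pairs, at most of order n^2, cost o(n^(-2)) each.\<close>

lemma weighted_Levy_uniqueness:
  fixes Z1 :: "'a \<Rightarrow> real" and Z2 :: "'b \<Rightarrow> real"
  assumes "finite_measure M1" "finite_measure M2"
    and [measurable]: "f1 \<in> borel_measurable M1" "f2 \<in> borel_measurable M2"
      "Z1 \<in> borel_measurable M1" "Z2 \<in> borel_measurable M2"
    and f1: "\<And>\<omega>. 0 \<le> f1 \<omega> \<and> f1 \<omega> \<le> C" and f2: "\<And>\<omega>. 0 \<le> f2 \<omega> \<and> f2 \<omega> \<le> C"
    and char: "\<And>t. (CLINT \<omega>|M1. complex_of_real (f1 \<omega>) * iexp (t * Z1 \<omega>)) =
                   (CLINT \<omega>|M2. complex_of_real (f2 \<omega>) * iexp (t * Z2 \<omega>))"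
    and A [measurable]: "A \<in> sets borel"
  shows "(\<integral>\<omega>. f1 \<omega> * indicator A (Z1 \<omega>) \<partial>M1) = (\<integral>\<omega>. f2 \<omega> * indicator A (Z2 \<omega>) \<partial>M2)"
proof -
  interpret M1: finite_measure M1 by fact
  interpret M2: finite_measure M2 by fact
  have i1 [simp]: "integrable M1 f1" by (rule M1.integrable_const_bound[of _ C]) (use f1 in auto)
  have i2 [simp]: "integrable M2 f2" by (rule M2.integrable_const_bound[of _ C]) (use f2 in auto)
  \<comment> \<open>The hypothesis at t = 0 gives both weights the same mass \<open>c\<close>.
    Dividing by it produces two probability laws with equal characteristic functions; if it
    vanishes, both weights are zero almost everywhere.\<close>
  define c where "c = (\<integral>\<omega>. f1 \<omega> \<partial>M1)"
  have c2: "c = (\<integral>\<omega>. f2 \<omega> \<partial>M2)"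
    using char[of 0] by (simp add: c_def)
  show ?thesis
  proof (cases "c = 0")
    case True
    then have "AE \<omega> in M1. f1 \<omega> = 0" "AE \<omega> in M2. f2 \<omega> = 0"
      using integral_nonneg_eq_0_iff_AE[OF i1] integral_nonneg_eq_0_iff_AE[OF i2] f1 f2 c2
      by (auto simp: c_def)
    then have "(\<integral>\<omega>. f1 \<omega> * indicator A (Z1 \<omega>) \<partial>M1) = (\<integral>\<omega>. 0 \<partial>M1)"
      "(\<integral>\<omega>. f2 \<omega> * indicator A (Z2 \<omega>) \<partial>M2) = (\<integral>\<omega>. 0 \<partial>M2)"
      by (intro integral_cong_AE; auto)+
    then show ?thesis by simp
  next
    case False
    have "c \<ge> 0" unfolding c_def using f1 by (intro integral_nonneg_AE) auto
    with False have c: "c > 0" by simp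
    have rd: "real_distribution (distr (density N (\<lambda>\<omega>. f \<omega> / c)) borel Z)"
      and ch: "char (distr (density N (\<lambda>\<omega>. f \<omega> / c)) borel Z) t =
        (CLINT \<omega>|N. complex_of_real (f \<omega>) * iexp (t * Z \<omega>)) / c"
      and me: "measure (distr (density N (\<lambda>\<omega>. f \<omega> / c)) borel Z) A =
        (\<integral>\<omega>. f \<omega> * indicator A (Z \<omega>) \<partial>N) / c"
      if [measurable]: "f \<in> borel_measurable N" "Z \<in> borel_measurable N"
        and f: "\<And>\<omega>. 0 \<le> f \<omega> \<and> f \<omega> \<le> C" and int: "integrable N f" and cc: "c = (\<integral>\<omega>. f \<omega> \<partial>N)"
      for N :: "'x measure" and f Z t
    proof -
      have "emeasure (density N (\<lambda>\<omega>. f \<omega> / c)) (space N) = (\<integral>\<^sup>+\<omega>. ennreal (f \<omega> / c) \<partial>N)"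
        by (subst emeasure_density) (auto intro!: nn_integral_cong)
      also have "\<dots> = ennreal (\<integral>\<omega>. f \<omega> / c \<partial>N)"
        using f int c by (intro nn_integral_eq_integral) auto
      also have "\<dots> = 1" using c cc by simp
      finally have *: "prob_space (density N (\<lambda>\<omega>. f \<omega> / c))" by (intro prob_spaceI) simp
      interpret D: prob_space "density N (\<lambda>\<omega>. f \<omega> / c)" by fact
      show "real_distribution (distr (density N (\<lambda>\<omega>. f \<omega> / c)) borel Z)"
        by (intro D.real_distribution_distr) simp
      show "char (distr (density N (\<lambda>\<omega>. f \<omega> / c)) borel Z) t =
        (CLINT \<omega>|N. complex_of_real (f \<omega>) * iexp (t * Z \<omega>)) / c"
        unfolding char_def using c f
        by (simp add: integral_distr integral_density scaleR_conv_of_real)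
      have "measure (distr (density N (\<lambda>\<omega>. f \<omega> / c)) borel Z) A =
        (\<integral>x. indicator A x \<partial>distr (density N (\<lambda>\<omega>. f \<omega> / c)) borel Z)" by simp
      also have "\<dots> = (\<integral>\<omega>. f \<omega> * indicator A (Z \<omega>) \<partial>N) / c"
        using c f by (subst integral_distr) (auto simp: integral_density)
      finally show "measure (distr (density N (\<lambda>\<omega>. f \<omega> / c)) borel Z) A =
        (\<integral>\<omega>. f \<omega> * indicator A (Z \<omega>) \<partial>N) / c" .
    qed
    note r1 = rd[OF assms(3,5) f1 i1 c_def] ch[OF assms(3,5) f1 i1 c_def] me[OF assms(3,5) f1 i1 c_def]
    note r2 = rd[OF assms(4,6) f2 i2 c2] ch[OF assms(4,6) f2 i2 c2] me[OF assms(4,6) f2 i2 c2]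
    have "distr (density M1 (\<lambda>\<omega>. f1 \<omega> / c)) borel Z1 = distr (density M2 (\<lambda>\<omega>. f2 \<omega> / c)) borel Z2"
      by (rule Levy_uniqueness[OF r1(1) r2(1)]) (rule ext, simp only: r1(2) r2(2) char)
    then show ?thesis using r1(3) r2(3) c by simp
  qed
qed

text \<open>Exponential factors are exchanged for indicators one coordinate at a time. The factor
  left over from the other coordinates is complex, whereas Levy uniqueness needs nonnegative
  weights, so it enters as \<open>1 + cos (\<theta> + \<phi>)\<close> with a free phase.\<close>

lemma char_determines_rectangles:
  fixes X1 :: "'i \<Rightarrow> 'a \<Rightarrow> real" and X2 :: "'i \<Rightarrow> 'b \<Rightarrow> real"
  assumes M1: "prob_space M1" and M2: "prob_space M2" and I: "finite I"
    and X1: "\<And>i. i \<in> I \<Longrightarrow> X1 i \<in> borel_measurable M1"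
    and X2: "\<And>i. i \<in> I \<Longrightarrow> X2 i \<in> borel_measurable M2"
    and char: "\<And>c. (CLINT \<omega>|M1. iexp (\<Sum>i\<in>I. c i * X1 i \<omega>)) =
                   (CLINT \<omega>|M2. iexp (\<Sum>i\<in>I. c i * X2 i \<omega>))"
    and J: "J \<subseteq> I" and A: "\<And>i. i \<in> I \<Longrightarrow> A i \<in> sets borel"
  shows "(CLINT \<omega>|M1. complex_of_real (\<Prod>i\<in>J. indicator (A i) (X1 i \<omega>)) * iexp (\<Sum>i\<in>I - J. c i * X1 i \<omega>)) =
         (CLINT \<omega>|M2. complex_of_real (\<Prod>i\<in>J. indicator (A i) (X2 i \<omega>)) * iexp (\<Sum>i\<in>I - J. c i * X2 i \<omega>))"
  using finite_subset[OF J I] J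
proof (induction J arbitrary: c rule: finite_induct)
  case empty
  then show ?case using char by simp
next
  case (insert k J)
  interpret M1: prob_space M1 by fact
  interpret M2: prob_space M2 by fact
  define f1 where "f1 \<omega> = (\<Prod>i\<in>J. indicator (A i) (X1 i \<omega>) :: real)" for \<omega>
  define f2 where "f2 \<omega> = (\<Prod>i\<in>J. indicator (A i) (X2 i \<omega>) :: real)" for \<omega>
  define \<theta>1 where "\<theta>1 \<omega> = (\<Sum>i\<in>I - insert k J. c i * X1 i \<omega>)" for \<omega>
  define \<theta>2 where "\<theta>2 \<omega> = (\<Sum>i\<in>I - insert k J. c i * X2 i \<omega>)" for \<omega>
  have kI: "k \<in> I" "J \<subseteq> I" "k \<notin> J" using insert by auto
  have [measurable]: "X1 i \<in> borel_measurable M1" "X2 i \<in> borel_measurable M2" "A i \<in> sets borel"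
    if "i \<in> I" for i using X1 X2 A that by auto
  have [measurable]: "X1 k \<in> borel_measurable M1" "X2 k \<in> borel_measurable M2" "A k \<in> sets borel"
    using kI by auto
  have [measurable]: "f1 \<in> borel_measurable M1" "f2 \<in> borel_measurable M2"
    unfolding f1_def[abs_def] f2_def[abs_def] using kI
    by (auto intro!: borel_measurable_prod borel_measurable_indicator' measurable_sets_borel simp: subset_iff)
  have [measurable]: "\<theta>1 \<in> borel_measurable M1" "\<theta>2 \<in> borel_measurable M2"
    unfolding \<theta>1_def[abs_def] \<theta>2_def[abs_def] by (auto intro!: borel_measurable_sum borel_measurable_times)
  have f01: "0 \<le> f1 \<omega> \<and> f1 \<omega> \<le> 1" "0 \<le> f2 \<omega>' \<and> f2 \<omega>' \<le> 1" for \<omega> \<omega>'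
    unfolding f1_def f2_def by (auto intro!: prod_nonneg prod_le_1)
  \<comment> \<open>The induction hypothesis holds for all coefficients, so coordinate
    \<open>k\<close> may get a separate frequency \<open>t\<close> while the others are scaled
    jointly by \<open>s\<close>; only \<open>s = 0, 1, -1\<close> are needed.\<close>
  have IH: "(CLINT \<omega>|M1. f1 \<omega> * iexp (t * X1 k \<omega> + s * \<theta>1 \<omega>)) = (CLINT \<omega>|M2. f2 \<omega> * iexp (t * X2 k \<omega> + s * \<theta>2 \<omega>))" for t s
  proof -
    have *: "(\<Sum>i\<in>I - J. (if i = k then t else s * c i) * X i) =
        t * X k + s * (\<Sum>i\<in>I - insert k J. c i * X i)" for X :: "'i \<Rightarrow> real"
    proof -
      have *: "I - J = insert k (I - insert k J)" using kI by auto
      have "(\<Sum>i\<in>I - J. (if i = k then t else s * c i) * X i) =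
          t * X k + (\<Sum>i\<in>I - insert k J. (if i = k then t else s * c i) * X i)"
        unfolding * using I by (subst sum.insert) auto
      also have "(\<Sum>i\<in>I - insert k J. (if i = k then t else s * c i) * X i) =
          s * (\<Sum>i\<in>I - insert k J. c i * X i)"
        unfolding sum_distrib_left by (intro sum.cong) auto
      finally show ?thesis .
    qed
    show ?thesis
      using insert.IH[OF kI(2), of "\<lambda>i. if i = k then t else s * c i"]
      unfolding * f1_def f2_def \<theta>1_def \<theta>2_def by simp
  qed
  have int1: "integrable M1 (\<lambda>\<omega>. complex_of_real (f1 \<omega>) * iexp (t * X1 k \<omega> + s * \<theta>1 \<omega>))" for t s
    using f01 by (intro M1.integrable_const_bound[of _ 1]) (auto simp: norm_mult)
  have int2: "integrable M2 (\<lambda>\<omega>. complex_of_real (f2 \<omega>) * iexp (t * X2 k \<omega> + s * \<theta>2 \<omega>))" for t s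
    using f01 by (intro M2.integrable_const_bound[of _ 1]) (auto simp: norm_mult)
  \<comment> \<open>Euler's formula writes the cosine weight as a combination of the exponentials
    covered by \<open>IH\<close>.\<close>
  have cosexp: "complex_of_real (f * (1 + cos (\<theta> + \<phi>))) * iexp (t * z) =
      f * iexp (t * z + 0 * \<theta>) + (iexp \<phi> / 2 * (f * iexp (t * z + 1 * \<theta>)) + iexp (- \<phi>) / 2 * (f * iexp (t * z + (-1) * \<theta>)))"
    for f \<theta> \<phi> t z :: real
    by (simp add: cos_of_real[symmetric] cos_exp_eq exp_add[symmetric] algebra_simps add_divide_distrib)
  have "(\<integral>\<omega>. f1 \<omega> * indicator (A k) (X1 k \<omega>) \<partial>M1) = (\<integral>\<omega>. f2 \<omega> * indicator (A k) (X2 k \<omega>) \<partial>M2)"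
    using IH[of _ 0] f01 kI
    by (intro weighted_Levy_uniqueness[where C = 1] M1.finite_measure_axioms M2.finite_measure_axioms) auto
  moreover have "(\<integral>\<omega>. f1 \<omega> * (1 + cos (\<theta>1 \<omega> + \<phi>)) * indicator (A k) (X1 k \<omega>) \<partial>M1) =
      (\<integral>\<omega>. f2 \<omega> * (1 + cos (\<theta>2 \<omega> + \<phi>)) * indicator (A k) (X2 k \<omega>) \<partial>M2)" for \<phi>
  proof (intro weighted_Levy_uniqueness[where C = 2] M1.finite_measure_axioms M2.finite_measure_axioms)
    have *: "0 \<le> f * (1 + cos x) \<and> f * (1 + cos x) \<le> 2" if "0 \<le> f \<and> f \<le> 1" for f x :: real
    proof -
      have c: "0 \<le> 1 + cos x" "1 + cos x \<le> 2" using cos_ge_minus_one[of x] cos_le_one[of x] by linarith+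
      have "f * (1 + cos x) \<le> 1 * 2" using that c by (intro mult_mono) auto
      then show ?thesis using that c by simp
    qed
    show "0 \<le> f1 \<omega> * (1 + cos (\<theta>1 \<omega> + \<phi>)) \<and> f1 \<omega> * (1 + cos (\<theta>1 \<omega> + \<phi>)) \<le> 2" for \<omega>
      using * f01 by blast
    show "0 \<le> f2 \<omega> * (1 + cos (\<theta>2 \<omega> + \<phi>)) \<and> f2 \<omega> * (1 + cos (\<theta>2 \<omega> + \<phi>)) \<le> 2" for \<omega>
      using * f01 by blast
    show "(CLINT \<omega>|M1. complex_of_real (f1 \<omega> * (1 + cos (\<theta>1 \<omega> + \<phi>))) * iexp (t * X1 k \<omega>)) =
      (CLINT \<omega>|M2. complex_of_real (f2 \<omega> * (1 + cos (\<theta>2 \<omega> + \<phi>))) * iexp (t * X2 k \<omega>))" for t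
      unfolding cosexp
      by (simp only: Bochner_Integration.integral_add Bochner_Integration.integrable_add
          integrable_mult_right int1 int2 integral_mult_right_zero IH)
  qed (use kI in auto)
  ultimately have cosint: "(\<integral>\<omega>. f1 \<omega> * indicator (A k) (X1 k \<omega>) * cos (\<theta>1 \<omega> + \<phi>) \<partial>M1) =
      (\<integral>\<omega>. f2 \<omega> * indicator (A k) (X2 k \<omega>) * cos (\<theta>2 \<omega> + \<phi>) \<partial>M2)" for \<phi>
  proof -
    have i1: "integrable M1 (\<lambda>\<omega>. f1 \<omega> * indicator (A k) (X1 k \<omega>))"
      "integrable M1 (\<lambda>\<omega>. f1 \<omega> * indicator (A k) (X1 k \<omega>) * cos (\<theta>1 \<omega> + \<phi>))"
      using f01 by (auto intro!: M1.integrable_const_bound[of _ 1] simp: abs_mult indicator_def mult_le_one)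
    have i2: "integrable M2 (\<lambda>\<omega>. f2 \<omega> * indicator (A k) (X2 k \<omega>))"
      "integrable M2 (\<lambda>\<omega>. f2 \<omega> * indicator (A k) (X2 k \<omega>) * cos (\<theta>2 \<omega> + \<phi>))"
      using f01 by (auto intro!: M2.integrable_const_bound[of _ 1] simp: abs_mult indicator_def mult_le_one)
    have "f * (1 + c) * a = f * a + f * a * c" for f c a :: real by (simp add: algebra_simps)
    then show ?thesis
      using \<open>\<And>\<phi>. (\<integral>\<omega>. f1 \<omega> * (1 + cos (\<theta>1 \<omega> + \<phi>)) * indicator (A k) (X1 k \<omega>) \<partial>M1) = _ \<phi>\<close>[of \<phi>]
        \<open>(\<integral>\<omega>. f1 \<omega> * indicator (A k) (X1 k \<omega>) \<partial>M1) = _\<close> i1 i2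
      by (simp add: Bochner_Integration.integral_add)
  qed
  \<comment> \<open>The phases \<open>0\<close> and \<open>- (pi/2)\<close> recover the real and the
    imaginary part of the exponential.\<close>
  have decomp: "complex_of_real (\<Prod>i\<in>insert k J. a i) * iexp \<theta> =
      complex_of_real ((\<Prod>i\<in>J. a i) * a k * cos (\<theta> + 0)) + \<i> * complex_of_real ((\<Prod>i\<in>J. a i) * a k * cos (\<theta> + (- (pi/2))))"
    for a :: "'i \<Rightarrow> real" and \<theta>
    using insert.hyps by (simp add: exp_Euler cos_of_real sin_of_real cos_diff algebra_simps)
  have i1: "integrable M1 (\<lambda>\<omega>. complex_of_real (f1 \<omega> * indicator (A k) (X1 k \<omega>) * cos (\<theta>1 \<omega> + \<phi>)))" for \<phi>
    using f01 by (auto intro!: M1.integrable_const_bound[of _ 1] simp: norm_mult abs_mult indicator_def mult_le_one)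
  have i2: "integrable M2 (\<lambda>\<omega>. complex_of_real (f2 \<omega> * indicator (A k) (X2 k \<omega>) * cos (\<theta>2 \<omega> + \<phi>)))" for \<phi>
    using f01 by (auto intro!: M2.integrable_const_bound[of _ 1] simp: norm_mult abs_mult indicator_def mult_le_one)
  show ?case
    unfolding decomp f1_def[symmetric] f2_def[symmetric] \<theta>1_def[symmetric] \<theta>2_def[symmetric]
    by (simp only: Bochner_Integration.integral_add integrable_mult_right i1 i2
        integral_mult_right_zero integral_complex_of_real cosint)
qed

text \<open>With every coordinate exchanged for an indicator, the two laws agree on rectangles,
  which generate the product \<sigma>-algebra and are closed under intersection.\<close>

theorem char_determines_law:
  fixes X1 :: "'i \<Rightarrow> 'a \<Rightarrow> real" and X2 :: "'i \<Rightarrow> 'b \<Rightarrow> real"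
  assumes M1: "prob_space M1" and M2: "prob_space M2" and I: "finite I"
    and X1: "\<And>i. i \<in> I \<Longrightarrow> X1 i \<in> borel_measurable M1"
    and X2: "\<And>i. i \<in> I \<Longrightarrow> X2 i \<in> borel_measurable M2"
    and char: "\<And>c. (CLINT \<omega>|M1. iexp (\<Sum>i\<in>I. c i * X1 i \<omega>)) =
                   (CLINT \<omega>|M2. iexp (\<Sum>i\<in>I. c i * X2 i \<omega>))"
  shows "distr M1 (PiM I (\<lambda>_. borel)) (\<lambda>\<omega>. \<lambda>i\<in>I. X1 i \<omega>) = distr M2 (PiM I (\<lambda>_. borel)) (\<lambda>\<omega>. \<lambda>i\<in>I. X2 i \<omega>)"
    (is "?D1 = ?D2")
proof -
  interpret M1: prob_space M1 by fact
  interpret M2: prob_space M2 by fact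
  have m1 [measurable]: "(\<lambda>\<omega>. \<lambda>i\<in>I. X1 i \<omega>) \<in> M1 \<rightarrow>\<^sub>M PiM I (\<lambda>_. borel)"
    using X1 by (intro measurable_restrict) auto
  have m2 [measurable]: "(\<lambda>\<omega>. \<lambda>i\<in>I. X2 i \<omega>) \<in> M2 \<rightarrow>\<^sub>M PiM I (\<lambda>_. borel)"
    using X2 by (intro measurable_restrict) auto
  interpret D1: prob_space ?D1 by (rule M1.prob_space_distr) fact
  interpret D2: prob_space ?D2 by (rule M2.prob_space_distr) fact
  show ?thesis
  proof (rule measure_eqI_PiM_finite[OF I])
    fix A :: "'i \<Rightarrow> real set" assume A: "\<And>i. i \<in> I \<Longrightarrow> A i \<in> sets borel"
    have eq: "measure N (({\<omega>. (\<lambda>i\<in>I. X i \<omega>) \<in> Pi\<^sub>E I A}) \<inter> space N) = (\<integral>\<omega>. (\<Prod>i\<in>I. indicator (A i) (X i \<omega>)) \<partial>N)"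
      if N: "(\<lambda>\<omega>. \<lambda>i\<in>I. X i \<omega>) \<in> N \<rightarrow>\<^sub>M PiM I (\<lambda>_. borel)" for N :: "'x measure" and X :: "'i \<Rightarrow> 'x \<Rightarrow> real"
    proof -
      have "(\<integral>\<omega>. (\<Prod>i\<in>I. indicator (A i) (X i \<omega>)) \<partial>N :: real) =
         (\<integral>\<omega>. indicator (({\<omega>. (\<lambda>i\<in>I. X i \<omega>) \<in> Pi\<^sub>E I A}) \<inter> space N) \<omega> \<partial>N)"
      proof (intro Bochner_Integration.integral_cong refl)
        fix \<omega> assume "\<omega> \<in> space N"
        then show "(\<Prod>i\<in>I. indicator (A i) (X i \<omega>) :: real) =
            indicator (({\<omega>. (\<lambda>i\<in>I. X i \<omega>) \<in> Pi\<^sub>E I A}) \<inter> space N) \<omega>"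
          using I by (cases "\<forall>i\<in>I. X i \<omega> \<in> A i") (auto simp: PiE_iff indicator_eq_0_iff intro!: prod_zero)
      qed
      then show ?thesis by simp
    qed
    have "(\<integral>\<omega>. (\<Prod>i\<in>I. indicator (A i) (X1 i \<omega>)) \<partial>M1) = (\<integral>\<omega>. (\<Prod>i\<in>I. indicator (A i) (X2 i \<omega>)) \<partial>M2 :: real)"
      using char_determines_rectangles[OF M1 M2 I X1 X2 char subset_refl A]
      by (simp add: integral_complex_of_real flip: of_real_prod)
    then have "measure ?D1 (Pi\<^sub>E I A) = measure ?D2 (Pi\<^sub>E I A)"
      using A I eq[OF m1] eq[OF m2]
      by (simp add: measure_distr sets_PiM_I_finite vimage_def)
    then show "emeasure ?D1 (Pi\<^sub>E I A) = emeasure ?D2 (Pi\<^sub>E I A)"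
      by (simp add: D1.emeasure_eq_measure D2.emeasure_eq_measure)
  next
    show "range (\<lambda>_::nat. space (PiM I (\<lambda>_. borel :: real measure))) \<subseteq> prod_algebra I (\<lambda>_. borel)"
      using I by (auto simp: space_PiM intro!: prod_algebraI_finite)
  qed auto
qed

section \<open>Gaussian sequences with independent random scaling\<close>

lemma (in prob_space) indep_elements_compose:
  fixes f :: "'b \<Rightarrow> 'd::topological_space" and g :: "'c \<Rightarrow> 'd"
  assumes ind: "indep_elements K V L W" and f: "f \<in> borel_measurable K" and g: "g \<in> borel_measurable L"
  shows "indep_var borel (\<lambda>\<omega>. f (V \<omega>)) borel (\<lambda>\<omega>. g (W \<omega>))"
proof -
  have mV: "V \<in> M \<rightarrow>\<^sub>M K" and mW: "W \<in> M \<rightarrow>\<^sub>M L"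
    and ind: "indep_set {V -` A \<inter> space M | A. A \<in> sets K} {W -` B \<inter> space M | B. B \<in> sets L}"
    using ind by (auto simp: indep_elements_def)
  have mf: "(\<lambda>\<omega>. f (V \<omega>)) \<in> borel_measurable M" using measurable_compose[OF mV f] .
  have mg: "(\<lambda>\<omega>. g (W \<omega>)) \<in> borel_measurable M" using measurable_compose[OF mW g] .
  \<comment> \<open>The preimages of all Borel sets already form a \<sigma>-algebra, so the families
    generated in \<open>indep_var_eq\<close> are the preimage families themselves.\<close>
  have sub: "sigma_sets (space M) {h -` A \<inter> space M |A. A \<in> sets borel} = {h -` A \<inter> space M |A. A \<in> sets borel}"
    if "h \<in> borel_measurable M" for h :: "'a \<Rightarrow> 'd"
    using that sets_vimage_algebra2[of h "space M" borel] sets_vimage_algebra[of "space M" h borel]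
    by (auto simp: measurable_def)
  have "indep_set {(\<lambda>\<omega>. f (V \<omega>)) -` A \<inter> space M |A. A \<in> sets borel} {(\<lambda>\<omega>. g (W \<omega>)) -` A \<inter> space M |A. A \<in> sets borel}"
    unfolding indep_sets2_eq
  proof (intro conjI ballI)
    show "{(\<lambda>\<omega>. f (V \<omega>)) -` A \<inter> space M |A. A \<in> sets borel} \<subseteq> events"
      using measurable_sets[OF mf] by auto
    show "{(\<lambda>\<omega>. g (W \<omega>)) -` A \<inter> space M |A. A \<in> sets borel} \<subseteq> events"
      using measurable_sets[OF mg] by auto
  next
    fix a b assume "a \<in> {(\<lambda>\<omega>. f (V \<omega>)) -` A \<inter> space M |A. A \<in> sets borel}"
      "b \<in> {(\<lambda>\<omega>. g (W \<omega>)) -` A \<inter> space M |A. A \<in> sets borel}"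
    then obtain A B where AB: "A \<in> sets borel" "B \<in> sets borel"
      "a = (\<lambda>\<omega>. f (V \<omega>)) -` A \<inter> space M" "b = (\<lambda>\<omega>. g (W \<omega>)) -` B \<inter> space M" by auto
    have a: "a = V -` (f -` A \<inter> space K) \<inter> space M"
      using AB measurable_space[OF mV] by auto
    have b: "b = W -` (g -` B \<inter> space L) \<inter> space M"
      using AB measurable_space[OF mW] by auto
    show "prob (a \<inter> b) = prob a * prob b"
      using measurable_sets[OF f AB(1)] measurable_sets[OF g AB(2)]
      unfolding a b by (intro indep_setD[OF ind]) blast+
  qed
  then show ?thesis
    using mf mg by (auto simp: indep_var_eq sub)
qed

text \<open>The scales are indexed from \<open>0\<close> although the Gaussian sequence starts at
  \<open>1\<close>: index \<open>0\<close> is reserved for the generic variable S of the limit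
  relation for the levels.\<close>

locale gaussian_scale_mixture = prob_space M for M :: "'a measure" +
  fixes X S :: "nat \<Rightarrow> 'a \<Rightarrow> real" and \<rho> :: "nat \<Rightarrow> real"
  assumes gauss: "standard_stationary_gaussian M X \<rho>"
    and indep_S: "indep_vars (\<lambda>_. borel) S UNIV"
    and indep_S_X: "indep_elements (PiM UNIV (\<lambda>_. borel)) (\<lambda>\<omega> n. S n \<omega>)
      (PiM {1..} (\<lambda>_. borel)) (\<lambda>\<omega>. \<lambda>n\<in>{1..}. X n \<omega>)"
begin

lemma X_measurable [measurable (raw)]: "1 \<le> i \<Longrightarrow> X i \<in> borel_measurable M"
  using gauss by (auto simp: standard_stationary_gaussian_def jointly_gaussian_def)

lemma S_measurable [measurable]: "S i \<in> borel_measurable M"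
  using indep_S by (auto simp: indep_vars_def)

lemma X_distributed: "1 \<le> i \<Longrightarrow> distributed M lborel (X i) std_normal_density"
  using gauss by (auto simp: standard_stationary_gaussian_def)

lemma indep_S_X_compose:
  fixes f g :: "(nat \<Rightarrow> real) \<Rightarrow> 'b::topological_space"
  assumes "f \<in> borel_measurable (PiM UNIV (\<lambda>_. borel))" "g \<in> borel_measurable (PiM {1..} (\<lambda>_. borel))"
  shows "indep_var borel (\<lambda>\<omega>. f (\<lambda>n. S n \<omega>)) borel (\<lambda>\<omega>. g (\<lambda>n\<in>{1..}. X n \<omega>))"
  using indep_S_X assms by (rule indep_elements_compose)

definition lin :: "nat set \<Rightarrow> (nat \<Rightarrow> real) \<Rightarrow> 'a \<Rightarrow> real" where
  "lin J c \<omega> = (\<Sum>j\<in>J. c j * X j \<omega>)"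

lemma lin_measurable: "J \<subseteq> {1..} \<Longrightarrow> lin J c \<in> borel_measurable M"
  unfolding lin_def[abs_def] by (intro borel_measurable_sum borel_measurable_times) auto

lemma X_square: "1 \<le> i \<Longrightarrow> integrable M (\<lambda>\<omega>. (X i \<omega>)\<^sup>2)" "1 \<le> i \<Longrightarrow> expectation (\<lambda>\<omega>. (X i \<omega>)\<^sup>2) = 1"
proof -
  assume i: "1 \<le> i"
  note D = X_distributed[OF i]
  show "integrable M (\<lambda>\<omega>. (X i \<omega>)\<^sup>2)"
    using distributed_integrable[OF D, of "\<lambda>x. x\<^sup>2"] integrable_std_normal_moment[of 2]
    by simp
  show "expectation (\<lambda>\<omega>. (X i \<omega>)\<^sup>2) = 1"
    using standard_normal_distributed_variance[OF D] standard_normal_distributed_expectation[OF D] by simp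
qed

lemma X_expectation: "1 \<le> i \<Longrightarrow> integrable M (X i)" "1 \<le> i \<Longrightarrow> expectation (X i) = 0"
proof -
  assume i: "1 \<le> i"
  note D = X_distributed[OF i]
  show "integrable M (X i)"
    using distributed_integrable[OF D, of "\<lambda>x. x"] integrable_std_normal_moment[of 1] by simp
  show "expectation (X i) = 0"
    using standard_normal_distributed_expectation[OF D] .
qed

lemma X_product: "1 \<le> i \<Longrightarrow> 1 \<le> j \<Longrightarrow> integrable M (\<lambda>\<omega>. X i \<omega> * X j \<omega>)"
proof -
  assume ij: "1 \<le> i" "1 \<le> j"
  have "\<bar>a * b\<bar> \<le> a\<^sup>2 + b\<^sup>2" for a b :: real
  proof -
    have "0 \<le> (\<bar>a\<bar> - \<bar>b\<bar>)\<^sup>2" by simp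
    then have "2 * (\<bar>a\<bar> * \<bar>b\<bar>) \<le> a\<^sup>2 + b\<^sup>2" by (simp add: power2_diff)
    moreover have "0 \<le> a\<^sup>2 + b\<^sup>2" by simp
    ultimately show ?thesis unfolding abs_mult by linarith
  qed
  then show ?thesis
    using ij by (intro Bochner_Integration.integrable_bound[OF Bochner_Integration.integrable_add[OF X_square(1)[OF ij(1)] X_square(1)[OF ij(2)]]]) auto
qed

lemma lin_product:
  assumes "finite J" "J \<subseteq> {1..}" "finite K" "K \<subseteq> {1..}"
  shows "integrable M (\<lambda>\<omega>. lin J c \<omega> * lin K d \<omega>)"
  unfolding lin_def sum_product using assms X_product
  by (intro Bochner_Integration.integrable_sum) (auto simp: subset_iff ac_simps intro!: integrable_mult_right)

lemma lin_expectation: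
  assumes "finite J" "J \<subseteq> {1..}"
  shows "integrable M (lin J c)" "expectation (lin J c) = 0"
proof -
  have [simp]: "integrable M (X j)" "expectation (X j) = 0" if "j \<in> J" for j
    using X_expectation[of j] that assms by auto
  show "integrable M (lin J c)" "expectation (lin J c) = 0"
    unfolding lin_def[abs_def] by auto
qed

text \<open>A Gaussian law allows any mean and also a point mass. All \<open>X j\<close> are
  centred, so the mean is \<open>0\<close>, and the second moment alone decides between the two
  cases.\<close>

lemma lin_distributed:
  fixes c :: "nat \<Rightarrow> real"
  assumes J: "finite J" "J \<subseteq> {1..}"
  defines "V \<equiv> expectation (\<lambda>\<omega>. (lin J c \<omega>)\<^sup>2)"
  shows "V = 0 \<and> (AE \<omega> in M. lin J c \<omega> = 0) \<or>
    V > 0 \<and> distributed M lborel (lin J c) (normal_density 0 (sqrt V))"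
proof -
  have [measurable]: "lin J c \<in> borel_measurable M" using lin_measurable J by auto
  have "gaussian_law (distr M borel (lin J c))"
    using gauss J unfolding standard_stationary_gaussian_def jointly_gaussian_def lin_def[abs_def] by auto
  then obtain m where "distr M borel (lin J c) = return borel m \<or>
      (\<exists>\<sigma>>0. distr M borel (lin J c) = density lborel (normal_density m \<sigma>))"
    unfolding gaussian_law_def by auto
  then show ?thesis
  proof (elim disjE exE conjE)
    assume "distr M borel (lin J c) = return borel m"
    moreover have "AE x in return borel m. x = m" by (simp add: AE_return)
    ultimately have "AE x in distr M borel (lin J c). x = m" by (simp only:)
    then have ae: "AE \<omega> in M. lin J c \<omega> = m" by (simp add: AE_distr_iff)
    have "expectation (lin J c) = expectation (\<lambda>_. m)" using ae by (intro integral_cong_AE) auto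
    then have "m = 0" using lin_expectation[OF J] by (simp add: prob_space)
    with ae have ae: "AE \<omega> in M. lin J c \<omega> = 0" by simp
    then have "V = expectation (\<lambda>_. 0)" unfolding V_def by (intro integral_cong_AE) auto
    with ae show ?thesis by simp
  next
    fix \<sigma> :: real assume \<sigma>: "\<sigma> > 0" and eq: "distr M borel (lin J c) = density lborel (normal_density m \<sigma>)"
    have "distr M lborel (lin J c) = distr M borel (lin J c)" by (intro distr_cong) auto
    with eq have D: "distributed M lborel (lin J c) (normal_density m \<sigma>)" by (simp add: distributed_def)
    have m: "m = 0" using normal_distributed_expectation[OF \<sigma> D] lin_expectation[OF J] by simp
    have "V = \<sigma>\<^sup>2" using normal_distributed_variance[OF \<sigma> D] lin_expectation[OF J] by (simp add: V_def)
    with m D \<sigma> show ?thesis by simp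
  qed
qed

lemma lin_char:
  assumes J: "finite J" "J \<subseteq> {1..}"
  shows "(CLINT \<omega>|M. iexp (lin J c \<omega>)) = exp (- (expectation (\<lambda>\<omega>. (lin J c \<omega>)\<^sup>2)) / 2)"
proof -
  have [measurable]: "lin J c \<in> borel_measurable M" using lin_measurable J by auto
  define V where "V = expectation (\<lambda>\<omega>. (lin J c \<omega>)\<^sup>2)"
  from lin_distributed[OF J, of c] show ?thesis unfolding V_def[symmetric]
  proof (elim disjE conjE)
    assume V: "V = 0" and ae: "AE \<omega> in M. lin J c \<omega> = 0"
    have "(CLINT \<omega>|M. iexp (lin J c \<omega>)) = (CLINT \<omega>|M. 1)"
      using ae by (intro integral_cong_AE) auto
    then show "(CLINT \<omega>|M. iexp (lin J c \<omega>)) = exp (- V / 2)" using V by (simp add: prob_space)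
  next
    assume V: "V > 0" and D: "distributed M lborel (lin J c) (normal_density 0 (sqrt V))"
    then have "distributed M lborel (\<lambda>\<omega>. lin J c \<omega> / sqrt V) std_normal_density"
      using normal_standard_normal_convert[of "sqrt V" "lin J c" 0] by simp
    then have "distr M lborel (\<lambda>\<omega>. lin J c \<omega> / sqrt V) = std_normal_distribution"
      by (simp add: distributed_def)
    then have "char (distr M lborel (\<lambda>\<omega>. lin J c \<omega> / sqrt V)) (sqrt V) = exp (- ((sqrt V)\<^sup>2) / 2)"
      by (simp add: char_std_normal_distribution)
    moreover have "char (distr M lborel (\<lambda>\<omega>. lin J c \<omega> / sqrt V)) (sqrt V) = (CLINT \<omega>|M. iexp (lin J c \<omega>))"
      unfolding char_def using V by (subst integral_distr) auto
    ultimately show "(CLINT \<omega>|M. iexp (lin J c \<omega>)) = exp (- V / 2)" using V by simp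
  qed
qed

text \<open>Independence leaves a Gaussian factor that depends only on the second moment of the
  linear form, times one factor for each scale. Equality of two such laws thus becomes an identity
  between variances.\<close>

lemma joint_char:
  assumes J: "finite J" "J \<subseteq> {1..}" and K: "finite K"
  shows "(CLINT \<omega>|M. iexp (lin J c \<omega> + (\<Sum>k\<in>K. d k * S k \<omega>))) =
    exp (- (expectation (\<lambda>\<omega>. (lin J c \<omega>)\<^sup>2)) / 2) * (\<Prod>k\<in>K. CLINT \<omega>|M. iexp (d k * S k \<omega>))"
proof -
  have [measurable]: "lin J c \<in> borel_measurable M" using lin_measurable J by auto
  have *: "lin J c \<omega> = (\<Sum>j\<in>J. c j * (\<lambda>n\<in>{1..}. X n \<omega>) j)" for \<omega>
    unfolding lin_def using J by (intro sum.cong) auto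
  have mf: "(\<lambda>s::nat \<Rightarrow> real. iexp (\<Sum>k\<in>K. d k * s k)) \<in> borel_measurable (PiM UNIV (\<lambda>_. borel))"
    by measurable
  have mg: "(\<lambda>x. iexp (\<Sum>j\<in>J. c j * x j)) \<in> borel_measurable (PiM {1..} (\<lambda>_. borel))"
    using J by (auto simp: subset_iff)
  have "indep_var borel (\<lambda>\<omega>. iexp (\<Sum>k\<in>K. d k * S k \<omega>)) borel (\<lambda>\<omega>. iexp (lin J c \<omega>))"
    using indep_S_X_compose[OF mf mg] unfolding * .
  then have "(CLINT \<omega>|M. iexp (\<Sum>k\<in>K. d k * S k \<omega>) * iexp (lin J c \<omega>)) =
     (CLINT \<omega>|M. iexp (\<Sum>k\<in>K. d k * S k \<omega>)) * (CLINT \<omega>|M. iexp (lin J c \<omega>))"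
    by (intro indep_var_lebesgue_integral integrable_iexp) auto
  moreover have "indep_vars (\<lambda>_. borel) (\<lambda>k \<omega>. iexp (d k * S k \<omega>)) K"
    by (intro indep_vars_compose2[where M' = "\<lambda>_. borel" and Y = "\<lambda>k s. iexp (d k * s)", OF indep_vars_subset[OF indep_S]]) auto
  then have "(CLINT \<omega>|M. (\<Prod>k\<in>K. iexp (d k * S k \<omega>))) = (\<Prod>k\<in>K. CLINT \<omega>|M. iexp (d k * S k \<omega>))"
    using K by (intro indep_vars_lebesgue_integral integrable_iexp) auto
  moreover have "(\<Prod>k\<in>K. iexp (d k * S k \<omega>)) = iexp (\<Sum>k\<in>K. d k * S k \<omega>)" for \<omega>
    using K by (simp add: exp_sum[symmetric] sum_distrib_left)
  moreover have "iexp (lin J c \<omega> + (\<Sum>k\<in>K. d k * S k \<omega>)) = iexp (\<Sum>k\<in>K. d k * S k \<omega>) * iexp (lin J c \<omega>)" for \<omega>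
    unfolding exp_add[symmetric] by (simp add: algebra_simps)
  ultimately show ?thesis
    unfolding lin_char[OF J] by (simp only: mult.commute)
qed


section \<open>Resampling one index by an independent copy\<close>

definition corr :: "nat \<Rightarrow> nat \<Rightarrow> real" where
  "corr i j = expectation (\<lambda>\<omega>. X i \<omega> * X j \<omega>)"

lemma lin_X_expectation:
  assumes J: "finite J" "J \<subseteq> {1..}" and i: "1 \<le> i"
  shows "integrable M (\<lambda>\<omega>. lin J c \<omega> * X i \<omega>)"
    and "expectation (\<lambda>\<omega>. lin J c \<omega> * X i \<omega>) = (\<Sum>j\<in>J. c j * corr i j)"
proof -
  have [simp]: "integrable M (\<lambda>\<omega>. X i \<omega> * X j \<omega>)" if "j \<in> J" for j
    using X_product[of i j] that J i by auto
  have *: "lin J c \<omega> * X i \<omega> = (\<Sum>j\<in>J. c j * (X i \<omega> * X j \<omega>))" for \<omega>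
    unfolding lin_def sum_distrib_right by (simp add: ac_simps)
  show "integrable M (\<lambda>\<omega>. lin J c \<omega> * X i \<omega>)"
    "expectation (\<lambda>\<omega>. lin J c \<omega> * X i \<omega>) = (\<Sum>j\<in>J. c j * corr i j)"
    unfolding * corr_def by auto
qed

lemma corr_self [simp]: "1 \<le> i \<Longrightarrow> corr i i = 1"
  using X_square(2)[of i] by (simp add: corr_def power2_eq_square)

text \<open>Scales and Gaussians are merged into one family with a flagged index, so that
  \<open>char_determines_law\<close> treats their joint law at once.\<close>

definition vec :: "nat \<times> bool \<Rightarrow> 'a \<Rightarrow> real" where
  "vec k \<omega> = (if snd k then X (fst k) \<omega> else S (fst k) \<omega>)"

text \<open>Subtracting from \<open>X j\<close> its regression on \<open>X i\<close> and adding back the regression on an independent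
  copy of \<open>X i\<close> keeps the law; together with an independent copy of \<open>S i\<close> this resamples the
  coordinate \<open>i\<close> while all other coordinates move only by \<open>corr i j * (X i - X i')\<close>.\<close>

definition coupled_vec :: "nat \<Rightarrow> nat \<times> bool \<Rightarrow> 'a \<times> 'a \<Rightarrow> real" where
  "coupled_vec i k = (\<lambda>(\<omega>, \<omega>'). if snd k then X (fst k) \<omega>' + corr i (fst k) * (X i \<omega> - X i \<omega>')
     else if fst k = i then S i \<omega> else S (fst k) \<omega>')"

lemma vec_measurable: "k \<in> {1..} \<times> UNIV \<Longrightarrow> vec k \<in> borel_measurable M"
  unfolding vec_def[abs_def] by (cases "snd k") auto

lemma coupled_vec_measurable:
  assumes "1 \<le> i" "k \<in> {1..} \<times> UNIV"
  shows "coupled_vec i k \<in> borel_measurable (M \<Otimes>\<^sub>M M)"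
proof -
  have [measurable]: "X i \<in> borel_measurable M" "X (fst k) \<in> borel_measurable M"
    using assms by (auto intro!: X_measurable)
  show ?thesis unfolding coupled_vec_def case_prod_beta by measurable
qed

text \<open>A linear form in the coupled vector splits into a form in the first copy that involves
  only index \<open>i\<close> and a form in the second copy. The copies are independent, so the
  characteristic function is a product, and it remains to see that the two variances add up to the
  original one.\<close>

lemma coupled_vec_law:
  assumes J: "finite J" "J \<subseteq> {1..}" and i: "i \<in> J"
  shows "distr (M \<Otimes>\<^sub>M M) (PiM (J \<times> UNIV) (\<lambda>_. borel)) (\<lambda>z. \<lambda>k\<in>J \<times> UNIV. coupled_vec i k z) =
    distr M (PiM (J \<times> UNIV) (\<lambda>_. borel)) (\<lambda>\<omega>. \<lambda>k\<in>J \<times> UNIV. vec k \<omega>)"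
proof (rule char_determines_law)
  interpret P: pair_prob_space M M ..
  show "prob_space (M \<Otimes>\<^sub>M M)" by (rule P.prob_space_axioms)
  show "prob_space M" by (rule prob_space_axioms)
  have i1: "1 \<le> i" using i J by auto
  show "finite (J \<times> (UNIV :: bool set))" using J by simp
  show "coupled_vec i k \<in> borel_measurable (M \<Otimes>\<^sub>M M)" "vec k \<in> borel_measurable M"
    if "k \<in> J \<times> UNIV" for k
    using that J i1 by (auto intro!: vec_measurable coupled_vec_measurable)
  fix c :: "nat \<times> bool \<Rightarrow> real"
  define a where "a j = c (j, True)" for j
  define d where "d j = c (j, False)" for j
  \<comment> \<open>The covariance of the form with \<open>X i\<close>, that is its regression
    coefficient; \<open>a'\<close> is the coefficient vector of the residual.\<close>
  define \<alpha> where "\<alpha> = (\<Sum>j\<in>J. a j * corr i j)"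
  define a' where "a' j = a j - (if j = i then \<alpha> else 0)" for j
  have [measurable]: "lin K b \<in> borel_measurable M" if "K \<subseteq> J" for K b
    using that J by (intro lin_measurable) auto
  have J': "J = insert i (J - {i})" using i by auto
  have lin_a': "lin J a' \<omega> = lin J a \<omega> - \<alpha> * X i \<omega>" for \<omega>
  proof -
    have "lin J a' \<omega> = (\<Sum>j\<in>J. a j * X j \<omega>) - (\<Sum>j\<in>J. (if j = i then \<alpha> * X i \<omega> else 0))"
      unfolding lin_def a'_def sum_subtractf[symmetric] by (intro sum.cong) (auto simp: algebra_simps)
    then show ?thesis using J i by (simp add: lin_def)
  qed
  have split: "(\<Sum>k\<in>J \<times> UNIV. c k * g k) = (\<Sum>j\<in>J. a j * g (j, True)) + (\<Sum>j\<in>J. d j * g (j, False))" for g :: "nat \<times> bool \<Rightarrow> real"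
  proof -
    have "(\<Sum>k\<in>J \<times> UNIV. c k * g k) = (\<Sum>j\<in>J. \<Sum>b\<in>UNIV. c (j, b) * g (j, b))"
      by (simp add: sum.cartesian_product case_prod_beta)
    then show ?thesis
      unfolding a_def d_def by (simp add: UNIV_bool sum.distrib add.commute)
  qed
  have v: "(\<Sum>k\<in>J \<times> UNIV. c k * vec k \<omega>) = lin J a \<omega> + (\<Sum>j\<in>J. d j * S j \<omega>)" for \<omega>
    unfolding split by (simp add: vec_def lin_def)
  have cv: "(\<Sum>k\<in>J \<times> UNIV. c k * coupled_vec i k z) =
     (lin {i} (\<lambda>_. \<alpha>) (fst z) + (\<Sum>j\<in>{i}. d j * S j (fst z))) + (lin J a' (snd z) + (\<Sum>j\<in>J - {i}. d j * S j (snd z)))" for z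
  proof -
    have "(\<Sum>j\<in>J. a j * coupled_vec i (j, True) z) = lin J a (snd z) + \<alpha> * (X i (fst z) - X i (snd z))"
      by (simp add: coupled_vec_def case_prod_beta lin_def \<alpha>_def algebra_simps sum.distrib sum_subtractf sum_distrib_left)
    moreover have "(\<Sum>j\<in>J. d j * coupled_vec i (j, False) z) = d i * S i (fst z) + (\<Sum>j\<in>J - {i}. d j * S j (snd z))"
      using J i by (subst J', subst sum.insert) (auto simp: coupled_vec_def case_prod_beta)
    ultimately show ?thesis unfolding split lin_a' by (simp add: lin_def algebra_simps)
  qed
  have fub: "(CLINT z|M \<Otimes>\<^sub>M M. iexp (f (fst z) + g (snd z))) = (CLINT \<omega>|M. iexp (f \<omega>)) * (CLINT \<omega>|M. iexp (g \<omega>))"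
    if [measurable]: "f \<in> borel_measurable M" "g \<in> borel_measurable M" for f g :: "'a \<Rightarrow> real"
  proof -
    have "integrable (M \<Otimes>\<^sub>M M) (\<lambda>z. iexp (f (fst z) + g (snd z)))"
      by (intro P.integrable_const_bound[of _ 1]) (auto simp del: of_real_add)
    from P.integral_fst'[OF this] have "(CLINT z|M \<Otimes>\<^sub>M M. iexp (f (fst z) + g (snd z))) =
      (CLINT x|M. (CLINT y|M. iexp (f x + g y)))" by simp
    also have "\<dots> = (CLINT x|M. (CLINT y|M. iexp (f x) * iexp (g y)))"
      by (simp add: exp_add[symmetric] algebra_simps)
    finally show ?thesis by simp
  qed
  \<comment> \<open>Pythagoras: the residual has second moment V - 2\<alpha>^2 + \<alpha>^2, and the
    regression on the new copy of \<open>X i\<close> returns the missing \<alpha>^2.\<close>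
  have sq: "expectation (\<lambda>\<omega>. (lin {i} (\<lambda>_. \<alpha>) \<omega>)\<^sup>2) + expectation (\<lambda>\<omega>. (lin J a' \<omega>)\<^sup>2) = expectation (\<lambda>\<omega>. (lin J a \<omega>)\<^sup>2)"
  proof -
    have "expectation (\<lambda>\<omega>. (lin J a' \<omega>)\<^sup>2) =
        expectation (\<lambda>\<omega>. lin J a \<omega> * lin J a \<omega> - 2 * \<alpha> * (lin J a \<omega> * X i \<omega>) + \<alpha>\<^sup>2 * (X i \<omega>)\<^sup>2)"
      by (simp add: lin_a' power2_eq_square algebra_simps)
    also have "\<dots> = expectation (\<lambda>\<omega>. lin J a \<omega> * lin J a \<omega>) - 2 * \<alpha> * \<alpha> + \<alpha>\<^sup>2"
      using lin_product[OF J J] lin_X_expectation[OF J i1] X_square[OF i1]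
      by (simp add: \<alpha>_def)
    finally show ?thesis using X_square[OF i1]
      by (simp add: lin_def power_mult_distrib) (simp add: power2_eq_square)
  qed
  have "(CLINT z|M \<Otimes>\<^sub>M M. iexp (\<Sum>k\<in>J \<times> UNIV. c k * coupled_vec i k z)) =
     (exp (- (expectation (\<lambda>\<omega>. (lin {i} (\<lambda>_. \<alpha>) \<omega>)\<^sup>2)) / 2) * (\<Prod>k\<in>{i}. CLINT \<omega>|M. iexp (d k * S k \<omega>))) *
     (exp (- (expectation (\<lambda>\<omega>. (lin J a' \<omega>)\<^sup>2)) / 2) * (\<Prod>k\<in>J - {i}. CLINT \<omega>|M. iexp (d k * S k \<omega>)))"
  proof -
    have *: "finite {i}" "{i} \<subseteq> {1..}" "finite (J - {i})" using J i1 by auto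
    have [measurable]: "lin {i} (\<lambda>_. \<alpha>) \<in> borel_measurable M" "lin J a' \<in> borel_measurable M"
      using J * by (auto intro!: lin_measurable)
    show ?thesis
      unfolding cv joint_char[OF *(1,2,1), symmetric] joint_char[OF J *(3), symmetric]
      by (rule fub; measurable)
  qed
  also have "\<dots> = exp (- (expectation (\<lambda>\<omega>. (lin {i} (\<lambda>_. \<alpha>) \<omega>)\<^sup>2 ) + expectation (\<lambda>\<omega>. (lin J a' \<omega>)\<^sup>2)) / 2) *
      ((CLINT \<omega>|M. iexp (d i * S i \<omega>)) * (\<Prod>k\<in>J - {i}. CLINT \<omega>|M. iexp (d k * S k \<omega>)))"
    by (simp add: add_divide_distrib exp_add[symmetric] flip: of_real_mult)
  also have "\<dots> = (CLINT \<omega>|M. iexp (\<Sum>k\<in>J \<times> UNIV. c k * vec k \<omega>))"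
    unfolding v sq using J i by (subst joint_char) (auto simp: prod.remove[OF _ i])
  finally show "(CLINT z|M \<Otimes>\<^sub>M M. iexp (\<Sum>k\<in>J \<times> UNIV. c k * coupled_vec i k z)) =
    (CLINT \<omega>|M. iexp (\<Sum>k\<in>J \<times> UNIV. c k * vec k \<omega>))" .
qed

end

section \<open>Almost independence of one exceedance from the others\<close>

text \<open>The property \<Phi> may be arbitrary because the pattern takes only finitely many
  values, each on a measurable event.\<close>

lemma pred_finite_pattern:
  assumes "finite K" and [measurable]: "\<And>k. k \<in> K \<Longrightarrow> Measurable.pred N (P k)"
  shows "Measurable.pred N (\<lambda>\<omega>. \<Phi> {k \<in> K. P k \<omega>})"
proof -
  have "\<Phi> {k \<in> K. P k \<omega>} \<longleftrightarrow> (\<exists>A\<in>Pow K. \<Phi> A \<and> (\<forall>k\<in>K. P k \<omega> \<longleftrightarrow> k \<in> A))" for \<omega>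
  proof
    assume "\<Phi> {k \<in> K. P k \<omega>}"
    then show "\<exists>A\<in>Pow K. \<Phi> A \<and> (\<forall>k\<in>K. P k \<omega> \<longleftrightarrow> k \<in> A)"
      by (intro bexI[of _ "{k \<in> K. P k \<omega>}"]) auto
  next
    assume "\<exists>A\<in>Pow K. \<Phi> A \<and> (\<forall>k\<in>K. P k \<omega> \<longleftrightarrow> k \<in> A)"
    then obtain A where "A \<subseteq> K" "\<Phi> A" "\<forall>k\<in>K. P k \<omega> \<longleftrightarrow> k \<in> A" by auto
    moreover from this have "{k \<in> K. P k \<omega>} = A" by auto
    ultimately show "\<Phi> {k \<in> K. P k \<omega>}" by simp
  qed
  moreover have "Measurable.pred N (\<lambda>\<omega>. \<exists>A\<in>Pow K. \<Phi> A \<and> (\<forall>k\<in>K. P k \<omega> \<longleftrightarrow> k \<in> A))"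
    using assms(1) by (intro pred_intros_finite pred_intros_logic) auto
  ultimately show ?thesis by simp
qed

lemma (in prob_space) prob_pair_product:
  assumes [measurable]: "Measurable.pred M P" "Measurable.pred M Q"
  shows "\<P>(z in M \<Otimes>\<^sub>M M. P (fst z) \<and> Q (snd z)) = \<P>(\<omega> in M. P \<omega>) * \<P>(\<omega> in M. Q \<omega>)"
proof -
  interpret P: pair_prob_space M M ..
  have "{z \<in> space (M \<Otimes>\<^sub>M M). P (fst z) \<and> Q (snd z)} = {\<omega> \<in> space M. P \<omega>} \<times> {\<omega> \<in> space M. Q \<omega>}"
    by (auto simp: space_pair_measure)
  then show ?thesis
    by (simp add: measure_def emeasure_pair_measure_Times enn2real_mult)
qed

text \<open>By Fubini, an inequality that holds for each frozen value of \<open>A\<close> integrates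
  over the law of \<open>A\<close>. It serves to compare two events about Gaussians after
  conditioning on a scale.\<close>

lemma (in prob_space) indep_prob_mono:
  fixes A B B' :: "'a \<Rightarrow> real"
  assumes ind: "indep_var borel A borel B" "indep_var borel A borel B'"
    and [measurable]: "Measurable.pred (borel \<Otimes>\<^sub>M borel) (case_prod Q)" "Measurable.pred (borel \<Otimes>\<^sub>M borel) (case_prod Q')"
    and C: "C \<ge> 0"
    and le: "\<And>a. \<P>(\<omega> in M. Q a (B \<omega>)) \<le> C * \<P>(\<omega> in M. Q' a (B' \<omega>))"
  shows "\<P>(\<omega> in M. Q (A \<omega>) (B \<omega>)) \<le> C * \<P>(\<omega> in M. Q' (A \<omega>) (B' \<omega>))"
proof -
  have [measurable]: "A \<in> borel_measurable M" "B \<in> borel_measurable M" "B' \<in> borel_measurable M"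
    using ind by (auto dest: indep_var_rv1 indep_var_rv2)
  have *: "emeasure M {\<omega> \<in> space M. R (A \<omega>) (D \<omega>)} = (\<integral>\<^sup>+a. emeasure M {\<omega> \<in> space M. R a (D \<omega>)} \<partial>distr M borel A)"
    if D: "indep_var borel A borel D" and R[measurable]: "Measurable.pred (borel \<Otimes>\<^sub>M borel) (case_prod R)"
    for R and D :: "'a \<Rightarrow> real"
  proof -
    have [measurable]: "D \<in> borel_measurable M" using D by (auto dest: indep_var_rv2)
    interpret D: prob_space "distr M borel D" by (rule prob_space_distr) simp
    let ?E = "{p. case_prod R p}"
    have E: "?E \<in> sets (borel \<Otimes>\<^sub>M borel)"
      using R by (simp add: pred_def space_pair_measure)
    have "emeasure M {\<omega> \<in> space M. R (A \<omega>) (D \<omega>)} = emeasure (distr M (borel \<Otimes>\<^sub>M borel) (\<lambda>\<omega>. (A \<omega>, D \<omega>))) ?E"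
      using E by (subst emeasure_distr) (auto intro!: arg_cong[where f = "emeasure M"])
    also have "\<dots> = emeasure (distr M borel A \<Otimes>\<^sub>M distr M borel D) ?E"
      using D by (simp add: indep_var_distribution_eq)
    also have "\<dots> = (\<integral>\<^sup>+a. emeasure (distr M borel D) (Pair a -` ?E) \<partial>distr M borel A)"
      using E by (intro D.emeasure_pair_measure_alt) simp
    also have "\<dots> = (\<integral>\<^sup>+a. emeasure M {\<omega> \<in> space M. R a (D \<omega>)} \<partial>distr M borel A)"
    proof (intro nn_integral_cong)
      fix a
      have "Pair a -` ?E \<in> sets borel" using E by (rule sets_Pair1)
      then show "emeasure (distr M borel D) (Pair a -` ?E) = emeasure M {\<omega> \<in> space M. R a (D \<omega>)}"
        by (subst emeasure_distr) (auto intro!: arg_cong[where f = "emeasure M"])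
    qed
    finally show ?thesis .
  qed
  have "ennreal (\<P>(\<omega> in M. Q (A \<omega>) (B \<omega>))) = (\<integral>\<^sup>+a. emeasure M {\<omega> \<in> space M. Q a (B \<omega>)} \<partial>distr M borel A)"
    using *[OF ind(1)] by (simp add: emeasure_eq_measure)
  also have "\<dots> \<le> (\<integral>\<^sup>+a. ennreal C * emeasure M {\<omega> \<in> space M. Q' a (B' \<omega>)} \<partial>distr M borel A)"
    using le C by (intro nn_integral_mono) (simp add: emeasure_eq_measure ennreal_mult[symmetric])
  also have "\<dots> = ennreal C * emeasure M {\<omega> \<in> space M. Q' (A \<omega>) (B' \<omega>)}"
  proof -
    have mE: "(\<lambda>a. emeasure (distr M borel B') (Pair a -` {p. case_prod Q' p})) \<in> borel_measurable borel"
    proof -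
      interpret D: prob_space "distr M borel B'" by (rule prob_space_distr) simp
      show ?thesis using assms(4) by (intro D.measurable_emeasure_Pair) (simp add: pred_def space_pair_measure)
    qed
    have eE: "emeasure M {\<omega> \<in> space M. Q' a (B' \<omega>)} = emeasure (distr M borel B') (Pair a -` {p. case_prod Q' p})" for a
    proof -
      have "Pair a -` {p. case_prod Q' p} \<in> sets borel"
        using assms(4) by (intro sets_Pair1) (simp add: pred_def space_pair_measure)
      then show ?thesis
        by (subst emeasure_distr) (auto intro!: arg_cong[where f = "emeasure M"])
    qed
    have "(\<integral>\<^sup>+a. ennreal C * emeasure M {\<omega> \<in> space M. Q' a (B' \<omega>)} \<partial>distr M borel A) =
      ennreal C * (\<integral>\<^sup>+a. emeasure M {\<omega> \<in> space M. Q' a (B' \<omega>)} \<partial>distr M borel A)"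
      unfolding eE by (rule nn_integral_cmult) (use mE in \<open>simp only: measurable_distr_eq1\<close>)
    then show ?thesis unfolding *[OF ind(2) assms(4)] .
  qed
  also have "\<dots> = ennreal (C * \<P>(\<omega> in M. Q' (A \<omega>) (B' \<omega>)))"
    using C by (simp add: emeasure_eq_measure ennreal_mult)
  finally show ?thesis using C by (subst (asm) ennreal_le_iff) auto
qed

text \<open>The configuration \<open>w\<close> is an argument so that the same event can be read off
  \<open>vec\<close> and off \<open>coupled_vec\<close>. A point \<open>k\<close> is a pair (type,
  index), and \<open>v\<close> gives the level for each type.\<close>

definition exceeds :: "(nat \<Rightarrow> real) \<Rightarrow> (nat \<times> bool \<Rightarrow> real) \<Rightarrow> nat \<times> nat \<Rightarrow> bool" where
  "exceeds v w k \<longleftrightarrow> v (fst k) < \<xi> (fst k) (w (snd k, False) * w (snd k, True))"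

definition pattern :: "(nat \<Rightarrow> real) \<Rightarrow> nat set \<Rightarrow> (nat \<times> bool \<Rightarrow> real) \<Rightarrow> (nat \<times> nat) set" where
  "pattern v J w = {k \<in> {1, 2} \<times> J. exceeds v w k}"

lemma \<xi>_measurable [measurable]: "\<xi> d \<in> borel_measurable borel"
  unfolding \<xi>_def[abs_def] by simp

lemma pred_exceeds:
  assumes "\<And>b. (\<lambda>\<omega>. w \<omega> (snd k, b)) \<in> borel_measurable N"
  shows "Measurable.pred N (\<lambda>\<omega>. exceeds v (w \<omega>) k)"
proof -
  note [measurable] = assms
  show ?thesis unfolding exceeds_def by measurable
qed

context gaussian_scale_mixture
begin

text \<open>The second condition on \<open>Q\<close> says that it looks only at the coordinates in
  \<open>J\<close>, so unrestricted families can be inserted on both sides.\<close>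

lemma prob_coupled:
  assumes J: "finite J" "J \<subseteq> {1..}" and i: "i \<in> J"
    and Q: "Measurable.pred (PiM (J \<times> UNIV) (\<lambda>_. borel)) Q" "\<And>w. Q (restrict w (J \<times> UNIV)) = Q w"
  shows "\<P>(z in M \<Otimes>\<^sub>M M. Q (\<lambda>k. coupled_vec i k z)) = \<P>(\<omega> in M. Q (\<lambda>k. vec k \<omega>))"
proof -
  let ?P = "PiM (J \<times> UNIV) (\<lambda>_. borel :: real measure)"
  have i1: "1 \<le> i" using i J by auto
  have m1: "(\<lambda>z. \<lambda>k\<in>J \<times> UNIV. coupled_vec i k z) \<in> M \<Otimes>\<^sub>M M \<rightarrow>\<^sub>M ?P"
    using J i1 by (intro measurable_restrict coupled_vec_measurable) auto
  have m2: "(\<lambda>\<omega>. \<lambda>k\<in>J \<times> UNIV. vec k \<omega>) \<in> M \<rightarrow>\<^sub>M ?P"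
    using J i1 by (intro measurable_restrict vec_measurable) auto
  let ?E = "{w \<in> space ?P. Q w}"
  have E: "?E \<in> sets ?P" using Q(1) by simp
  have eq: "f -` ?E \<inter> space N = {z \<in> space N. Q (f z)}" if "f \<in> N \<rightarrow>\<^sub>M ?P" for f and N :: "'x measure"
    using measurable_space[OF that] by auto
  have "measure (distr (M \<Otimes>\<^sub>M M) ?P (\<lambda>z. \<lambda>k\<in>J \<times> UNIV. coupled_vec i k z)) ?E =
     measure (distr M ?P (\<lambda>\<omega>. \<lambda>k\<in>J \<times> UNIV. vec k \<omega>)) ?E"
    using coupled_vec_law[OF J i] by simp
  then show ?thesis
    unfolding measure_distr[OF m1 E] measure_distr[OF m2 E] eq[OF m1] eq[OF m2] Q(2) .
qed

text \<open>The error is recorded for each point \<open>k\<close> separately, so that a union bound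
  over \<open>k\<close> controls how far an exceedance at \<open>e\<close> influences the whole
  pattern.\<close>

definition discrepancy :: "(nat \<Rightarrow> real) \<Rightarrow> nat \<times> nat \<Rightarrow> nat \<times> nat \<Rightarrow> real" where
  "discrepancy v e k = \<P>(z in M \<Otimes>\<^sub>M M. exceeds v (\<lambda>k. vec k (fst z)) e \<and>
      exceeds v (\<lambda>k. coupled_vec (snd e) k z) k \<noteq> exceeds v (\<lambda>k. vec k (snd z)) k)"

abbreviation exceed_prob :: "(nat \<Rightarrow> real) \<Rightarrow> nat \<times> nat \<Rightarrow> real" where
  "exceed_prob v e \<equiv> \<P>(\<omega> in M. exceeds v (\<lambda>k. vec k \<omega>) e)"

lemma coupled_exceeds_self:
  "1 \<le> i \<Longrightarrow> exceeds v (\<lambda>k. coupled_vec i k z) (d, i) = exceeds v (\<lambda>k. vec k (fst z)) (d, i)"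
  by (simp add: exceeds_def coupled_vec_def vec_def case_prod_beta)

lemma pred_exceeds_vec: "1 \<le> snd k \<Longrightarrow> Measurable.pred M (\<lambda>\<omega>. exceeds v (\<lambda>k. vec k \<omega>) k)"
  by (rule pred_exceeds) (auto intro: vec_measurable)

lemma pred_exceeds_coupled:
  "1 \<le> i \<Longrightarrow> 1 \<le> snd k \<Longrightarrow> Measurable.pred (M \<Otimes>\<^sub>M M) (\<lambda>z. exceeds v (\<lambda>k. coupled_vec i k z) k)"
  by (rule pred_exceeds) (auto intro: coupled_vec_measurable)

lemma pred_pattern_vec: "finite J \<Longrightarrow> J \<subseteq> {1..} \<Longrightarrow> Measurable.pred M (\<lambda>\<omega>. \<Phi> (pattern v J (\<lambda>k. vec k \<omega>)))"
  unfolding pattern_def by (intro pred_finite_pattern pred_exceeds_vec) auto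

text \<open>At index \<open>i\<close> the coupled vector shows the first copy, so the joint
  probability may be computed with the coupled pattern. Unless some point is discrepant, that
  pattern is the one of the second copy, which is independent of the exceedance. The bound is
  uniform in \<Phi>.\<close>

lemma exceed_pattern_almost_independent:
  assumes J: "finite J" "J \<subseteq> {1..}" and i: "i \<in> J"
  shows "\<bar>\<P>(\<omega> in M. exceeds v (\<lambda>k. vec k \<omega>) (d, i) \<and> \<Phi> (pattern v (J - {i}) (\<lambda>k. vec k \<omega>))) -
      exceed_prob v (d, i) * \<P>(\<omega> in M. \<Phi> (pattern v (J - {i}) (\<lambda>k. vec k \<omega>)))\<bar>
    \<le> (\<Sum>k\<in>{1, 2} \<times> (J - {i}). discrepancy v (d, i) k)"
proof -
  interpret P: pair_prob_space M M ..
  have i1: "1 \<le> i" using i J by auto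
  let ?c = "\<lambda>z k. coupled_vec i k z"
  let ?w = "\<lambda>\<omega> k. vec k \<omega>"
  let ?K = "{1, 2::nat} \<times> (J - {i})"
  have e_meas: "Measurable.pred (PiM (J \<times> UNIV) (\<lambda>_. borel)) (\<lambda>w. exceeds v w k)" if "snd k \<in> J" for k
    using that by (intro pred_exceeds measurable_component_singleton) auto
  have [measurable]: "Measurable.pred (PiM (J \<times> UNIV) (\<lambda>_. borel)) (\<lambda>w. exceeds v w (d, i))"
    using i by (intro e_meas) auto
  have [measurable]: "Measurable.pred (PiM (J \<times> UNIV) (\<lambda>_. borel)) (\<lambda>w. \<Phi> (pattern v (J - {i}) w))"
    unfolding pattern_def using J by (intro pred_finite_pattern e_meas) auto
  have restr: "exceeds v (restrict w (J \<times> UNIV)) k = exceeds v w k" if "snd k \<in> J" for k w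
    using that by (simp add: exceeds_def)
  have restr': "pattern v (J - {i}) (restrict w (J \<times> UNIV)) = pattern v (J - {i}) w" for w
    unfolding pattern_def using restr by auto
  have 1: "\<P>(\<omega> in M. exceeds v (?w \<omega>) (d, i) \<and> \<Phi> (pattern v (J - {i}) (?w \<omega>))) =
      \<P>(z in M \<Otimes>\<^sub>M M. exceeds v (?w (fst z)) (d, i) \<and> \<Phi> (pattern v (J - {i}) (?c z)))"
    unfolding coupled_exceeds_self[OF i1, symmetric]
    by (rule prob_coupled[OF J i, symmetric]) (measurable, simp add: restr restr' i del: restrict_apply)
  have m1 [measurable]: "Measurable.pred M (\<lambda>\<omega>. exceeds v (?w \<omega>) (d, i))"
    using i1 by (intro pred_exceeds_vec) auto
  have m2 [measurable]: "Measurable.pred M (\<lambda>\<omega>. \<Phi> (pattern v (J - {i}) (?w \<omega>)))"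
    using J by (intro pred_pattern_vec) auto
  have m3 [measurable]: "Measurable.pred (M \<Otimes>\<^sub>M M) (\<lambda>z. \<Phi> (pattern v (J - {i}) (?c z)))"
    unfolding pattern_def using J i1 by (intro pred_finite_pattern pred_exceeds_coupled) auto
  have m4: "Measurable.pred (M \<Otimes>\<^sub>M M) (\<lambda>z. exceeds v (?w (fst z)) (d, i) \<and> exceeds v (?c z) k \<noteq> exceeds v (?w (snd z)) k)"
    if "k \<in> ?K" for k
  proof -
    have k: "1 \<le> snd k" using that J by auto
    note [measurable] = pred_exceeds_coupled[OF i1 k] pred_exceeds_vec[OF k]
    show ?thesis by measurable
  qed
  have 2: "exceed_prob v (d, i) * \<P>(\<omega> in M. \<Phi> (pattern v (J - {i}) (?w \<omega>))) =
      \<P>(z in M \<Otimes>\<^sub>M M. exceeds v (?w (fst z)) (d, i) \<and> \<Phi> (pattern v (J - {i}) (?w (snd z))))"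
    by (rule prob_pair_product[symmetric]) measurable
  define A where "A = {z \<in> space (M \<Otimes>\<^sub>M M). exceeds v (?w (fst z)) (d, i) \<and> \<Phi> (pattern v (J - {i}) (?c z))}"
  define B where "B = {z \<in> space (M \<Otimes>\<^sub>M M). exceeds v (?w (fst z)) (d, i) \<and> \<Phi> (pattern v (J - {i}) (?w (snd z)))}"
  define C where "C k = {z \<in> space (M \<Otimes>\<^sub>M M). exceeds v (?w (fst z)) (d, i) \<and> exceeds v (?c z) k \<noteq> exceeds v (?w (snd z)) k}" for k
  have sets: "A \<in> sets (M \<Otimes>\<^sub>M M)" "B \<in> sets (M \<Otimes>\<^sub>M M)" "\<And>k. k \<in> ?K \<Longrightarrow> C k \<in> sets (M \<Otimes>\<^sub>M M)"
  proof -
    show "A \<in> sets (M \<Otimes>\<^sub>M M)" "B \<in> sets (M \<Otimes>\<^sub>M M)" unfolding A_def B_def by measurable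
    show "C k \<in> sets (M \<Otimes>\<^sub>M M)" if "k \<in> ?K" for k using m4[OF that] unfolding C_def pred_def .
  qed
  \<comment> \<open>Outside all \<open>C k\<close> the two patterns coincide as sets, hence so do
    the values of \<Phi>.\<close>
  have sub: "A \<subseteq> B \<union> (\<Union>k\<in>?K. C k)" "B \<subseteq> A \<union> (\<Union>k\<in>?K. C k)"
  proof -
    have "pattern v (J - {i}) (?c z) = pattern v (J - {i}) (?w (snd z))"
      if "z \<in> space (M \<Otimes>\<^sub>M M)" "exceeds v (?w (fst z)) (d, i)" "z \<notin> (\<Union>k\<in>?K. C k)" for z
    proof -
      have "exceeds v (?c z) k = exceeds v (?w (snd z)) k" if "k \<in> ?K" for k
        using \<open>z \<notin> (\<Union>k\<in>?K. C k)\<close> \<open>z \<in> space (M \<Otimes>\<^sub>M M)\<close> \<open>exceeds v (?w (fst z)) (d, i)\<close> that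
        unfolding C_def by blast
      then show ?thesis unfolding pattern_def by (intro Collect_cong) (simp cong: conj_cong)
    qed
    then show "A \<subseteq> B \<union> (\<Union>k\<in>?K. C k)" "B \<subseteq> A \<union> (\<Union>k\<in>?K. C k)"
      unfolding A_def B_def by auto
  qed
  have finK: "finite ?K" using J by auto
  have U: "(\<Union>k\<in>?K. C k) \<in> sets (M \<Otimes>\<^sub>M M)" using sets finK by auto
  have Cle: "P.prob (\<Union>k\<in>?K. C k) \<le> (\<Sum>k\<in>?K. P.prob (C k))"
    using sets finK by (intro P.finite_measure_subadditive_finite) auto
  have "P.prob A \<le> P.prob B + P.prob (\<Union>k\<in>?K. C k)"
    using P.finite_measure_mono[OF sub(1)] measure_Un_le[OF sets(2) U] sets U by simp
  moreover have "P.prob B \<le> P.prob A + P.prob (\<Union>k\<in>?K. C k)"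
    using P.finite_measure_mono[OF sub(2)] measure_Un_le[OF sets(1) U] sets U by simp
  ultimately have "\<bar>P.prob A - P.prob B\<bar> \<le> (\<Sum>k\<in>?K. P.prob (C k))" using Cle by linarith
  then show ?thesis
    unfolding 1 2 discrepancy_def A_def B_def C_def by simp
qed

end

section \<open>Bounds for the discrepancies\<close>

context prob_space
begin

text \<open>Exponential tilting: to the right of \<open>a\<close> the density is at most
  \<open>exp (- a\<^sup>2 / (2 * \<sigma>\<^sup>2))\<close> times the density centred at
  \<open>a\<close>, whose total mass is 1.\<close>

lemma normal_upper_tail:
  assumes D: "distributed M lborel U (normal_density 0 \<sigma>)" and \<sigma>: "\<sigma> > 0" and a: "a \<ge> 0"
  shows "\<P>(\<omega> in M. a \<le> U \<omega>) \<le> exp (- a\<^sup>2 / (2 * \<sigma>\<^sup>2))"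
proof -
  have "emeasure M {\<omega> \<in> space M. a \<le> U \<omega>} = emeasure M (U -` {a..} \<inter> space M)"
    by (intro arg_cong[where f = "emeasure M"]) auto
  also have "\<dots> = (\<integral>\<^sup>+x. ennreal (normal_density 0 \<sigma> x) * indicator {a..} x \<partial>lborel)"
    using D by (rule distributed_emeasure) simp
  also have "\<dots> \<le> (\<integral>\<^sup>+x. ennreal (exp (- a\<^sup>2 / (2 * \<sigma>\<^sup>2))) * ennreal (normal_density a \<sigma> x) \<partial>lborel)"
  proof (intro nn_integral_mono)
    fix x
    have "normal_density 0 \<sigma> x \<le> exp (- a\<^sup>2 / (2 * \<sigma>\<^sup>2)) * normal_density a \<sigma> x" if "a \<le> x"
    proof -
      have "a * (x - a) \<ge> 0" using a that by simp
      then have "- x\<^sup>2 \<le> - a\<^sup>2 - (x - a)\<^sup>2" by (simp add: power2_eq_square algebra_simps)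
      then have "- x\<^sup>2 / (2 * \<sigma>\<^sup>2) \<le> - a\<^sup>2 / (2 * \<sigma>\<^sup>2) + - (x - a)\<^sup>2 / (2 * \<sigma>\<^sup>2)"
        unfolding add_divide_distrib[symmetric] by (intro divide_right_mono) auto
      then have "exp (- x\<^sup>2 / (2 * \<sigma>\<^sup>2)) \<le> exp (- a\<^sup>2 / (2 * \<sigma>\<^sup>2)) * exp (- (x - a)\<^sup>2 / (2 * \<sigma>\<^sup>2))"
        unfolding exp_add[symmetric] by simp
      then have "1 / sqrt (2 * pi * \<sigma>\<^sup>2) * exp (- x\<^sup>2 / (2 * \<sigma>\<^sup>2)) \<le>
          1 / sqrt (2 * pi * \<sigma>\<^sup>2) * (exp (- a\<^sup>2 / (2 * \<sigma>\<^sup>2)) * exp (- (x - a)\<^sup>2 / (2 * \<sigma>\<^sup>2)))"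
        by (intro mult_left_mono) auto
      then show ?thesis unfolding normal_density_def by (simp add: ac_simps)
    qed
    then show "ennreal (normal_density 0 \<sigma> x) * indicator {a..} x \<le>
        ennreal (exp (- a\<^sup>2 / (2 * \<sigma>\<^sup>2))) * ennreal (normal_density a \<sigma> x)"
      by (auto simp: indicator_def ennreal_mult[symmetric] intro!: ennreal_leI)
  qed
  also have "\<dots> = ennreal (exp (- a\<^sup>2 / (2 * \<sigma>\<^sup>2))) * ennreal (\<integral>x. normal_density a \<sigma> x \<partial>lborel)"
    using \<sigma> by (subst nn_integral_cmult) (auto simp: nn_integral_eq_integral)
  also have "\<dots> = ennreal (exp (- a\<^sup>2 / (2 * \<sigma>\<^sup>2)))" using \<sigma> by simp
  finally show ?thesis by (simp add: emeasure_eq_measure)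
qed

text \<open>Window length 2\<delta> times the largest density. As \<delta> t \<le> 1, the squared
  distance to the origin is at least t^2 - 2 on the window, which costs a factor e; \<sigma> \<le> 1
  helps the exponent and \<sigma> \<ge> 1/2 costs the factor 2.\<close>

lemma normal_near:
  assumes D: "distributed M lborel U (normal_density 0 \<sigma>)" and \<sigma>: "1 / 2 \<le> \<sigma>" "\<sigma> \<le> 1"
    and t: "1 \<le> t" and \<delta>: "0 \<le> \<delta>" "\<delta> * t \<le> 1"
  shows "\<P>(\<omega> in M. \<bar>U \<omega> - t\<bar> \<le> \<delta>) \<le> 4 * \<delta> / sqrt (2 * pi) * exp (1 - t\<^sup>2 / 2)"
proof -
  define C where "C = 2 / sqrt (2 * pi) * exp (1 - t\<^sup>2 / 2)"
  have C: "C \<ge> 0" by (simp add: C_def)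
  have \<delta>t: "\<delta> \<le> t"
  proof -
    have "\<delta> * 1 \<le> \<delta> * t" using t \<delta> by (intro mult_left_mono) auto
    then show ?thesis using \<delta> t by linarith
  qed
  have "emeasure M {\<omega> \<in> space M. \<bar>U \<omega> - t\<bar> \<le> \<delta>} = emeasure M (U -` {t - \<delta>..t + \<delta>} \<inter> space M)"
    by (intro arg_cong[where f = "emeasure M"]) auto
  also have "\<dots> = (\<integral>\<^sup>+x. ennreal (normal_density 0 \<sigma> x) * indicator {t - \<delta>..t + \<delta>} x \<partial>lborel)"
    using D by (rule distributed_emeasure) simp
  also have "\<dots> \<le> (\<integral>\<^sup>+x. ennreal C * indicator {t - \<delta>..t + \<delta>} x \<partial>lborel)"
  proof (intro nn_integral_mono)
    fix x
    have "normal_density 0 \<sigma> x \<le> C" if x: "t - \<delta> \<le> x"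
    proof -
      have s2: "\<sigma>\<^sup>2 \<le> 1" using \<sigma> by (simp add: power2_eq_square mult_le_one)
      have "(t - \<delta>)\<^sup>2 \<le> x\<^sup>2" using x \<delta>t by (intro power_mono) auto
      moreover have "(t - \<delta>)\<^sup>2 = t\<^sup>2 - 2 * (\<delta> * t) + \<delta>\<^sup>2" by (simp add: power2_diff)
      ultimately have "t\<^sup>2 - 2 \<le> x\<^sup>2" using \<delta>(2) zero_le_power2[of \<delta>] by linarith
      moreover have "x\<^sup>2 \<le> x\<^sup>2 / \<sigma>\<^sup>2"
        using s2 \<sigma> by (simp add: le_divide_eq mult_left_le)
      ultimately have "- x\<^sup>2 / (2 * \<sigma>\<^sup>2) \<le> 1 - t\<^sup>2 / 2" by (simp add: field_simps)
      then have e: "exp (- x\<^sup>2 / (2 * \<sigma>\<^sup>2)) \<le> exp (1 - t\<^sup>2 / 2)" by simp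
      have "sqrt (2 * pi) / 2 \<le> sqrt (2 * pi) * \<sigma>" using \<sigma> by (simp add: mult_left_mono)
      then have "1 / (sqrt (2 * pi) * \<sigma>) \<le> 1 / (sqrt (2 * pi) / 2)"
        using \<sigma> by (intro divide_left_mono) auto
      then have "1 / sqrt (2 * pi * \<sigma>\<^sup>2) \<le> 2 / sqrt (2 * pi)"
        using \<sigma> by (simp add: real_sqrt_mult)
      then show ?thesis
        unfolding normal_density_def C_def using e by (intro mult_mono) auto
    qed
    then show "ennreal (normal_density 0 \<sigma> x) * indicator {t - \<delta>..t + \<delta>} x \<le> ennreal C * indicator {t - \<delta>..t + \<delta>} x"
      by (auto simp: indicator_def intro!: ennreal_leI)
  qed
  also have "\<dots> = ennreal C * ennreal (2 * \<delta>)"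
    using \<delta> by (simp add: nn_integral_cmult)
  also have "\<dots> = ennreal (C * (2 * \<delta>))" using C \<delta> by (simp add: ennreal_mult)
  finally have "\<P>(\<omega> in M. \<bar>U \<omega> - t\<bar> \<le> \<delta>) \<le> C * (2 * \<delta>)"
    using C \<delta> by (simp add: emeasure_eq_measure)
  then show ?thesis by (simp add: C_def algebra_simps)
qed

text \<open>The mass of an interval of length \<open>h\<close> is at least \<open>h\<close> times
  the density at its far end.\<close>

lemma std_normal_tail_lower:
  assumes D: "distributed M lborel W std_normal_density" and t: "0 \<le> t" and h: "0 \<le> h"
  shows "h / sqrt (2 * pi) * exp (- (t + h)\<^sup>2 / 2) \<le> \<P>(\<omega> in M. t < W \<omega>)"
proof -
  define C where "C = 1 / sqrt (2 * pi) * exp (- (t + h)\<^sup>2 / 2)"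
  have C: "C \<ge> 0" by (simp add: C_def)
  have "ennreal (C * h) = (\<integral>\<^sup>+x. ennreal C * indicator {t<..t + h} x \<partial>lborel)"
    using h C by (simp add: nn_integral_cmult ennreal_mult)
  also have "\<dots> \<le> (\<integral>\<^sup>+x. ennreal (std_normal_density x) * indicator {t<..} x \<partial>lborel)"
  proof (intro nn_integral_mono)
    fix x
    have "C \<le> std_normal_density x" if "t < x" "x \<le> t + h"
    proof -
      have "x\<^sup>2 \<le> (t + h)\<^sup>2" using that t by (intro power_mono) auto
      then show ?thesis unfolding C_def std_normal_density_def by (intro mult_left_mono) auto
    qed
    then show "ennreal C * indicator {t<..t + h} x \<le> ennreal (std_normal_density x) * indicator {t<..} x"
      by (auto simp: indicator_def intro!: ennreal_leI)
  qed
  also have "\<dots> = emeasure M (W -` {t<..} \<inter> space M)"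
    using D by (rule distributed_emeasure[symmetric]) simp
  also have "\<dots> = emeasure M {\<omega> \<in> space M. t < W \<omega>}"
    by (intro arg_cong[where f = "emeasure M"]) auto
  finally show ?thesis by (simp add: emeasure_eq_measure C_def mult.commute)
qed

text \<open>The normal hazard rate at t is of order t, so a window of half-width \<delta> weighs
  about \<delta> t tails. The tail is bounded below with \<open>h = 1 / t\<close>, where (t + 1/t)^2
  \<le> t^2 + 3; the exponents 1 and 3/2 combine to exp (5/2) \<le> 27, and 108 = 4 * 27.\<close>

lemma normal_near_tail_ratio:
  assumes D: "distributed M lborel U (normal_density 0 \<sigma>)" and \<sigma>: "1 / 2 \<le> \<sigma>" "\<sigma> \<le> 1"
    and W: "distributed M lborel W std_normal_density"
    and t: "1 \<le> t" and \<delta>: "0 \<le> \<delta>" "\<delta> * t \<le> 1"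
  shows "\<P>(\<omega> in M. \<bar>U \<omega> - t\<bar> \<le> \<delta>) \<le> 108 * \<delta> * t * \<P>(\<omega> in M. t < W \<omega>)"
proof -
  have "(t + 1 / t)\<^sup>2 \<le> t\<^sup>2 + 3"
  proof -
    have "(1 / t)\<^sup>2 \<le> 1" using t by (simp add: power_le_one)
    then show ?thesis using t by (simp add: power2_sum)
  qed
  then have "exp (- t\<^sup>2 / 2 - 3 / 2) \<le> exp (- (t + 1 / t)\<^sup>2 / 2)" by simp
  then have "1 / t / sqrt (2 * pi) * exp (- t\<^sup>2 / 2 - 3 / 2) \<le> 1 / t / sqrt (2 * pi) * exp (- (t + 1 / t)\<^sup>2 / 2)"
    using t by (intro mult_left_mono) auto
  also have "\<dots> \<le> \<P>(\<omega> in M. t < W \<omega>)"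
    using std_normal_tail_lower[OF W, of t "1 / t"] t by simp
  finally have low: "1 / t / sqrt (2 * pi) * exp (- t\<^sup>2 / 2 - 3 / 2) \<le> \<P>(\<omega> in M. t < W \<omega>)" .
  have e: "exp (5 / 2 :: real) \<le> 27"
  proof -
    have "exp (5 / 2 :: real) \<le> exp (1 + 1 + 1)" by simp
    also have "\<dots> = exp 1 * exp 1 * exp (1 :: real)" by (simp only: exp_add)
    also have "\<dots> \<le> 3 * 3 * 3" using exp_le by (intro mult_mono) auto
    finally show ?thesis by simp
  qed
  have "4 * \<delta> / sqrt (2 * pi) * exp (1 - t\<^sup>2 / 2) =
      4 * exp (5 / 2) * \<delta> * t * (1 / t / sqrt (2 * pi) * exp (- t\<^sup>2 / 2 - 3 / 2))"
  proof -
    have "exp (1 - t\<^sup>2 / 2) = exp (5 / 2) * exp (- t\<^sup>2 / 2 - 3 / 2)"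
      unfolding exp_add[symmetric] by simp
    then show ?thesis using t by simp
  qed
  also have "\<dots> \<le> 4 * exp (5 / 2) * \<delta> * t * \<P>(\<omega> in M. t < W \<omega>)"
    using low t \<delta> by (intro mult_left_mono) auto
  also have "\<dots> \<le> (4 * 27) * \<delta> * t * \<P>(\<omega> in M. t < W \<omega>)"
    using e t \<delta> by (intro mult_right_mono) auto
  finally show ?thesis using normal_near[OF D \<sigma> t \<delta>] by simp
qed

end

context gaussian_scale_mixture
begin

lemma indep_S_lin:
  assumes "finite J" "J \<subseteq> {1..}"
  shows "indep_var borel (S k) borel (lin J c)"
proof -
  have *: "lin J c \<omega> = (\<Sum>j\<in>J. c j * (\<lambda>n\<in>{1..}. X n \<omega>) j)" for \<omega>
    unfolding lin_def using assms by (intro sum.cong) auto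
  have mg: "(\<lambda>x. \<Sum>j\<in>J. c j * x j) \<in> borel_measurable (PiM {1..} (\<lambda>_. borel))"
    using assms by (auto simp: subset_iff)
  have "indep_var borel (\<lambda>\<omega>. S k \<omega>) borel (\<lambda>\<omega>. lin J c \<omega>)"
    unfolding * using mg by (intro indep_S_X_compose[of "\<lambda>s. s k"]) auto
  then show ?thesis by simp
qed

lemma lin_single_distributed:
  assumes "1 \<le> j" "s = 1 \<or> s = - 1"
  shows "distributed M lborel (\<lambda>\<omega>. s * X j \<omega>) std_normal_density"
proof -
  have "expectation (\<lambda>\<omega>. (lin {j} (\<lambda>_. s) \<omega>)\<^sup>2) = 1"
    using X_square(2)[OF assms(1)] assms(2) by (auto simp: lin_def power_mult_distrib)
  then have "distributed M lborel (lin {j} (\<lambda>_. s)) (normal_density 0 1)"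
    using lin_distributed[of "{j}" "\<lambda>_. s"] assms by auto
  moreover have "lin {j} (\<lambda>_. s) = (\<lambda>\<omega>. s * X j \<omega>)" by (simp add: lin_def fun_eq_iff)
  ultimately show ?thesis by simp
qed

lemma lin_pair_variance:
  assumes "1 \<le> i" "1 \<le> j" "i \<noteq> j"
  shows "expectation (\<lambda>\<omega>. (lin {i, j} c \<omega>)\<^sup>2) = (c i)\<^sup>2 + (c j)\<^sup>2 + 2 * c i * c j * corr i j"
proof -
  have [simp]: "integrable M (\<lambda>\<omega>. (X i \<omega>)\<^sup>2)" "integrable M (\<lambda>\<omega>. (X j \<omega>)\<^sup>2)" "integrable M (\<lambda>\<omega>. X i \<omega> * X j \<omega>)"
    using X_square X_product assms by auto
  have "(lin {i, j} c \<omega>)\<^sup>2 = (c i)\<^sup>2 * (X i \<omega>)\<^sup>2 + (c j)\<^sup>2 * (X j \<omega>)\<^sup>2 + 2 * c i * c j * (X i \<omega> * X j \<omega>)" for \<omega>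
    using assms by (simp add: lin_def power2_eq_square algebra_simps)
  then show ?thesis using X_square assms by (simp add: corr_def)
qed

lemma lin_tail:
  assumes J: "finite J" "J \<subseteq> {1..}" and V: "expectation (\<lambda>\<omega>. (lin J c \<omega>)\<^sup>2) \<le> V" and a: "a > 0"
  shows "\<P>(\<omega> in M. a \<le> lin J c \<omega>) \<le> exp (- a\<^sup>2 / (2 * V))"
proof -
  have [measurable]: "lin J c \<in> borel_measurable M" using J by (rule_tac lin_measurable)
  from lin_distributed[OF J, of c] show ?thesis
  proof (elim disjE conjE)
    assume "AE \<omega> in M. lin J c \<omega> = 0"
    then have "AE \<omega> in M. \<not> a \<le> lin J c \<omega>" using a by auto
    then have "\<P>(\<omega> in M. a \<le> lin J c \<omega>) = 0" by (subst prob_eq_0) auto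
    then show ?thesis by simp
  next
    let ?V = "expectation (\<lambda>\<omega>. (lin J c \<omega>)\<^sup>2)"
    assume *: "?V > 0" "distributed M lborel (lin J c) (normal_density 0 (sqrt ?V))"
    have "\<P>(\<omega> in M. a \<le> lin J c \<omega>) \<le> exp (- a\<^sup>2 / (2 * (sqrt ?V)\<^sup>2))"
      using * a by (intro normal_upper_tail) auto
    also have "\<dots> \<le> exp (- a\<^sup>2 / (2 * V))"
      using * V by (simp add: frac_le)
    finally show ?thesis .
  qed
qed

end

section \<open>Discrepancies at short and at long lags\<close>

locale bounded_scale_mixture = gaussian_scale_mixture +
  assumes S_range: "1 \<le> i \<Longrightarrow> AE \<omega> in M. 0 \<le> S i \<omega> \<and> S i \<omega> \<le> 1"
begin

text \<open>Scales are at most 1, so both signed Gaussians reach \<open>m\<close> and their sum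
  reaches \<open>2 * m\<close>. Its variance is at most \<open>2 * (1 + \<theta>)\<close>, which
  gives the exponent m^2 / (1 + \<theta>), strictly better than the m^2 / 2 of one exceedance when
  \<theta> < 1.\<close>

lemma joint_exceedance_bound:
  assumes ij: "1 \<le> i" "1 \<le> j" "i \<noteq> j" and d: "d \<in> {1, 2}" "d' \<in> {1, 2}"
    and m: "0 < m" "m \<le> v d" "m \<le> v d'" and \<theta>: "\<bar>corr i j\<bar> \<le> \<theta>"
  shows "\<P>(\<omega> in M. exceeds v (\<lambda>k. vec k \<omega>) (d, i) \<and> exceeds v (\<lambda>k. vec k \<omega>) (d', j)) \<le> exp (- m\<^sup>2 / (1 + \<theta>))"
proof -
  define sg where "sg d = (if d = 1 then 1 else - 1 :: real)" for d :: nat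
  define c where "c l = (if l = i then sg d else sg d')" for l
  have J: "finite {i, j}" "{i, j} \<subseteq> {1..}" using ij by auto
  note [measurable] = lin_measurable[OF J(2)]
    pred_exceeds_vec[of "(d, i)", simplified, OF ij(1)[simplified]] pred_exceeds_vec[of "(d', j)", simplified, OF ij(2)[simplified]]
  \<comment> \<open>A positive product with a nonnegative scale forces a nonnegative signed
    Gaussian, which a scale in [0, 1] can only make smaller.\<close>
  have big: "m \<le> sg d * x" if "v d < \<xi> d (s * x)" "0 \<le> s" "s \<le> 1" "m \<le> v d" for d s x
  proof -
    have *: "v d < s * (sg d * x)" using that by (auto simp: \<xi>_def sg_def split: if_splits)
    then have "0 < s * (sg d * x)" using m that by linarith
    moreover have "0 \<le> y" if "0 < s * y" "0 \<le> s" for y using that by (auto simp: zero_less_mult_iff)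
    ultimately have "0 \<le> sg d * x" using that(2) by blast
    then have "s * (sg d * x) \<le> sg d * x" using that by (simp add: mult_left_le_one_le)
    then show ?thesis using * that by linarith
  qed
  have "\<P>(\<omega> in M. exceeds v (\<lambda>k. vec k \<omega>) (d, i) \<and> exceeds v (\<lambda>k. vec k \<omega>) (d', j)) \<le>
      \<P>(\<omega> in M. 2 * m \<le> lin {i, j} c \<omega>)"
  proof (rule finite_measure_mono_AE)
    show "AE \<omega> in M. \<omega> \<in> {\<omega> \<in> space M. exceeds v (\<lambda>k. vec k \<omega>) (d, i) \<and> exceeds v (\<lambda>k. vec k \<omega>) (d', j)} \<longrightarrow>
      \<omega> \<in> {\<omega> \<in> space M. 2 * m \<le> lin {i, j} c \<omega>}"
      using S_range[OF ij(1)] S_range[OF ij(2)]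
    proof eventually_elim
      case (elim \<omega>)
      show ?case
      proof
        assume "\<omega> \<in> {\<omega> \<in> space M. exceeds v (\<lambda>k. vec k \<omega>) (d, i) \<and> exceeds v (\<lambda>k. vec k \<omega>) (d', j)}"
        then have *: "\<omega> \<in> space M" "v d < \<xi> d (S i \<omega> * X i \<omega>)" "v d' < \<xi> d' (S j \<omega> * X j \<omega>)"
          by (auto simp: exceeds_def vec_def)
        have "m \<le> sg d * X i \<omega>" "m \<le> sg d' * X j \<omega>"
          using big[OF *(2)] big[OF *(3)] elim m by auto
        then show "\<omega> \<in> {\<omega> \<in> space M. 2 * m \<le> lin {i, j} c \<omega>}"
          using *(1) ij by (simp add: lin_def c_def)
      qed
    qed
  qed measurable
  also have "\<dots> \<le> exp (- (2 * m)\<^sup>2 / (2 * (2 * (1 + \<theta>))))"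
  proof (rule lin_tail[OF J])
    have "sg d * sg d' * corr i j \<le> \<theta>" using \<theta> by (auto simp: sg_def)
    moreover have "(sg d)\<^sup>2 = 1" "(sg d')\<^sup>2 = 1" by (auto simp: sg_def)
    ultimately show "expectation (\<lambda>\<omega>. (lin {i, j} c \<omega>)\<^sup>2) \<le> 2 * (1 + \<theta>)"
      using ij by (simp add: lin_pair_variance c_def algebra_simps)
  qed (use m in simp)
  also have "- (2 * m)\<^sup>2 / (2 * (2 * (1 + \<theta>))) = - m\<^sup>2 / (1 + \<theta>)"
  proof -
    have "- (2 * m)\<^sup>2 = 4 * (- m\<^sup>2)" "2 * (2 * (1 + \<theta>)) = 4 * (1 + \<theta>)"
      by (simp_all add: power2_eq_square)
    then show ?thesis by (simp only: mult_divide_mult_cancel_left)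
  qed
  finally show ?thesis .
qed


text \<open>A discrepancy at \<open>j\<close> requires an exceedance there in the coupled vector or
  in the second copy. The former has the original joint law with the exceedance at \<open>i\<close>;
  the latter is independent of it.\<close>

lemma discrepancy_le_joint:
  assumes ij: "1 \<le> i" "1 \<le> j" "i \<noteq> j"
  shows "discrepancy v (d, i) (d', j) \<le>
    \<P>(\<omega> in M. exceeds v (\<lambda>k. vec k \<omega>) (d, i) \<and> exceeds v (\<lambda>k. vec k \<omega>) (d', j)) +
    exceed_prob v (d, i) * exceed_prob v (d', j)"
proof -
  interpret P: pair_prob_space M M ..
  let ?w = "\<lambda>\<omega> k. vec k \<omega>"
  have m1 [measurable]: "Measurable.pred M (\<lambda>\<omega>. exceeds v (?w \<omega>) (d, i))"
    and m2 [measurable]: "Measurable.pred M (\<lambda>\<omega>. exceeds v (?w \<omega>) (d', j))"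
    using ij by (auto intro!: pred_exceeds_vec)
  have m3 [measurable]: "Measurable.pred (M \<Otimes>\<^sub>M M) (\<lambda>z. exceeds v (\<lambda>k. coupled_vec i k z) (d', j))"
    using ij by (auto intro!: pred_exceeds_coupled)
  have e_meas: "Measurable.pred (PiM ({i, j} \<times> UNIV) (\<lambda>_. borel)) (\<lambda>w. exceeds v w k)" if "snd k \<in> {i, j}" for k
    using that by (intro pred_exceeds measurable_component_singleton) auto
  have [measurable]: "Measurable.pred (PiM ({i, j} \<times> UNIV) (\<lambda>_. borel)) (\<lambda>w. exceeds v w (d, i))"
    "Measurable.pred (PiM ({i, j} \<times> UNIV) (\<lambda>_. borel)) (\<lambda>w. exceeds v w (d', j))"
    by (auto intro!: e_meas)
  have "discrepancy v (d, i) (d', j) \<le>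
     P.prob ({z \<in> space (M \<Otimes>\<^sub>M M). exceeds v (?w (fst z)) (d, i) \<and> exceeds v (\<lambda>k. coupled_vec i k z) (d', j)} \<union>
       {z \<in> space (M \<Otimes>\<^sub>M M). exceeds v (?w (fst z)) (d, i) \<and> exceeds v (?w (snd z)) (d', j)})"
    unfolding discrepancy_def by (intro P.finite_measure_mono) auto
  also have "\<dots> \<le> \<P>(z in M \<Otimes>\<^sub>M M. exceeds v (?w (fst z)) (d, i) \<and> exceeds v (\<lambda>k. coupled_vec i k z) (d', j)) +
      \<P>(z in M \<Otimes>\<^sub>M M. exceeds v (?w (fst z)) (d, i) \<and> exceeds v (?w (snd z)) (d', j))"
    by (rule measure_Un_le) measurable
  also have "\<P>(z in M \<Otimes>\<^sub>M M. exceeds v (?w (fst z)) (d, i) \<and> exceeds v (?w (snd z)) (d', j)) =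
      exceed_prob v (d, i) * exceed_prob v (d', j)"
    by (rule prob_pair_product) measurable
  also have "\<P>(z in M \<Otimes>\<^sub>M M. exceeds v (?w (fst z)) (d, i) \<and> exceeds v (\<lambda>k. coupled_vec i k z) (d', j)) =
     \<P>(\<omega> in M. exceeds v (?w \<omega>) (d, i) \<and> exceeds v (?w \<omega>) (d', j))"
    unfolding coupled_exceeds_self[OF ij(1), symmetric]
    by (rule prob_coupled[where J = "{i, j}"]) (use ij in \<open>simp_all add: exceeds_def\<close>)
  finally show ?thesis by simp
qed

text \<open>The variable compared with v / S_j is the regression residual, the part of X_j that the
  coupling leaves alone; the window bounds the shift while |X_i| < 2m. Small scales push the
  threshold up to at least 2m, which the Gaussian tail handles; for scales above 1/2 the window is
  compared with the tail, conditionally on the scale.\<close>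

lemma near_threshold_bound:
  assumes ij: "1 \<le> i" "1 \<le> j" "i \<noteq> j" and sg: "sg = 1 \<or> sg = - 1"
    and m: "1 \<le> m" "m \<le> v" "v \<le> V" and r: "\<bar>corr i j\<bar> \<le> 1 / 4" "4 * \<bar>corr i j\<bar> * V\<^sup>2 \<le> 1"
  shows "\<P>(\<omega> in M. 0 < S j \<omega> \<and> \<bar>sg * (X j \<omega> - corr i j * X i \<omega>) - v / S j \<omega>\<bar> \<le> 2 * \<bar>corr i j\<bar> * m)
    \<le> exp (- (9 / 8) * m\<^sup>2) + 432 * \<bar>corr i j\<bar> * V\<^sup>2 * \<P>(\<omega> in M. v < S j \<omega> * (sg * X j \<omega>))"
proof -
  let ?r = "corr i j"
  define c where "c l = (if l = j then sg else - sg * ?r)" for l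
  define B where "B = lin {i, j} c"
  define \<delta> where "\<delta> = 2 * \<bar>?r\<bar> * m"
  have B: "sg * (X j \<omega> - ?r * X i \<omega>) = B \<omega>" for \<omega>
    using ij by (simp add: B_def lin_def c_def algebra_simps)
  have J: "finite {i, j}" "{i, j} \<subseteq> {1..}" using ij by auto
  have [measurable]: "B \<in> borel_measurable M" unfolding B_def using J by (intro lin_measurable)
  have [measurable]: "X i \<in> borel_measurable M" "X j \<in> borel_measurable M" using ij by auto
  have r2: "?r\<^sup>2 \<le> (1 / 4)\<^sup>2"
    using r(1) by (metis abs_ge_zero power2_abs power_mono)
  have var: "expectation (\<lambda>\<omega>. (B \<omega>)\<^sup>2) = 1 - ?r\<^sup>2"
    unfolding B_def lin_pair_variance[OF ij] using ij sg
    by (auto simp: c_def power2_eq_square algebra_simps)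
  have \<delta>: "0 \<le> \<delta>" "\<delta> \<le> 2 * \<bar>?r\<bar> * V" using m unfolding \<delta>_def by (auto intro: mult_left_mono)
  have \<delta>m: "\<delta> \<le> m / 2"
  proof -
    have "\<bar>?r\<bar> * m \<le> 1 / 4 * m" using r(1) m by (intro mult_right_mono) auto
    then show ?thesis by (simp add: \<delta>_def)
  qed
  \<comment> \<open>For a scale of at most 1/2 the threshold is at least 2m, and \<delta> \<le> m/2
    leaves B \<ge> 3m/2.\<close>
  have near_cases: "3 / 2 * m \<le> B \<omega> \<or> 1 / 2 < S j \<omega>"
    if "0 < S j \<omega>" "\<bar>B \<omega> - v / S j \<omega>\<bar> \<le> \<delta>" for \<omega>
  proof (cases "1 / 2 < S j \<omega>")
    case False
    then have "2 * v \<le> v / S j \<omega>"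
      using that m by (simp add: le_divide_eq)
    then show ?thesis using that \<delta>m m by linarith
  qed simp
  have "\<P>(\<omega> in M. 0 < S j \<omega> \<and> \<bar>B \<omega> - v / S j \<omega>\<bar> \<le> \<delta>) \<le>
      prob ({\<omega> \<in> space M. 3 / 2 * m \<le> B \<omega>} \<union> {\<omega> \<in> space M. (1 / 2 < S j \<omega> \<and> S j \<omega> \<le> 1) \<and> \<bar>B \<omega> - v / S j \<omega>\<bar> \<le> \<delta>})"
    (is "prob ?A \<le> prob (?B \<union> ?C)")
  proof (rule finite_measure_mono_AE)
    show "AE \<omega> in M. \<omega> \<in> ?A \<longrightarrow> \<omega> \<in> ?B \<union> ?C"
      using S_range[OF ij(2)] by eventually_elim (use near_cases in blast)
    show "?B \<union> ?C \<in> events" by measurable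
  qed
  also have "\<dots> \<le> \<P>(\<omega> in M. 3 / 2 * m \<le> B \<omega>) + \<P>(\<omega> in M. (1 / 2 < S j \<omega> \<and> S j \<omega> \<le> 1) \<and> \<bar>B \<omega> - v / S j \<omega>\<bar> \<le> \<delta>)"
    by (rule measure_Un_le) measurable
  also have "\<P>(\<omega> in M. 3 / 2 * m \<le> B \<omega>) \<le> exp (- (3 / 2 * m)\<^sup>2 / (2 * 1))"
    unfolding B_def using var m by (intro lin_tail[OF J]) (auto simp: B_def)
  also have "- (3 / 2 * m)\<^sup>2 / (2 * 1) = - (9 / 8) * m\<^sup>2" by (simp add: power2_eq_square)
  also have "\<P>(\<omega> in M. (1 / 2 < S j \<omega> \<and> S j \<omega> \<le> 1) \<and> \<bar>B \<omega> - v / S j \<omega>\<bar> \<le> \<delta>) \<le>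
      432 * \<bar>?r\<bar> * V\<^sup>2 * \<P>(\<omega> in M. (1 / 2 < S j \<omega> \<and> S j \<omega> \<le> 1) \<and> v < S j \<omega> * lin {j} (\<lambda>_. sg) \<omega>)"
  proof (rule indep_prob_mono[where Q = "\<lambda>a b. (1 / 2 < a \<and> a \<le> 1) \<and> \<bar>b - v / a\<bar> \<le> \<delta>"
        and Q' = "\<lambda>a b. (1 / 2 < a \<and> a \<le> 1) \<and> v < a * b"])
    show "indep_var borel (S j) borel B" unfolding B_def using J by (rule indep_S_lin)
    show "indep_var borel (S j) borel (lin {j} (\<lambda>_. sg))" using ij by (intro indep_S_lin) auto
    fix a
    show "\<P>(\<omega> in M. (1 / 2 < a \<and> a \<le> 1) \<and> \<bar>B \<omega> - v / a\<bar> \<le> \<delta>) \<le>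
        432 * \<bar>?r\<bar> * V\<^sup>2 * \<P>(\<omega> in M. (1 / 2 < a \<and> a \<le> 1) \<and> v < a * lin {j} (\<lambda>_. sg) \<omega>)"
    proof (cases "1 / 2 < a \<and> a \<le> 1")
      case True
      define t where "t = v / a"
      \<comment> \<open>From a > 1/2 follows t \<le> 2V. With \<delta> \<le> 2|r|V this gives
        \<delta> t \<le> 4|r|V^2, and 432 = 108 * 4.\<close>
      have "V * 1 \<le> V * (2 * a)" using True m by (intro mult_left_mono) auto
      then have "v \<le> V * (2 * a)" using m by linarith
      then have t: "1 \<le> t" "t \<le> 2 * V" using True m by (auto simp: t_def field_simps)
      have "\<delta> * t \<le> (2 * \<bar>?r\<bar> * V) * (2 * V)" using \<delta> t m by (intro mult_mono) auto
      then have \<delta>t': "\<delta> * t \<le> 4 * \<bar>?r\<bar> * V\<^sup>2" by (simp add: power2_eq_square ac_simps)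
      then have \<delta>t: "\<delta> * t \<le> 1" using r(2) by linarith
      have D: "distributed M lborel B (normal_density 0 (sqrt (1 - ?r\<^sup>2)))"
        using lin_distributed[OF J, of c] var r2 unfolding B_def[symmetric] by (auto simp: power2_eq_square)
      \<comment> \<open>The residual has variance 1 - r^2, and |r| \<le> 1/4 puts its standard
        deviation into the range required by \<open>normal_near_tail_ratio\<close>.\<close>
      have "(1 / 2)\<^sup>2 \<le> 1 - ?r\<^sup>2" using r2 by (simp add: power_divide)
      then have s: "1 / 2 \<le> sqrt (1 - ?r\<^sup>2)" "sqrt (1 - ?r\<^sup>2) \<le> 1"
        by (rule real_le_rsqrt, simp)
      have W: "distributed M lborel (\<lambda>\<omega>. sg * X j \<omega>) std_normal_density"
        using ij sg by (intro lin_single_distributed) auto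
      have "\<P>(\<omega> in M. \<bar>B \<omega> - t\<bar> \<le> \<delta>) \<le> 108 * \<delta> * t * \<P>(\<omega> in M. t < sg * X j \<omega>)"
        by (rule normal_near_tail_ratio[OF D s W t(1) \<delta>(1) \<delta>t])
      also have "\<dots> = 108 * (\<delta> * t) * \<P>(\<omega> in M. t < sg * X j \<omega>)" by simp
      also have "\<dots> \<le> 108 * (4 * \<bar>?r\<bar> * V\<^sup>2) * \<P>(\<omega> in M. t < sg * X j \<omega>)"
        by (intro mult_right_mono mult_left_mono \<delta>t') simp_all
      also have "\<P>(\<omega> in M. t < sg * X j \<omega>) = \<P>(\<omega> in M. (1 / 2 < a \<and> a \<le> 1) \<and> v < a * lin {j} (\<lambda>_. sg) \<omega>)"
        using True by (intro arg_cong[where f = prob] Collect_cong) (auto simp: t_def lin_def field_simps)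
      finally show ?thesis using True by (simp add: t_def)
    next
      case False
      then have "(1 / 2 < a \<and> a \<le> 1) = False" by simp
      then show ?thesis by (simp only:) simp
    qed
  qed auto
  also have "\<P>(\<omega> in M. (1 / 2 < S j \<omega> \<and> S j \<omega> \<le> 1) \<and> v < S j \<omega> * lin {j} (\<lambda>_. sg) \<omega>) \<le>
      \<P>(\<omega> in M. v < S j \<omega> * (sg * X j \<omega>))"
    by (intro finite_measure_mono) (auto simp: lin_def)
  finally show ?thesis
    unfolding B \<delta>_def[symmetric] by (simp add: mult_left_mono)
qed

text \<open>While |X_i| < 2m in both copies, the shift can change the status of \<open>j\<close>
  only if the residual is near v / S_j. That event concerns the second copy alone, so it is
  independent of the exceedance at \<open>i\<close> in the first one. The two copies and the two
  signs account for the factor 4.\<close>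

lemma discrepancy_le_long:
  assumes ij: "1 \<le> i" "1 \<le> j" "i \<noteq> j" and d: "d' \<in> {1, 2}"
    and m: "1 \<le> m" "m \<le> v d'" "v d' \<le> V" and r: "\<bar>corr i j\<bar> \<le> 1 / 4" "4 * \<bar>corr i j\<bar> * V\<^sup>2 \<le> 1"
  shows "discrepancy v (d, i) (d', j) \<le> 4 * exp (- 2 * m\<^sup>2) +
    exceed_prob v (d, i) * (exp (- (9 / 8) * m\<^sup>2) + 432 * \<bar>corr i j\<bar> * V\<^sup>2 * exceed_prob v (d', j))"
proof -
  interpret P: pair_prob_space M M ..
  let ?w = "\<lambda>\<omega> k. vec k \<omega>"
  let ?r = "corr i j"
  define sg where "sg = (if d' = 1 then 1 else - 1 :: real)"
  have sg: "sg = 1 \<or> sg = - 1" by (simp add: sg_def)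
  have \<xi>: "\<xi> d' y = sg * y" for y using d by (auto simp: \<xi>_def sg_def)
  have m1 [measurable]: "Measurable.pred M (\<lambda>\<omega>. exceeds v (?w \<omega>) (d, i))"
    and m2 [measurable]: "Measurable.pred M (\<lambda>\<omega>. exceeds v (?w \<omega>) (d', j))"
    using ij by (auto intro!: pred_exceeds_vec)
  have m3 [measurable]: "Measurable.pred (M \<Otimes>\<^sub>M M) (\<lambda>z. exceeds v (\<lambda>k. coupled_vec i k z) (d', j))"
    using ij by (auto intro!: pred_exceeds_coupled)
  have [measurable]: "X i \<in> borel_measurable M" "X j \<in> borel_measurable M" using ij by auto
  define big where "big \<omega> \<longleftrightarrow> 2 * m \<le> \<bar>X i \<omega>\<bar>" for \<omega>
  define near where "near \<omega> \<longleftrightarrow> 0 < S j \<omega> \<and> \<bar>sg * (X j \<omega> - ?r * X i \<omega>) - v d' / S j \<omega>\<bar> \<le> 2 * \<bar>?r\<bar> * m" for \<omega>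
  have [measurable]: "Measurable.pred M big" "Measurable.pred M near"
    unfolding big_def[abs_def] near_def[abs_def] by measurable
  have [measurable]: "Measurable.pred M (\<lambda>\<omega>. near \<omega> \<or> S j \<omega> < 0)" by measurable
  have main: "near (snd z)"
    if "\<not> big (fst z)" "\<not> big (snd z)" "0 \<le> S j (snd z)"
      "exceeds v (\<lambda>k. coupled_vec i k z) (d', j) \<noteq> exceeds v (?w (snd z)) (d', j)" for z
  proof -
    define s where "s = S j (snd z)"
    define R where "R = sg * (X j (snd z) - ?r * X i (snd z))"
    have e1: "exceeds v (\<lambda>k. coupled_vec i k z) (d', j) \<longleftrightarrow> v d' < s * (R + sg * ?r * X i (fst z))"
      using ij by (simp add: exceeds_def coupled_vec_def case_prod_beta \<xi> s_def R_def algebra_simps)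
    have e2: "exceeds v (?w (snd z)) (d', j) \<longleftrightarrow> v d' < s * (R + sg * ?r * X i (snd z))"
      by (simp add: exceeds_def vec_def \<xi> s_def R_def algebra_simps)
    have ne: "(v d' < s * (R + sg * ?r * X i (fst z))) \<noteq> (v d' < s * (R + sg * ?r * X i (snd z)))"
      using that(4) unfolding e1 e2 .
    \<comment> \<open>For a zero scale both exceedance conditions read \<open>v d' < 0\<close> and
      cannot differ.\<close>
    then have s: "s > 0" using that(3) by (cases "s = 0") (auto simp: s_def)
    have iff: "v d' < s * y \<longleftrightarrow> v d' / s < y" for y using s by (simp add: field_simps)
    have bd: "\<bar>sg * ?r * y\<bar> \<le> 2 * \<bar>?r\<bar> * m" if "\<not> 2 * m \<le> \<bar>y\<bar>" for y
    proof -
      have "\<bar>sg * ?r * y\<bar> = \<bar>?r\<bar> * \<bar>y\<bar>" using sg by (auto simp: abs_mult)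
      also have "\<dots> \<le> \<bar>?r\<bar> * (2 * m)" using that by (intro mult_left_mono) auto
      finally show ?thesis by simp
    qed
    \<comment> \<open>The threshold separates two points, each within
      \<open>2 * \<bar>?r\<bar> * m\<close> of \<open>R\<close>, so it is itself that close to
      \<open>R\<close>.\<close>
    have "\<bar>R - v d' / s\<bar> \<le> 2 * \<bar>?r\<bar> * m"
      using ne bd[of "X i (fst z)"] bd[of "X i (snd z)"] that(1,2) unfolding iff big_def by linarith
    then show ?thesis using s unfolding near_def s_def R_def by simp
  qed
  have pbig: "\<P>(\<omega> in M. big \<omega>) \<le> 2 * exp (- 2 * m\<^sup>2)"
  proof -
    have t: "\<P>(\<omega> in M. 2 * m \<le> s * X i \<omega>) \<le> exp (- 2 * m\<^sup>2)" if "s = 1 \<or> s = - 1" for s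
      using normal_upper_tail[of "\<lambda>\<omega>. s * X i \<omega>" 1 "2 * m"] lin_single_distributed[OF ij(1) that] m
      by (simp add: power2_eq_square)
    have "\<P>(\<omega> in M. big \<omega>) \<le> prob ({\<omega> \<in> space M. 2 * m \<le> 1 * X i \<omega>} \<union> {\<omega> \<in> space M. 2 * m \<le> - 1 * X i \<omega>})"
      by (intro finite_measure_mono) (auto simp: big_def)
    also have "\<dots> \<le> \<P>(\<omega> in M. 2 * m \<le> 1 * X i \<omega>) + \<P>(\<omega> in M. 2 * m \<le> - 1 * X i \<omega>)"
      by (rule measure_Un_le) measurable
    also have "\<dots> \<le> exp (- 2 * m\<^sup>2) + exp (- 2 * m\<^sup>2)" by (intro add_mono t) auto
    finally show ?thesis by simp
  qed
  \<comment> \<open>\<open>main\<close> needs a nonnegative scale at every point, while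
    nonnegativity holds only almost surely. The exceptional null set is therefore carried along
    inside the event.\<close>
  have "AE \<omega> in M. \<not> S j \<omega> < 0" using S_range[OF ij(2)] by eventually_elim auto
  then have near: "\<P>(\<omega> in M. near \<omega> \<or> S j \<omega> < 0) = \<P>(\<omega> in M. near \<omega>)"
    by (intro finite_measure_eq_AE) (auto elim!: eventually_mono)
  have "discrepancy v (d, i) (d', j) \<le>
     P.prob (({z \<in> space (M \<Otimes>\<^sub>M M). big (fst z) \<and> True} \<union> {z \<in> space (M \<Otimes>\<^sub>M M). True \<and> big (snd z)}) \<union>
       {z \<in> space (M \<Otimes>\<^sub>M M). exceeds v (?w (fst z)) (d, i) \<and> (near (snd z) \<or> S j (snd z) < 0)})"
    unfolding discrepancy_def using main
    by (intro P.finite_measure_mono) (fastforce simp: not_less)+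
  also have "\<dots> \<le> P.prob ({z \<in> space (M \<Otimes>\<^sub>M M). big (fst z) \<and> True} \<union> {z \<in> space (M \<Otimes>\<^sub>M M). True \<and> big (snd z)}) +
       \<P>(z in M \<Otimes>\<^sub>M M. exceeds v (?w (fst z)) (d, i) \<and> (near (snd z) \<or> S j (snd z) < 0))"
    by (rule measure_Un_le) measurable
  also have "P.prob ({z \<in> space (M \<Otimes>\<^sub>M M). big (fst z) \<and> True} \<union> {z \<in> space (M \<Otimes>\<^sub>M M). True \<and> big (snd z)}) \<le>
      \<P>(z in M \<Otimes>\<^sub>M M. big (fst z) \<and> True) + \<P>(z in M \<Otimes>\<^sub>M M. True \<and> big (snd z))"
    by (rule measure_Un_le) measurable
  also have "\<P>(z in M \<Otimes>\<^sub>M M. big (fst z) \<and> True) = \<P>(\<omega> in M. big \<omega>) * \<P>(\<omega> in M. True)"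
    by (rule prob_pair_product) measurable
  also have "\<P>(z in M \<Otimes>\<^sub>M M. True \<and> big (snd z)) = \<P>(\<omega> in M. True) * \<P>(\<omega> in M. big \<omega>)"
    by (rule prob_pair_product) measurable
  also have "\<P>(z in M \<Otimes>\<^sub>M M. exceeds v (?w (fst z)) (d, i) \<and> (near (snd z) \<or> S j (snd z) < 0)) =
      exceed_prob v (d, i) * \<P>(\<omega> in M. near \<omega> \<or> S j \<omega> < 0)"
    by (rule prob_pair_product) measurable
  also have "exceed_prob v (d, i) * \<P>(\<omega> in M. near \<omega> \<or> S j \<omega> < 0) \<le>
     exceed_prob v (d, i) * (exp (- (9 / 8) * m\<^sup>2) + 432 * \<bar>?r\<bar> * V\<^sup>2 * exceed_prob v (d', j))"
  proof (intro mult_left_mono)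
    have "exceeds v (?w \<omega>) (d', j) \<longleftrightarrow> v d' < S j \<omega> * (sg * X j \<omega>)" for \<omega>
      by (simp add: exceeds_def vec_def \<xi> algebra_simps)
    then show "\<P>(\<omega> in M. near \<omega> \<or> S j \<omega> < 0) \<le> exp (- (9 / 8) * m\<^sup>2) + 432 * \<bar>?r\<bar> * V\<^sup>2 * exceed_prob v (d', j)"
      using near_threshold_bound[OF ij sg m r] unfolding near by (simp add: near_def)
  qed simp
  finally show ?thesis using pbig by (simp add: prob_space)
qed

end

section \<open>Poisson limits from an approximate Stein identity\<close>

lemma (in prob_space) prob_joint_values_le:
  fixes W :: "'b \<Rightarrow> 'a \<Rightarrow> nat"
  assumes B: "finite B" and [measurable]: "\<And>b. b \<in> B \<Longrightarrow> W b \<in> M \<rightarrow>\<^sub>M count_space UNIV"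
  shows "\<P>(\<omega> in M. \<forall>b\<in>B. W b \<omega> \<le> K) = (\<Sum>m\<in>B \<rightarrow>\<^sub>E {..K}. \<P>(\<omega> in M. \<forall>b\<in>B. W b \<omega> = m b))"
proof -
  have "{\<omega> \<in> space M. \<forall>b\<in>B. W b \<omega> \<le> K} = (\<Union>m\<in>B \<rightarrow>\<^sub>E {..K}. {\<omega> \<in> space M. \<forall>b\<in>B. W b \<omega> = m b})"
  proof (intro equalityI subsetI)
    fix \<omega> assume "\<omega> \<in> {\<omega> \<in> space M. \<forall>b\<in>B. W b \<omega> \<le> K}"
    then show "\<omega> \<in> (\<Union>m\<in>B \<rightarrow>\<^sub>E {..K}. {\<omega> \<in> space M. \<forall>b\<in>B. W b \<omega> = m b})"
      by (intro UN_I[of "\<lambda>b\<in>B. W b \<omega>"]) auto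
  qed (auto simp: PiE_iff)
  moreover have "disjoint_family_on (\<lambda>m. {\<omega> \<in> space M. \<forall>b\<in>B. W b \<omega> = m b}) (B \<rightarrow>\<^sub>E {..K})"
  proof (unfold disjoint_family_on_def, intro ballI impI)
    fix m m' assume m: "m \<in> B \<rightarrow>\<^sub>E {..K}" "m' \<in> B \<rightarrow>\<^sub>E {..K}" "m \<noteq> m'"
    then obtain b where "b \<in> B" "m b \<noteq> m' b" using PiE_ext[OF m(1,2)] by blast
    then show "{\<omega> \<in> space M. \<forall>b\<in>B. W b \<omega> = m b} \<inter> {\<omega> \<in> space M. \<forall>b\<in>B. W b \<omega> = m' b} = {}"
      by auto
  qed
  moreover have "{\<omega> \<in> space M. \<forall>b\<in>B. W b \<omega> = m b} \<in> events" for m using B by measurable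
  then have "(\<lambda>m. {\<omega> \<in> space M. \<forall>b\<in>B. W b \<omega> = m b}) ` (B \<rightarrow>\<^sub>E {..K}) \<subseteq> events" by blast
  moreover have "finite (B \<rightarrow>\<^sub>E {..K})" using B by (intro finite_PiE) auto
  ultimately show ?thesis by (simp only: finite_measure_finite_Union)
qed

text \<open>Where all counts are at most \<open>K\<close> the sum reproduces \<open>h\<close>
  exactly; elsewhere the error is at most \<open>C\<close>.\<close>

lemma (in prob_space) expectation_joint_values_approx:
  fixes W :: "'b \<Rightarrow> 'a \<Rightarrow> nat" and h :: "('b \<Rightarrow> nat) \<Rightarrow> real"
  assumes B: "finite B" and [measurable]: "\<And>b. b \<in> B \<Longrightarrow> W b \<in> M \<rightarrow>\<^sub>M count_space UNIV"
    and h: "\<And>m. \<bar>h m\<bar> \<le> C" and hm: "(\<lambda>\<omega>. h (\<lambda>b\<in>B. W b \<omega>)) \<in> borel_measurable M"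
  shows "\<bar>expectation (\<lambda>\<omega>. h (\<lambda>b\<in>B. W b \<omega>)) - (\<Sum>m\<in>B \<rightarrow>\<^sub>E {..K}. h m * \<P>(\<omega> in M. \<forall>b\<in>B. W b \<omega> = m b))\<bar>
    \<le> C * (1 - \<P>(\<omega> in M. \<forall>b\<in>B. W b \<omega> \<le> K))"
proof -
  let ?w = "\<lambda>\<omega>. \<lambda>b\<in>B. W b \<omega>"
  define E where "E = {\<omega> \<in> space M. \<forall>b\<in>B. W b \<omega> \<le> K}"
  have [measurable]: "E \<in> events" using B unfolding E_def by measurable
  have F: "finite (B \<rightarrow>\<^sub>E {..K})" using B by (intro finite_PiE) auto
  have [simp]: "integrable M (\<lambda>\<omega>. h (?w \<omega>))"
    using h hm by (intro integrable_const_bound[of _ C]) auto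
  have Em: "{\<omega> \<in> space M. \<forall>b\<in>B. W b \<omega> = m b} \<in> events" for m using B by measurable
  have i: "integrable M (\<lambda>\<omega>. indicator {\<omega> \<in> space M. \<forall>b\<in>B. W b \<omega> = m b} \<omega> * h m)" for m
    using Em by (intro integrable_mult_left) (simp add: emeasure_eq_measure)
  have "h (?w \<omega>) * indicator E \<omega> = (\<Sum>m\<in>B \<rightarrow>\<^sub>E {..K}. indicator {\<omega> \<in> space M. \<forall>b\<in>B. W b \<omega> = m b} \<omega> * h m)"
    if sp: "\<omega> \<in> space M" for \<omega>
  proof (cases "\<omega> \<in> E")
    case True
    then have w: "?w \<omega> \<in> B \<rightarrow>\<^sub>E {..K}" by (auto simp: E_def)
    have "(\<Sum>m\<in>B \<rightarrow>\<^sub>E {..K}. indicator {\<omega> \<in> space M. \<forall>b\<in>B. W b \<omega> = m b} \<omega> * h m) =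
        (\<Sum>m\<in>B \<rightarrow>\<^sub>E {..K}. if m = ?w \<omega> then h m else 0)"
    proof (intro sum.cong refl)
      fix m assume "m \<in> B \<rightarrow>\<^sub>E {..K}"
      then have "(\<forall>b\<in>B. W b \<omega> = m b) \<longleftrightarrow> m = ?w \<omega>"
        by (auto simp: PiE_iff intro: extensionalityI[where A = B])
      then show "indicator {\<omega> \<in> space M. \<forall>b\<in>B. W b \<omega> = m b} \<omega> * h m = (if m = ?w \<omega> then h m else 0)"
        using sp by (simp add: indicator_def)
    qed
    then show ?thesis using w F True by simp
  next
    case False
    then obtain b where "b \<in> B" "\<not> W b \<omega> \<le> K" using sp by (auto simp: E_def)
    then have "indicator {\<omega> \<in> space M. \<forall>b\<in>B. W b \<omega> = m b} \<omega> = (0 :: real)" if "m \<in> B \<rightarrow>\<^sub>E {..K}" for m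
    proof -
      have "W b \<omega> \<noteq> m b" using PiE_mem[OF that \<open>b \<in> B\<close>] \<open>\<not> W b \<omega> \<le> K\<close> by auto
      then show ?thesis using \<open>b \<in> B\<close> by (intro indicator_simps(2)) auto
    qed
    then show ?thesis using False by simp
  qed
  then have "expectation (\<lambda>\<omega>. h (?w \<omega>) * indicator E \<omega>) =
      expectation (\<lambda>\<omega>. \<Sum>m\<in>B \<rightarrow>\<^sub>E {..K}. indicator {\<omega> \<in> space M. \<forall>b\<in>B. W b \<omega> = m b} \<omega> * h m)"
    by (intro Bochner_Integration.integral_cong) auto
  also have "\<dots> = (\<Sum>m\<in>B \<rightarrow>\<^sub>E {..K}. h m * \<P>(\<omega> in M. \<forall>b\<in>B. W b \<omega> = m b))"
    using i Em by (simp add: Bochner_Integration.integral_sum mult.commute)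
  finally have s: "(\<Sum>m\<in>B \<rightarrow>\<^sub>E {..K}. h m * \<P>(\<omega> in M. \<forall>b\<in>B. W b \<omega> = m b)) = expectation (\<lambda>\<omega>. h (?w \<omega>) * indicator E \<omega>)" ..
  have iE: "integrable M (\<lambda>\<omega>. h (?w \<omega>) * indicator E \<omega>)"
    by (rule Bochner_Integration.integrable_bound[of M "\<lambda>\<omega>. h (?w \<omega>)"]) (use hm in \<open>auto simp: indicator_def\<close>)
  have "expectation (\<lambda>\<omega>. h (?w \<omega>)) - expectation (\<lambda>\<omega>. h (?w \<omega>) * indicator E \<omega>) =
      expectation (\<lambda>\<omega>. h (?w \<omega>) - h (?w \<omega>) * indicator E \<omega>)"
    using iE by simp
  also have "\<bar>\<dots>\<bar> \<le> expectation (\<lambda>\<omega>. \<bar>h (?w \<omega>) - h (?w \<omega>) * indicator E \<omega>\<bar>)"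
    by (rule integral_abs_bound)
  also have "\<dots> \<le> expectation (\<lambda>\<omega>. C * (1 - indicator E \<omega>))"
  proof (rule integral_mono)
    show "integrable M (\<lambda>\<omega>. \<bar>h (?w \<omega>) - h (?w \<omega>) * indicator E \<omega>\<bar>)"
      using iE by simp
    have "integrable M (indicator E :: 'a \<Rightarrow> real)" by (simp add: emeasure_eq_measure)
    then show "integrable M (\<lambda>\<omega>. C * (1 - indicator E \<omega>))"
      by (intro integrable_mult_right Bochner_Integration.integrable_diff) auto
    show "\<bar>h (?w \<omega>) - h (?w \<omega>) * indicator E \<omega>\<bar> \<le> C * (1 - indicator E \<omega>)" for \<omega>
      using h by (cases "\<omega> \<in> E") auto
  qed
  also have "\<dots> = C * (1 - prob E)"
    by (simp add: emeasure_eq_measure prob_space)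
  finally show ?thesis unfolding s E_def .
qed

text \<open>Multiplying out the product over \<open>B\<close> of truncated exponential series gives
  the sum over the box.\<close>

lemma prod_exp_partial_sums:
  fixes \<mu> :: "'b \<Rightarrow> real"
  assumes "finite B"
  shows "(\<lambda>K. \<Sum>m\<in>B \<rightarrow>\<^sub>E {..K}. \<Prod>b\<in>B. \<mu> b ^ m b / fact (m b)) \<longlonglongrightarrow> (\<Prod>b\<in>B. exp (\<mu> b))"
proof -
  have "(\<lambda>K. \<Sum>k\<le>K. \<mu> b ^ k / fact k) \<longlonglongrightarrow> exp (\<mu> b)" for b
    using exp_converges[of "\<mu> b"] by (simp add: sums_def_le divide_inverse ac_simps)
  then have "(\<lambda>K. \<Prod>b\<in>B. \<Sum>k\<le>K. \<mu> b ^ k / fact k) \<longlonglongrightarrow> (\<Prod>b\<in>B. exp (\<mu> b))"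
    by (intro tendsto_prod)
  then show ?thesis
    using assms by (simp add: prod_sum_PiE)
qed

text \<open>The Stein identity \<open>E [W b * h W] = \<mu> b * E [h (W + e\<^sub>b)]\<close> for indicators \<open>h\<close> determines
  the law of \<open>W\<close> up to a factor, which tightness then fixes.\<close>

theorem (in prob_space) poisson_limit_from_recursion:
  fixes W :: "nat \<Rightarrow> 'b \<Rightarrow> 'a \<Rightarrow> nat" and \<mu> :: "'b \<Rightarrow> real"
  defines "q \<equiv> \<lambda>B n m. \<P>(\<omega> in M. \<forall>b\<in>B. W n b \<omega> = m b)"
  assumes B: "finite B" and meas [measurable]: "\<And>n b. b \<in> B \<Longrightarrow> W n b \<in> M \<rightarrow>\<^sub>M count_space UNIV"
    and rec: "\<And>m b. b \<in> B \<Longrightarrow> (\<lambda>n. real (m b + 1) * q B n (m(b := m b + 1)) - \<mu> b * q B n m) \<longlonglongrightarrow> 0"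
    and tight: "\<And>K. eventually (\<lambda>n. 1 - C / real (K + 1) \<le> \<P>(\<omega> in M. \<forall>b\<in>B. W n b \<omega> \<le> K)) sequentially"
  shows "(\<lambda>n. q B n m) \<longlonglongrightarrow> (\<Prod>b\<in>B. \<mu> b ^ m b / fact (m b) * exp (- \<mu> b))"
proof -
  define w where "w m = (\<Prod>b\<in>B. \<mu> b ^ m b / fact (m b))" for m
  define q0 where "q0 n = q B n (\<lambda>_. 0)" for n
  \<comment> \<open>Removing one unit from coordinate \<open>b\<close> multiplies by
    \<open>\<mu> b / real (m b)\<close>. Going down to the zero vector in this way shows that all
    values are asymptotically \<open>q0\<close> times the Poisson weight without its exponential
    factor.\<close>
  have step: "(\<lambda>n. q B n m - w m * q0 n) \<longlonglongrightarrow> 0" for m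
  proof (induction "\<Sum>b\<in>B. m b" arbitrary: m)
    case 0
    then have "\<forall>b\<in>B. m b = 0" using B by simp
    then have "q B n m = q0 n" "w m = 1" for n by (simp_all add: q_def q0_def w_def)
    then show ?case by simp
  next
    case (Suc s)
    then have "\<exists>b\<in>B. m b \<noteq> 0" using B by (metis nat.simps(3) sum.neutral)
    then obtain b where b: "b \<in> B" "m b > 0" by auto
    define m' where "m' = m(b := m b - 1)"
    have m: "m = m'(b := m' b + 1)" using b by (auto simp: m'_def)
    have "(\<Sum>b\<in>B. m b) = Suc (\<Sum>b\<in>B. m' b)"
      using b B by (simp add: sum.remove[OF B b(1)] m'_def)
    then have IH: "(\<lambda>n. q B n m' - w m' * q0 n) \<longlonglongrightarrow> 0" using Suc by simp
    have "w m = (\<Prod>b\<in>B - {b}. \<mu> b ^ m' b / fact (m' b)) * (\<mu> b ^ m b / fact (m b))"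
      unfolding w_def by (subst prod.remove[OF B b(1)]) (auto simp: m'_def intro!: prod.cong)
    also have "\<mu> b ^ m b / fact (m b) = \<mu> b / real (m b) * (\<mu> b ^ m' b / fact (m' b))"
      using b by (cases "m b") (auto simp: m'_def field_simps)
    finally have w: "w m = \<mu> b / real (m b) * w m'"
      unfolding w_def[of m'] by (subst prod.remove[OF B b(1)]) (simp add: ac_simps)
    have "(\<lambda>n. (real (m' b + 1) * q B n m - \<mu> b * q B n m') / real (m b) + \<mu> b / real (m b) * (q B n m' - w m' * q0 n))
        \<longlonglongrightarrow> 0 / real (m b) + \<mu> b / real (m b) * 0"
      using rec[OF b(1), of m'] IH b unfolding m[symmetric] by (intro tendsto_intros) auto
    moreover have "real (m' b + 1) = real (m b)" using b by (simp add: m'_def)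
    ultimately show ?case
      using b by (simp add: w diff_divide_distrib right_diff_distrib mult.assoc)
  qed
  define E where "E = (\<Prod>b\<in>B. exp (\<mu> b))"
  have E: "E > 0" unfolding E_def by (intro prod_pos) auto
  define T where "T K = (\<Sum>m\<in>B \<rightarrow>\<^sub>E {..K}. w m)" for K
  have T: "T \<longlonglongrightarrow> E" unfolding T_def[abs_def] E_def w_def by (rule prod_exp_partial_sums[OF B])
  have q01: "0 \<le> q0 n" "q0 n \<le> 1" for n by (auto simp: q0_def q_def)
  \<comment> \<open>The proportionality constant comes from total mass: the box up to
    \<open>K\<close> has probability near \<open>T K * q0 n\<close> and, by tightness, near 1, while
    \<open>T K\<close> tends to \<open>E\<close>.\<close>
  have "(\<lambda>n. q0 n * E) \<longlonglongrightarrow> 1"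
  proof (rule LIMSEQ_I)
    fix r :: real assume r: "r > 0"
    have "(\<lambda>K. \<bar>E - T K\<bar> + C / real (K + 1)) \<longlonglongrightarrow> \<bar>E - E\<bar> + 0"
      using T LIMSEQ_Suc[OF lim_const_over_n[of C]] by (intro tendsto_intros) auto
    then have "eventually (\<lambda>K. \<bar>E - T K\<bar> + C / real (K + 1) < r / 2) sequentially"
      using r by (intro order_tendstoD(2)[where y = "0 :: real"]) auto
    then obtain K where K: "\<bar>E - T K\<bar> + C / real (K + 1) < r / 2"
      using eventually_happens'[OF sequentially_bot] by blast
    have "(\<lambda>n. \<Sum>m\<in>B \<rightarrow>\<^sub>E {..K}. q B n m - w m * q0 n) \<longlonglongrightarrow> (\<Sum>m\<in>B \<rightarrow>\<^sub>E {..K}. 0)"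
      by (intro tendsto_sum step)
    then have "(\<lambda>n. \<P>(\<omega> in M. \<forall>b\<in>B. W n b \<omega> \<le> K) - T K * q0 n) \<longlonglongrightarrow> 0"
      using B by (simp add: prob_joint_values_le q_def sum_subtractf T_def sum_distrib_right)
    then have "eventually (\<lambda>n. \<bar>\<P>(\<omega> in M. \<forall>b\<in>B. W n b \<omega> \<le> K) - T K * q0 n\<bar> < r / 2) sequentially"
      using r unfolding tendsto_iff dist_real_def by (auto dest!: spec[of _ "r / 2"])
    with tight[of K] have "eventually (\<lambda>n. norm (q0 n * E - 1) < r) sequentially"
    proof eventually_elim
      case (elim n)
      let ?P = "\<P>(\<omega> in M. \<forall>b\<in>B. W n b \<omega> \<le> K)"
      have "\<bar>q0 n * (E - T K)\<bar> \<le> \<bar>E - T K\<bar>"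
        using q01[of n] by (simp add: abs_mult mult_left_le_one_le)
      moreover have "?P \<le> 1" by simp
      moreover have "q0 n * E - 1 = q0 n * (E - T K) - (?P - T K * q0 n) + (?P - 1)"
        by (simp add: algebra_simps)
      ultimately show ?case using elim K unfolding real_norm_def by linarith
    qed
    then show "\<exists>no. \<forall>n\<ge>no. norm (q0 n * E - 1) < r"
      by (simp add: eventually_sequentially)
  qed
  then have "(\<lambda>n. q0 n * E / E) \<longlonglongrightarrow> 1 / E" using E by (intro tendsto_intros) auto
  then have q0: "q0 \<longlonglongrightarrow> 1 / E" using E by simp
  have "(\<lambda>n. (q B n m - w m * q0 n) + w m * q0 n) \<longlonglongrightarrow> 0 + w m * (1 / E)"
    by (intro tendsto_intros step q0)
  also have "w m * (1 / E) = (\<Prod>b\<in>B. \<mu> b ^ m b / fact (m b) * exp (- \<mu> b))"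
  proof -
    have "(\<Prod>b\<in>B. exp (- \<mu> b)) = 1 / E"
      unfolding E_def exp_sum[OF B, symmetric] sum_negf by (simp add: exp_minus divide_inverse)
    then show ?thesis by (simp only: w_def prod.distrib)
  qed
  finally show ?thesis by simp
qed

text \<open>The cut-off \<open>K\<close> is chosen for the limit law. The mass of the box is a
  finite sum of converging point probabilities, so the same \<open>K\<close> eventually works for
  \<open>W n\<close>; boundedness of \<open>h\<close> does the rest.\<close>

lemma expectation_converges_from_joint_values:
  fixes W :: "nat \<Rightarrow> 'b \<Rightarrow> 'a \<Rightarrow> nat" and W' :: "'b \<Rightarrow> 'c \<Rightarrow> nat" and h :: "('b \<Rightarrow> nat) \<Rightarrow> real"
  assumes "prob_space M" "prob_space Q" and B: "finite B"
    and m1 [measurable]: "\<And>n b. b \<in> B \<Longrightarrow> W n b \<in> M \<rightarrow>\<^sub>M count_space UNIV"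
    and m2 [measurable]: "\<And>b. b \<in> B \<Longrightarrow> W' b \<in> Q \<rightarrow>\<^sub>M count_space UNIV"
    and h: "\<And>m. \<bar>h m\<bar> \<le> C"
    and hm: "\<And>n. (\<lambda>\<omega>. h (\<lambda>b\<in>B. W n b \<omega>)) \<in> borel_measurable M" "(\<lambda>\<omega>. h (\<lambda>b\<in>B. W' b \<omega>)) \<in> borel_measurable Q"
    and lim: "\<And>m. (\<lambda>n. \<P>(\<omega> in M. \<forall>b\<in>B. W n b \<omega> = m b)) \<longlonglongrightarrow> \<P>(\<omega> in Q. \<forall>b\<in>B. W' b \<omega> = m b)"
  shows "(\<lambda>n. \<integral>\<omega>. h (\<lambda>b\<in>B. W n b \<omega>) \<partial>M) \<longlonglongrightarrow> (\<integral>\<omega>. h (\<lambda>b\<in>B. W' b \<omega>) \<partial>Q)"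
proof (rule LIMSEQ_I)
  interpret M: prob_space M by fact
  interpret Q: prob_space Q by fact
  fix r :: real assume r: "r > 0"
  have C: "C \<ge> 0" using h[of undefined] by linarith
  have "(\<lambda>K. \<P>(\<omega> in Q. \<forall>b\<in>B. W' b \<omega> \<le> K)) \<longlonglongrightarrow> Q.prob (\<Union>K. {\<omega> \<in> space Q. \<forall>b\<in>B. W' b \<omega> \<le> K})"
    using B by (intro Q.finite_Lim_measure_incseq) (auto simp: incseq_def intro: order_trans)
  also have "(\<Union>K. {\<omega> \<in> space Q. \<forall>b\<in>B. W' b \<omega> \<le> K}) = space Q"
  proof (intro equalityI subsetI)
    fix \<omega> assume "\<omega> \<in> space Q"
    then show "\<omega> \<in> (\<Union>K. {\<omega> \<in> space Q. \<forall>b\<in>B. W' b \<omega> \<le> K})"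
      using B by (intro UN_I[of "\<Sum>b\<in>B. W' b \<omega>"]) (auto intro: member_le_sum)
  qed auto
  finally have "(\<lambda>K. C * (1 - \<P>(\<omega> in Q. \<forall>b\<in>B. W' b \<omega> \<le> K))) \<longlonglongrightarrow> C * (1 - 1)"
    by (intro tendsto_intros) (simp add: Q.prob_space)
  then have "eventually (\<lambda>K. C * (1 - \<P>(\<omega> in Q. \<forall>b\<in>B. W' b \<omega> \<le> K)) < r / 4) sequentially"
    using r by (intro order_tendstoD(2)[where y = "0 :: real"]) auto
  then obtain K where K: "C * (1 - \<P>(\<omega> in Q. \<forall>b\<in>B. W' b \<omega> \<le> K)) < r / 4"
    using eventually_happens'[OF sequentially_bot] by blast
  let ?F = "B \<rightarrow>\<^sub>E {..K}"
  have "(\<lambda>n. C * (1 - (\<Sum>m\<in>?F. \<P>(\<omega> in M. \<forall>b\<in>B. W n b \<omega> = m b)))) \<longlonglongrightarrow>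
      C * (1 - (\<Sum>m\<in>?F. \<P>(\<omega> in Q. \<forall>b\<in>B. W' b \<omega> = m b)))"
    by (intro tendsto_intros lim)
  then have "(\<lambda>n. C * (1 - \<P>(\<omega> in M. \<forall>b\<in>B. W n b \<omega> \<le> K))) \<longlonglongrightarrow> C * (1 - \<P>(\<omega> in Q. \<forall>b\<in>B. W' b \<omega> \<le> K))"
    using B by (simp add: M.prob_joint_values_le Q.prob_joint_values_le)
  from order_tendstoD(2)[OF this K]
  have e1: "eventually (\<lambda>n. C * (1 - \<P>(\<omega> in M. \<forall>b\<in>B. W n b \<omega> \<le> K)) < r / 4) sequentially" .
  have "(\<lambda>n. \<Sum>m\<in>?F. h m * \<P>(\<omega> in M. \<forall>b\<in>B. W n b \<omega> = m b)) \<longlonglongrightarrow> (\<Sum>m\<in>?F. h m * \<P>(\<omega> in Q. \<forall>b\<in>B. W' b \<omega> = m b))"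
    by (intro tendsto_intros lim)
  then have "eventually (\<lambda>n. \<bar>(\<Sum>m\<in>?F. h m * \<P>(\<omega> in M. \<forall>b\<in>B. W n b \<omega> = m b)) -
      (\<Sum>m\<in>?F. h m * \<P>(\<omega> in Q. \<forall>b\<in>B. W' b \<omega> = m b))\<bar> < r / 4) sequentially"
    using r unfolding tendsto_iff dist_real_def by (auto dest!: spec[of _ "r / 4"])
  with e1 have "eventually (\<lambda>n. norm ((\<integral>\<omega>. h (\<lambda>b\<in>B. W n b \<omega>) \<partial>M) - (\<integral>\<omega>. h (\<lambda>b\<in>B. W' b \<omega>) \<partial>Q)) < r) sequentially"
  proof eventually_elim
    case (elim n)
    show ?case
      using elim K M.expectation_joint_values_approx[OF B m1 h hm(1), of n K]
        Q.expectation_joint_values_approx[OF B m2 h hm(2), of K]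
      unfolding real_norm_def by linarith
  qed
  then show "\<exists>no. \<forall>n\<ge>no. norm ((\<integral>\<omega>. h (\<lambda>b\<in>B. W n b \<omega>) \<partial>M) - (\<integral>\<omega>. h (\<lambda>b\<in>B. W' b \<omega>) \<partial>Q)) < r"
    by (simp add: eventually_sequentially)
qed

section \<open>Counting exceedances\<close>

context gaussian_scale_mixture
begin

abbreviation pat :: "(nat \<Rightarrow> real) \<Rightarrow> nat set \<Rightarrow> 'a \<Rightarrow> (nat \<times> nat) set" where
  "pat v J \<omega> \<equiv> pattern v J (\<lambda>k. vec k \<omega>)"

lemma finite_pattern: "finite J \<Longrightarrow> finite (pattern v J w)"
  by (rule finite_subset[of _ "{1, 2} \<times> J"]) (auto simp: pattern_def)

lemma exceed_exclusive:
  assumes "v 1 > 0" "v 2 > 0" "d \<in> {1, 2}" "d' \<in> {1, 2}" "exceeds v w (d, i)" "exceeds v w (d', i)"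
  shows "d = d'"
  using assms by (auto simp: exceeds_def \<xi>_def)

text \<open>Positive levels cannot be exceeded by y and by -y at once, so an index contributes at
  most one point.\<close>

lemma pattern_insert:
  assumes v: "v 1 > 0" "v 2 > 0" and e: "(d, i) \<in> pattern v J w"
  shows "pattern v J w = insert (d, i) (pattern v (J - {i}) w)" "(d, i) \<notin> pattern v (J - {i}) w"
proof -
  have "(d', i) \<in> pattern v J w \<Longrightarrow> d' = d" for d'
    using e exceed_exclusive[of v d' d w i] v by (auto simp: pattern_def)
  then show "pattern v J w = insert (d, i) (pattern v (J - {i}) w)"
    using e by (auto simp: pattern_def)
  show "(d, i) \<notin> pattern v (J - {i}) w" by (auto simp: pattern_def)
qed

text \<open>A finite Stein or Mecke identity. Count the points of \<open>C b\<close> on the event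
  with \<open>m b + 1\<close> of them; for each such point delete its index, decouple the exceedance
  from the remaining pattern, and put the index back. The decoupling costs discrepancies, the
  restoration products of exceedance probabilities.\<close>

lemma count_recursion:
  fixes C :: "'b \<Rightarrow> (nat \<times> nat) set" and m :: "'b \<Rightarrow> nat"
  assumes J: "finite J" "J \<subseteq> {1..}" and v: "v 1 > 0" "v 2 > 0"
    and C: "\<And>b. b \<in> B \<Longrightarrow> C b \<subseteq> {1, 2} \<times> J" "disjoint_family_on C B" and b: "b \<in> B"
  defines "P \<equiv> \<lambda>m. \<P>(\<omega> in M. \<forall>b\<in>B. card (pat v J \<omega> \<inter> C b) = m b)"
  shows "\<bar>real (m b + 1) * P (m(b := m b + 1)) - (\<Sum>e\<in>C b. exceed_prob v e) * P m\<bar> \<le>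
    (\<Sum>e\<in>{1, 2} \<times> J. (\<Sum>k\<in>{1, 2} \<times> (J - {snd e}). discrepancy v e k) +
       exceed_prob v e * (exceed_prob v (1, snd e) + exceed_prob v (2, snd e)))"
proof -
  define ev where "ev m A \<longleftrightarrow> (\<forall>b\<in>B. card (A \<inter> C b) = m b)" for m :: "'b \<Rightarrow> nat" and A
  define m1 where "m1 = m(b := m b + 1)"
  define err where "err e = (\<Sum>k\<in>{1, 2} \<times> (J - {snd e}). discrepancy v e k) +
       exceed_prob v e * (exceed_prob v (1, snd e) + exceed_prob v (2, snd e))" for e
  have err0: "err e \<ge> 0" for e
    unfolding err_def discrepancy_def by (intro add_nonneg_nonneg sum_nonneg mult_nonneg_nonneg) auto
  have finC: "finite (C b)" using C(1)[OF b] J finite_subset by blast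
  have Pm: "P m = \<P>(\<omega> in M. ev m (pat v J \<omega>))" for m unfolding P_def ev_def ..
  have meas [measurable]: "Measurable.pred M (\<lambda>\<omega>. \<Phi> (pat v K \<omega>))" if "K \<subseteq> J" for K \<Phi>
    using J that by (intro pred_pattern_vec) (auto intro: finite_subset)
  have e_meas: "Measurable.pred M (\<lambda>\<omega>. exceeds v (\<lambda>k. vec k \<omega>) e)" if "snd e \<in> J" for e
    using J that by (intro pred_exceeds_vec) auto
  have in_pat: "e \<in> pat v J \<omega> \<longleftrightarrow> exceeds v (\<lambda>k. vec k \<omega>) e" if "e \<in> {1, 2} \<times> J" for e \<omega>
    using that by (simp add: pattern_def)
  \<comment> \<open>On the event the count in \<open>C b\<close> is exactly \<open>m b + 1\<close>,
    which is the number of summands equal to one.\<close>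
  have 1: "real (m b + 1) * P m1 = (\<Sum>e\<in>C b. \<P>(\<omega> in M. e \<in> pat v J \<omega> \<and> ev m1 (pat v J \<omega>)))"
  proof -
    have E: "{\<omega> \<in> space M. \<Phi> (pat v J \<omega>)} \<in> events" for \<Phi> using meas[of J \<Phi>] by (simp add: pred_def)
    have "real (m b + 1) * indicator {\<omega> \<in> space M. ev m1 (pat v J \<omega>)} \<omega> =
       (\<Sum>e\<in>C b. indicator {\<omega> \<in> space M. e \<in> pat v J \<omega> \<and> ev m1 (pat v J \<omega>)} \<omega>)" if "\<omega> \<in> space M" for \<omega>
    proof (cases "ev m1 (pat v J \<omega>)")
      case True
      then have "card (C b \<inter> pat v J \<omega>) = m b + 1" using b by (auto simp: ev_def m1_def Int_commute)
      then show ?thesis using True that finC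
        by (simp add: indicator_def sum.If_cases of_bool_def Int_def flip: of_nat_Suc)
    qed simp
    then have "expectation (\<lambda>\<omega>. real (m b + 1) * indicator {\<omega> \<in> space M. ev m1 (pat v J \<omega>)} \<omega>) =
        expectation (\<lambda>\<omega>. \<Sum>e\<in>C b. indicator {\<omega> \<in> space M. e \<in> pat v J \<omega> \<and> ev m1 (pat v J \<omega>)} \<omega>)"
      by (intro Bochner_Integration.integral_cong) auto
    also have "\<dots> = (\<Sum>e\<in>C b. \<P>(\<omega> in M. e \<in> pat v J \<omega> \<and> ev m1 (pat v J \<omega>)))"
      using E[of "\<lambda>A. _ \<in> A \<and> ev m1 A"] by (subst Bochner_Integration.integral_sum) (auto simp: emeasure_eq_measure)
    finally show ?thesis using E[of "ev m1"] unfolding Pm by simp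
  qed
  have 2: "\<bar>\<P>(\<omega> in M. e \<in> pat v J \<omega> \<and> ev m1 (pat v J \<omega>)) - exceed_prob v e * P m\<bar> \<le> err e" if e: "e \<in> C b" for e
  proof -
    obtain d i where di: "e = (d, i)" "d \<in> {1, 2}" "i \<in> J" using e C(1)[OF b] by (cases e) auto
    \<comment> \<open>Deleting index \<open>i\<close> lowers the count of cell \<open>b\<close> by
      one and no other: the cells are disjoint, and \<open>e\<close> is the only point at that
      index.\<close>
    have "e \<in> pat v J \<omega> \<and> ev m1 (pat v J \<omega>) \<longleftrightarrow> exceeds v (\<lambda>k. vec k \<omega>) (d, i) \<and> ev m (pat v (J - {i}) \<omega>)" for \<omega>
    proof (cases "e \<in> pat v J \<omega>")
      case True
      have fin: "finite (pat v (J - {i}) \<omega> \<inter> C b')" for b' using J finite_pattern by blast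
      have eq: "card (pat v J \<omega> \<inter> C b') = (if b' = b then 1 else 0) + card (pat v (J - {i}) \<omega> \<inter> C b')" if b': "b' \<in> B" for b'
      proof (cases "b' = b")
        case t: True
        then show ?thesis
          unfolding pattern_insert(1)[OF v True[unfolded di]]
          using e pattern_insert(2)[OF v True[unfolded di]] fin[of b] by (simp add: di)
      next
        case False
        then have "e \<notin> C b'" using C(2) b b' e unfolding disjoint_family_on_def by blast
        then show ?thesis
          unfolding pattern_insert(1)[OF v True[unfolded di]] using False by (simp add: di)
      qed
      have "ev m1 (pat v J \<omega>) \<longleftrightarrow> ev m (pat v (J - {i}) \<omega>)"
        unfolding ev_def m1_def using eq by (auto split: if_splits)
      then show ?thesis using True di in_pat[of e \<omega>] by auto
    next
      case False
      then show ?thesis using di in_pat[of e \<omega>] by auto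
    qed
    then have "\<bar>\<P>(\<omega> in M. e \<in> pat v J \<omega> \<and> ev m1 (pat v J \<omega>)) -
        exceed_prob v e * \<P>(\<omega> in M. ev m (pat v (J - {i}) \<omega>))\<bar> \<le> (\<Sum>k\<in>{1, 2} \<times> (J - {i}). discrepancy v e k)"
      using exceed_pattern_almost_independent[OF J di(3), of v d "ev m"] di(1) by simp
    \<comment> \<open>The restored index changes the pattern only when it exceeds in one of the two
      types.\<close>
    moreover have "\<bar>\<P>(\<omega> in M. ev m (pat v (J - {i}) \<omega>)) - P m\<bar> \<le> exceed_prob v (1, i) + exceed_prob v (2, i)"
    proof -
      let ?A = "{\<omega> \<in> space M. ev m (pat v (J - {i}) \<omega>)}" and ?B = "{\<omega> \<in> space M. ev m (pat v J \<omega>)}"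
      let ?D = "{\<omega> \<in> space M. exceeds v (\<lambda>k. vec k \<omega>) (1, i)} \<union> {\<omega> \<in> space M. exceeds v (\<lambda>k. vec k \<omega>) (2, i)}"
      have E: "?A \<in> events" "?B \<in> events" "?D \<in> events"
        "{\<omega> \<in> space M. exceeds v (\<lambda>k. vec k \<omega>) (1, i)} \<in> events" "{\<omega> \<in> space M. exceeds v (\<lambda>k. vec k \<omega>) (2, i)} \<in> events"
        using meas[of J "ev m"] meas[of "J - {i}" "ev m"] e_meas[of "(1, i)"] e_meas[of "(2, i)"] di
        by (auto simp: pred_def)
      have eq: "ev m (pat v J \<omega>) \<longleftrightarrow> ev m (pat v (J - {i}) \<omega>)" if "\<omega> \<in> space M" "\<omega> \<notin> ?D" for \<omega>
        using that by (intro arg_cong[where f = "ev m"]) (auto simp: pattern_def)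
      have sub: "?A \<subseteq> ?B \<union> ?D" "?B \<subseteq> ?A \<union> ?D"
        using eq by blast+
      have "prob ?D \<le> exceed_prob v (1, i) + exceed_prob v (2, i)" using E by (intro measure_Un_le)
      moreover have "prob ?A \<le> prob ?B + prob ?D"
        using finite_measure_mono[OF sub(1)] measure_Un_le[OF E(2,3)] E by force
      moreover have "prob ?B \<le> prob ?A + prob ?D"
        using finite_measure_mono[OF sub(2)] measure_Un_le[OF E(1,3)] E by force
      ultimately show ?thesis unfolding Pm by linarith
    qed
    then have "exceed_prob v e * \<bar>\<P>(\<omega> in M. ev m (pat v (J - {i}) \<omega>)) - P m\<bar> \<le>
        exceed_prob v e * (exceed_prob v (1, i) + exceed_prob v (2, i))"
      by (intro mult_left_mono) auto
    then have "\<bar>exceed_prob v e * \<P>(\<omega> in M. ev m (pat v (J - {i}) \<omega>)) - exceed_prob v e * P m\<bar> \<le>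
        exceed_prob v e * (exceed_prob v (1, i) + exceed_prob v (2, i))"
      by (simp add: abs_mult right_diff_distrib[symmetric])
    ultimately show ?thesis unfolding err_def di(1) by simp
  qed
  have "\<bar>real (m b + 1) * P m1 - (\<Sum>e\<in>C b. exceed_prob v e) * P m\<bar> =
     \<bar>\<Sum>e\<in>C b. \<P>(\<omega> in M. e \<in> pat v J \<omega> \<and> ev m1 (pat v J \<omega>)) - exceed_prob v e * P m\<bar>"
    unfolding 1 by (simp add: sum_subtractf sum_distrib_right)
  also have "\<dots> \<le> (\<Sum>e\<in>C b. \<bar>\<P>(\<omega> in M. e \<in> pat v J \<omega> \<and> ev m1 (pat v J \<omega>)) - exceed_prob v e * P m\<bar>)"
    by (rule sum_abs)
  also have "\<dots> \<le> (\<Sum>e\<in>C b. err e)" by (intro sum_mono 2)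
  also have "\<dots> \<le> (\<Sum>e\<in>{1, 2} \<times> J. err e)"
    using C(1)[OF b] J err0 by (intro sum_mono2) auto
  finally show ?thesis unfolding m1_def err_def .
qed

text \<open>Markov's inequality in each cell and a union bound, in the shape of the tightness
  condition of \<open>poisson_limit_from_recursion\<close>.\<close>

lemma count_tail:
  fixes C :: "'b \<Rightarrow> (nat \<times> nat) set"
  assumes J: "finite J" "J \<subseteq> {1..}" and B: "finite B" and C: "\<And>b. b \<in> B \<Longrightarrow> C b \<subseteq> {1, 2} \<times> J"
  shows "1 - (\<Sum>b\<in>B. \<Sum>e\<in>C b. exceed_prob v e) / real (K + 1) \<le> \<P>(\<omega> in M. \<forall>b\<in>B. card (pat v J \<omega> \<inter> C b) \<le> K)"
proof -
  have meas [measurable]: "Measurable.pred M (\<lambda>\<omega>. \<Phi> (pat v J \<omega>))" for \<Phi>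
    using J by (intro pred_pattern_vec) auto
  have E: "{\<omega> \<in> space M. \<Phi> (pat v J \<omega>)} \<in> events" for \<Phi> using meas[of \<Phi>] by (simp add: pred_def)
  have markov: "\<P>(\<omega> in M. K < card (pat v J \<omega> \<inter> C b)) \<le> (\<Sum>e\<in>C b. exceed_prob v e) / real (K + 1)" if b: "b \<in> B" for b
  proof -
    have fin: "finite (C b)" using C[OF b] J finite_subset by blast
    let ?A = "{\<omega> \<in> space M. K < card (pat v J \<omega> \<inter> C b)}"
    have "real (K + 1) * indicator ?A \<omega> \<le> (\<Sum>e\<in>C b. indicator {\<omega> \<in> space M. e \<in> pat v J \<omega>} \<omega>)" if "\<omega> \<in> space M" for \<omega>
    proof -
      have "(\<Sum>e\<in>C b. indicator {\<omega> \<in> space M. e \<in> pat v J \<omega>} \<omega>) = real (card (pat v J \<omega> \<inter> C b))"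
        using that fin by (simp add: indicator_def sum.If_cases of_bool_def Int_def conj_commute)
      then show ?thesis by (simp add: indicator_def)
    qed
    then have "expectation (\<lambda>\<omega>. real (K + 1) * indicator ?A \<omega>) \<le> expectation (\<lambda>\<omega>. \<Sum>e\<in>C b. indicator {\<omega> \<in> space M. e \<in> pat v J \<omega>} \<omega>)"
      using E[of "\<lambda>A. _ \<in> A"] E[of "\<lambda>A. K < card (A \<inter> C b)"]
      by (intro integral_mono integrable_mult_right Bochner_Integration.integrable_sum) (auto simp: emeasure_eq_measure)
    also have "\<dots> = (\<Sum>e\<in>C b. \<P>(\<omega> in M. e \<in> pat v J \<omega>))"
      using E[of "\<lambda>A. _ \<in> A"] by (subst Bochner_Integration.integral_sum) (auto simp: emeasure_eq_measure)
    also have "\<dots> = (\<Sum>e\<in>C b. exceed_prob v e)"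
      using C[OF b] by (intro sum.cong refl arg_cong[where f = prob] Collect_cong) (auto simp: pattern_def)
    finally have "real (K + 1) * prob ?A \<le> (\<Sum>e\<in>C b. exceed_prob v e)"
      using E[of "\<lambda>A. K < card (A \<inter> C b)"] by simp
    then show ?thesis by (simp add: pos_le_divide_eq mult.commute)
  qed
  have "1 - \<P>(\<omega> in M. \<forall>b\<in>B. card (pat v J \<omega> \<inter> C b) \<le> K) = prob (space M - {\<omega> \<in> space M. \<forall>b\<in>B. card (pat v J \<omega> \<inter> C b) \<le> K})"
    using E[of "\<lambda>A. \<forall>b\<in>B. card (A \<inter> C b) \<le> K"] by (simp add: prob_compl)
  also have "space M - {\<omega> \<in> space M. \<forall>b\<in>B. card (pat v J \<omega> \<inter> C b) \<le> K} = (\<Union>b\<in>B. {\<omega> \<in> space M. K < card (pat v J \<omega> \<inter> C b)})"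
    by (auto simp: not_le)
  also have "prob \<dots> \<le> (\<Sum>b\<in>B. \<P>(\<omega> in M. K < card (pat v J \<omega> \<inter> C b)))"
    using B E[of "\<lambda>A. K < card (A \<inter> C _)"] by (intro finite_measure_subadditive_finite) auto
  also have "\<dots> \<le> (\<Sum>b\<in>B. (\<Sum>e\<in>C b. exceed_prob v e) / real (K + 1))" by (intro sum_mono markov)
  finally show ?thesis by (simp add: sum_divide_distrib)
qed

end

section \<open>Asymptotics of correlations and levels\<close>

context gaussian_scale_mixture
begin

lemma corr_stationary: "1 \<le> j \<Longrightarrow> 1 \<le> k \<Longrightarrow> corr j (j + k) = \<rho> k"
  using gauss by (simp add: standard_stationary_gaussian_def corr_def add.commute[of j k])

lemma corr_commute: "corr i j = corr j i"
  by (simp add: corr_def mult.commute)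

lemma corr_lag:
  assumes "1 \<le> i" "1 \<le> j" "i \<noteq> j"
  shows "corr i j = \<rho> (nat \<bar>int i - int j\<bar>)"
proof (cases "i < j")
  case True
  then have "nat \<bar>int i - int j\<bar> = j - i" by arith
  then show ?thesis using corr_stationary[of i "j - i"] assms True by simp
next
  case False
  then have "nat \<bar>int i - int j\<bar> = i - j" by arith
  then show ?thesis using corr_stationary[of j "i - j"] assms False corr_commute[of i j] by simp
qed

text \<open>Perfect correlation at lag \<open>k\<close> would give X_(j+k) = X_j for all j, or
  X_(j+k) = -X_j for all j, almost surely. By stationarity all multiples of \<open>k\<close> would
  then have correlation of modulus one, against the decay.\<close>

lemma rho_less_1:
  assumes lim: "\<rho> \<longlonglongrightarrow> 0" and k: "1 \<le> k"
  shows "\<bar>\<rho> k\<bar> < 1"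
proof -
  \<comment> \<open>The variance of X_1 - s X_(1+k) is 2 - 2 s \<rho>(k) and nonnegative.\<close>
  have bound: "s * \<rho> k \<le> 1" if s: "s = 1 \<or> s = - 1" for s :: real
  proof -
    have "0 \<le> expectation (\<lambda>\<omega>. (lin {1, 1 + k} (\<lambda>j. if j = 1 then 1 else - s) \<omega>)\<^sup>2)"
      by (intro integral_nonneg_AE) auto
    then show ?thesis
      using k s corr_stationary[of 1 k] by (auto simp: lin_pair_variance)
  qed
  have "s * \<rho> k \<noteq> 1" if s: "s = 1 \<or> s = - 1" for s :: real
  proof
    assume eq: "s * \<rho> k = 1"
    have AE: "AE \<omega> in M. X (j + k) \<omega> = s * X j \<omega>" if j: "1 \<le> j" for j
    proof -
      let ?c = "\<lambda>i. if i = j then 1 else - s"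
      have "expectation (\<lambda>\<omega>. (lin {j, j + k} ?c \<omega>)\<^sup>2) = 0"
        using j k s eq corr_stationary[of j k] by (auto simp: lin_pair_variance)
      then have "AE \<omega> in M. lin {j, j + k} ?c \<omega> = 0"
        using lin_distributed[of "{j, j + k}" ?c] j by auto
      then show ?thesis
        using k s by (auto simp: lin_def elim!: eventually_mono)
    qed
    have "\<bar>\<rho> (m * k + k)\<bar> = 1" for m
    proof (induction m)
      case 0
      then show ?case using eq s by auto
    next
      case (Suc m)
      have [measurable]: "X 1 \<in> borel_measurable M" "X (1 + (Suc m * k + k)) \<in> borel_measurable M" "X (1 + (m * k + k)) \<in> borel_measurable M"
        by auto
      have "\<rho> (Suc m * k + k) = corr 1 (1 + (Suc m * k + k))" using k by (subst corr_stationary) auto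
      also have "\<dots> = expectation (\<lambda>\<omega>. s * (X 1 \<omega> * X (1 + (m * k + k)) \<omega>))"
        unfolding corr_def
      proof (rule integral_cong_AE)
        show "AE \<omega> in M. X 1 \<omega> * X (1 + (Suc m * k + k)) \<omega> = s * (X 1 \<omega> * X (1 + (m * k + k)) \<omega>)"
          using AE[of "1 + (m * k + k)"] by (auto elim!: eventually_mono simp: ac_simps)
      qed measurable
      also have "\<dots> = s * corr 1 (1 + (m * k + k))" by (simp add: corr_def)
      also have "corr 1 (1 + (m * k + k)) = \<rho> (m * k + k)" using k by (subst corr_stationary) auto
      finally show ?case using Suc s by (auto simp: abs_mult)
    qed
    moreover have "(\<lambda>m. \<rho> (m * k + k)) \<longlonglongrightarrow> 0"
      using LIMSEQ_subseq_LIMSEQ[OF lim, of "\<lambda>m. m * k + k"] k by (auto simp: o_def strict_mono_def)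
    then have "(\<lambda>m. \<bar>\<rho> (m * k + k)\<bar>) \<longlonglongrightarrow> \<bar>0\<bar>" by (rule tendsto_rabs)
    ultimately have "(\<lambda>m::nat. 1 :: real) \<longlonglongrightarrow> 0" by simp
    then show False using LIMSEQ_unique[OF tendsto_const] by fastforce
  qed
  from this[of 1] this[of "- 1"] bound[of 1] bound[of "- 1"] show ?thesis by auto
qed

text \<open>Beyond some lag the modulus is below 1/2, and the finitely many others are each below
  one.\<close>

lemma rho_bound:
  assumes lim: "\<rho> \<longlonglongrightarrow> 0"
  obtains \<theta> where "0 \<le> \<theta>" "\<theta> < 1" "\<And>k. 1 \<le> k \<Longrightarrow> \<bar>\<rho> k\<bar> \<le> \<theta>"
proof -
  have "eventually (\<lambda>k. \<bar>\<rho> k\<bar> < 1 / 2) sequentially"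
    using lim unfolding tendsto_iff dist_real_def by (auto dest: spec[of _ "1 / 2"])
  then obtain K where K: "\<And>k. k \<ge> K \<Longrightarrow> \<bar>\<rho> k\<bar> < 1 / 2" by (auto simp: eventually_sequentially)
  define \<theta> where "\<theta> = Max (insert (1 / 2) ((\<lambda>k. \<bar>\<rho> k\<bar>) ` {1..K}))"
  have "\<theta> \<in> insert (1 / 2) ((\<lambda>k. \<bar>\<rho> k\<bar>) ` {1..K})" unfolding \<theta>_def by (intro Max_in) auto
  then have "\<theta> < 1" using rho_less_1[OF lim] by auto
  moreover have half: "1 / 2 \<le> \<theta>" unfolding \<theta>_def by (intro Max_ge) auto
  moreover have "\<bar>\<rho> k\<bar> \<le> \<theta>" if "1 \<le> k" for k
  proof (cases "k \<le> K")
    case True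
    then show ?thesis using that unfolding \<theta>_def by (intro Max_ge) auto
  next
    case False
    then show ?thesis using K[of k] half by simp
  qed
  ultimately show ?thesis using that[of \<theta>] by simp
qed

end

lemma card_near_le:
  assumes "0 \<le> L"
  shows "real (card {j \<in> J. \<bar>real i - real j\<bar> \<le> L}) \<le> 2 * L + 1"
proof -
  define l where "l = nat \<lfloor>L\<rfloor>"
  have "{j \<in> J. \<bar>real i - real j\<bar> \<le> L} \<subseteq> {i - l..i + l}"
  proof
    fix j assume "j \<in> {j \<in> J. \<bar>real i - real j\<bar> \<le> L}"
    then have "\<bar>int i - int j\<bar> \<le> \<lfloor>L\<rfloor>" by (simp add: le_floor_iff)
    then show "j \<in> {i - l..i + l}" unfolding l_def by auto
  qed
  then have "card {j \<in> J. \<bar>real i - real j\<bar> \<le> L} \<le> card {i - l..i + l}" by (intro card_mono) auto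
  also have "\<dots> \<le> 2 * l + 1" by simp
  finally have "real (card {j \<in> J. \<bar>real i - real j\<bar> \<le> L}) \<le> 2 * real l + 1" by linarith
  moreover have "real l \<le> L" using assms by (simp add: l_def)
  ultimately show ?thesis by linarith
qed

text \<open>The form in which the hypotheses enter the asymptotics: \<open>c d\<close> stands for
  exp (- x_d), the exceedance probability depends on the type but not on the index, and the tail
  comparison has become the logarithmic rate for \<rho>.\<close>

locale exceedance_levels = bounded_scale_mixture +
  fixes v :: "nat \<Rightarrow> nat \<Rightarrow> real" and p :: "nat \<Rightarrow> nat \<Rightarrow> real" and c :: "nat \<Rightarrow> real"
  assumes p: "d \<in> {1, 2} \<Longrightarrow> 1 \<le> i \<Longrightarrow> exceed_prob (v n) (d, i) = p n d"
    and p_lim: "d \<in> {1, 2} \<Longrightarrow> (\<lambda>n. real n * p n d) \<longlonglongrightarrow> c d"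
    and c_pos: "d \<in> {1, 2} \<Longrightarrow> 0 < c d"
    and S_top: "s < 1 \<Longrightarrow> 0 < \<P>(\<omega> in M. s < S 1 \<omega>)"
    and rho_ln: "(\<lambda>n. \<rho> n * ln (real n)) \<longlonglongrightarrow> 0"
begin

section \<open>Size of the levels\<close>

lemma p_nonneg: "d \<in> {1, 2} \<Longrightarrow> 0 \<le> p n d"
  using p[of d 1 n] by (metis le_refl measure_nonneg)

lemma rho_tendsto_0: "\<rho> \<longlonglongrightarrow> 0"
proof (rule Lim_null_comparison[OF _ tendsto_rabs_zero[OF rho_ln]])
  have "eventually (\<lambda>n. n \<ge> 3) sequentially" by (rule eventually_ge_at_top)
  then show "eventually (\<lambda>n. norm (\<rho> n) \<le> \<bar>\<rho> n * ln (real n)\<bar>) sequentially"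
  proof eventually_elim
    case (elim n)
    have "exp 1 \<le> real n" using exp_le elim by linarith
    then have "1 \<le> ln (real n)" using elim by (subst ln_ge_iff) auto
    then have "\<bar>\<rho> n\<bar> * 1 \<le> \<bar>\<rho> n\<bar> * \<bar>ln (real n)\<bar>" by (intro mult_left_mono) auto
    then show ?case by (simp add: abs_mult)
  qed
qed

lemma ln_nat_at_top: "filterlim (\<lambda>n. ln (real n)) at_top sequentially"
  by (rule filterlim_compose[OF ln_at_top filterlim_real_sequentially])

lemma p_bound:
  obtains K where "K > 0" "\<And>n d. d \<in> {1, 2} \<Longrightarrow> 1 \<le> n \<Longrightarrow> p n d \<le> K / real n"
proof -
  have "Bseq (\<lambda>n. real n * p n d)" if "d \<in> {1, 2}" for d
    using convergent_imp_Bseq convergentI[OF p_lim[OF that]] by blast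
  then have "\<exists>K>0. \<forall>n. norm (real n * p n d) \<le> K" if "d \<in> {1, 2}" for d
    using that unfolding Bseq_def by blast
  then obtain K where K: "\<And>d. d \<in> {1, 2} \<Longrightarrow> K d > 0 \<and> (\<forall>n. norm (real n * p n d) \<le> K d)" by metis
  show ?thesis
  proof (rule that[of "K 1 + K 2"])
    show "K 1 + K 2 > 0" using K[of 1] K[of 2] by simp
    fix n d :: nat assume *: "d \<in> {1, 2}" "1 \<le> n"
    have "norm (real n * p n d) \<le> K d" using K[OF *(1)] by blast
    then have "real n * p n d \<le> K d" unfolding real_norm_def by linarith
    then have "real n * p n d \<le> K 1 + K 2" using K[of 1] K[of 2] *(1) by auto
    then show "p n d \<le> (K 1 + K 2) / real n" using *(2) by (simp add: field_simps)
  qed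
qed

text \<open>A scale above \<open>s\<close> and a signed Gaussian above \<open>y / s\<close> together
  produce an exceedance, and the two are independent; the Gaussian tail is bounded below with width
  1.\<close>

lemma level_tail_lower:
  assumes d: "d \<in> {1, 2}" and s: "0 < s" "s < 1" and y: "0 \<le> y" "v n d \<le> y"
  shows "\<P>(\<omega> in M. s < S 1 \<omega>) * (1 / sqrt (2 * pi) * exp (- (y / s + 1)\<^sup>2 / 2)) \<le> p n d"
proof -
  define sg where "sg = (if d = 1 then 1 else - 1 :: real)"
  have \<xi>: "\<xi> d z = sg * z" for z using d by (auto simp: \<xi>_def sg_def)
  have D: "distributed M lborel (\<lambda>\<omega>. sg * X 1 \<omega>) std_normal_density"
    by (rule lin_single_distributed) (auto simp: sg_def)
  have [measurable]: "X 1 \<in> borel_measurable M" by simp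
  have lin: "lin {1} (\<lambda>_. sg) \<omega> = sg * X 1 \<omega>" for \<omega> by (simp add: lin_def)
  have "indep_var borel (S 1) borel (lin {1} (\<lambda>_. sg))" by (rule indep_S_lin) auto
  then have ind: "indep_var borel (S 1) borel (\<lambda>\<omega>. sg * X 1 \<omega>)" unfolding lin[abs_def] by simp
  have "\<P>(\<omega> in M. s < S 1 \<omega>) * (1 / sqrt (2 * pi) * exp (- (y / s + 1)\<^sup>2 / 2)) \<le>
      \<P>(\<omega> in M. s < S 1 \<omega>) * \<P>(\<omega> in M. y / s < sg * X 1 \<omega>)"
    using std_normal_tail_lower[OF D, of "y / s" 1] s y by (intro mult_left_mono) auto
  also have "\<dots> = \<P>(\<omega> in M. s < S 1 \<omega> \<and> y / s < sg * X 1 \<omega>)"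
  proof -
    have "prob ((\<lambda>\<omega>. (S 1 \<omega>, sg * X 1 \<omega>)) -` ({s<..} \<times> {y / s<..}) \<inter> space M) =
      prob (S 1 -` {s<..} \<inter> space M) * prob ((\<lambda>\<omega>. sg * X 1 \<omega>) -` {y / s<..} \<inter> space M)"
      using ind by (intro indep_varD[of borel _ borel]) auto
    moreover have "(\<lambda>\<omega>. (S 1 \<omega>, sg * X 1 \<omega>)) -` ({s<..} \<times> {y / s<..}) \<inter> space M =
        {\<omega> \<in> space M. s < S 1 \<omega> \<and> y / s < sg * X 1 \<omega>}"
      "S 1 -` {s<..} \<inter> space M = {\<omega> \<in> space M. s < S 1 \<omega>}"
      "(\<lambda>\<omega>. sg * X 1 \<omega>) -` {y / s<..} \<inter> space M = {\<omega> \<in> space M. y / s < sg * X 1 \<omega>}" by auto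
    ultimately show ?thesis by simp
  qed
  also have "\<dots> \<le> exceed_prob (v n) (d, 1)"
  proof (rule finite_measure_mono)
    show "{\<omega> \<in> space M. s < S 1 \<omega> \<and> y / s < sg * X 1 \<omega>} \<subseteq> {\<omega> \<in> space M. exceeds (v n) (\<lambda>k. vec k \<omega>) (d, 1)}"
    proof safe
      fix \<omega> assume *: "s < S 1 \<omega>" "y / s < sg * X 1 \<omega>"
      have "0 \<le> y / s" using s y by simp
      then have z: "0 < sg * X 1 \<omega>" using * by linarith
      have "y < s * (sg * X 1 \<omega>)" using *(2) s by (simp add: divide_less_eq mult.commute)
      also have "\<dots> \<le> S 1 \<omega> * (sg * X 1 \<omega>)" using *(1) z by (intro mult_right_mono) auto
      finally have "v n d < S 1 \<omega> * (sg * X 1 \<omega>)" using y by linarith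
      then show "exceeds (v n) (\<lambda>k. vec k \<omega>) (d, 1)"
        by (simp add: exceeds_def vec_def \<xi> ac_simps)
    qed
    show "{\<omega> \<in> space M. exceeds (v n) (\<lambda>k. vec k \<omega>) (d, 1)} \<in> events"
      using pred_exceeds_vec[of "(d, 1)" "v n"] by (simp add: pred_def)
  qed
  also have "\<dots> = p n d" using d by (rule p) simp
  finally show ?thesis .
qed

text \<open>A level below sqrt (2 c0 ln n) would make n times the exceedance probability unbounded,
  because scales close to 1 already contribute a power of n larger than n^(-1).\<close>

lemma level_lower:
  assumes d: "d \<in> {1, 2}" and c0: "0 < c0" "c0 < 1"
  shows "eventually (\<lambda>n. sqrt (2 * c0 * ln (real n)) \<le> v n d) sequentially"
proof -
  \<comment> \<open>The fourth root of c0: then c0 / s^2 = sqrt c0 is still below 1, so using only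
    scales above \<open>s\<close> leaves room in the exponent.\<close>
  define s where "s = sqrt (sqrt c0)"
  have s: "0 < s" "s < 1" using c0 by (auto simp: s_def)
  have s2: "s\<^sup>2 = sqrt c0" using c0 by (simp add: s_def)
  define q where "q = \<P>(\<omega> in M. s < S 1 \<omega>) / sqrt (2 * pi)"
  have q: "q > 0" using S_top[OF s(2)] by (simp add: q_def)
  obtain K where K: "K > 0" "\<And>n d. d \<in> {1, 2} \<Longrightarrow> 1 \<le> n \<Longrightarrow> p n d \<le> K / real n" using p_bound by metis
  define t where "t n = sqrt (ln (real n))" for n
  have t: "filterlim t at_top sequentially"
    unfolding t_def[abs_def] by (rule filterlim_compose[OF sqrt_at_top ln_nat_at_top])
  \<comment> \<open>With t = sqrt (ln n) the exponent -(y/s + 1)^2 / 2 equals -ln n - 1/2 - b t + a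
    t^2; the quadratic term wins since a > 0.\<close>
  define a where "a = 1 - sqrt c0"
  define b where "b = sqrt (2 * c0) / s"
  have a: "a > 0" using c0 by (simp add: a_def)
  have "filterlim (\<lambda>n. - b + a * t n) at_top sequentially"
    by (intro filterlim_tendsto_add_at_top[OF tendsto_const] filterlim_tendsto_pos_mult_at_top[OF tendsto_const a t])
  then have "filterlim (\<lambda>n. t n * (- b + a * t n)) at_top sequentially"
    by (rule filterlim_at_top_mult_at_top[OF t])
  then have "filterlim (\<lambda>n. - (1 / 2) + t n * (- b + a * t n)) at_top sequentially"
    by (intro filterlim_tendsto_add_at_top[OF tendsto_const])
  then have "filterlim (\<lambda>n. exp (- (1 / 2) + t n * (- b + a * t n))) at_top sequentially"
    by (rule filterlim_compose[OF exp_at_top])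
  then have "eventually (\<lambda>n. K / q < exp (- (1 / 2) + t n * (- b + a * t n))) sequentially"
    by (auto simp: filterlim_at_top_dense)
  moreover have "eventually (\<lambda>n::nat. 1 \<le> n) sequentially" by (rule eventually_ge_at_top)
  ultimately show ?thesis
  proof eventually_elim
    case (elim n)
    show ?case
    proof (rule ccontr)
      let ?y = "sqrt (2 * c0 * ln (real n))"
      assume "\<not> ?y \<le> v n d"
      then have "v n d \<le> ?y" by simp
      have ln0: "0 \<le> ln (real n)" using elim by simp
      have y: "?y = sqrt (2 * c0) * t n" by (simp add: t_def real_sqrt_mult)
      have t2: "(t n)\<^sup>2 = ln (real n)" using ln0 by (simp add: t_def)
      have "(?y / s)\<^sup>2 = 2 * (c0 / sqrt c0 * (t n)\<^sup>2)"
        using c0 by (simp add: y power_divide power_mult_distrib s2)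
      then have e1: "(?y / s)\<^sup>2 = 2 * (sqrt c0 * (t n)\<^sup>2)" using c0 by (simp add: real_div_sqrt)
      have e2: "?y / s = b * t n" by (simp add: y b_def)
      have "(?y / s + 1)\<^sup>2 = (?y / s)\<^sup>2 + 2 * (?y / s) + 1" by (simp add: power2_sum)
      then have "(?y / s + 1)\<^sup>2 = 2 * (sqrt c0 * (t n)\<^sup>2) + 2 * (b * t n) + 1"
        unfolding e1 unfolding e2 .
      then have e: "- (?y / s + 1)\<^sup>2 / 2 = - ln (real n) + (- (1 / 2) + t n * (- b + a * t n))"
      proof -
        have "t n * (- b + a * t n) = (t n)\<^sup>2 - sqrt c0 * (t n)\<^sup>2 - b * t n"
          by (simp add: a_def power2_eq_square algebra_simps)
        then show ?thesis
          using \<open>(?y / s + 1)\<^sup>2 = 2 * (sqrt c0 * (t n)\<^sup>2) + 2 * (b * t n) + 1\<close> t2 by linarith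
      qed
      have "exp (- ln (real n) + z) = exp z / real n" for z
        using elim(2) by (simp add: exp_diff)
      then have "exp (- (?y / s + 1)\<^sup>2 / 2) = exp (- (1 / 2) + t n * (- b + a * t n)) / real n"
        unfolding e .
      then have "q * (exp (- (1 / 2) + t n * (- b + a * t n)) / real n) \<le> p n d"
        using level_tail_lower[OF d s, of ?y n] \<open>v n d \<le> ?y\<close> ln0 c0 by (simp add: q_def)
      also have "\<dots> \<le> K / real n" using K d elim by blast
      finally have "q * exp (- (1 / 2) + t n * (- b + a * t n)) \<le> K" using elim by (simp add: divide_le_cancel)
      then show False using elim(1) q by (simp add: pos_divide_less_eq mult.commute)
    qed
  qed
qed

lemma level_at_top:
  assumes d: "d \<in> {1, 2}"
  shows "filterlim (\<lambda>n. v n d) at_top sequentially"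
proof (rule filterlim_at_top_mono)
  show "filterlim (\<lambda>n. sqrt (2 * (1 / 2) * ln (real n))) at_top sequentially"
    using filterlim_compose[OF sqrt_at_top ln_nat_at_top] by simp
  show "eventually (\<lambda>n. sqrt (2 * (1 / 2) * ln (real n)) \<le> v n d) sequentially"
    by (rule level_lower[OF d]) auto
qed

text \<open>As S \<le> 1, the exceedance probability is at most exp (-v^2 / 2). Since it is
  eventually at least c / (2n), v^2 \<le> 2 ln n + 2 ln (2/c), and the constant is eventually
  absorbed by another 2 ln n.\<close>

lemma level_upper:
  assumes d: "d \<in> {1, 2}"
  shows "eventually (\<lambda>n. (v n d)\<^sup>2 \<le> 4 * ln (real n)) sequentially"
proof -
  define sg where "sg = (if d = 1 then 1 else - 1 :: real)"
  have \<xi>: "\<xi> d z = sg * z" for z using d by (auto simp: \<xi>_def sg_def)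
  have D: "distributed M lborel (\<lambda>\<omega>. sg * X 1 \<omega>) (normal_density 0 1)"
    using lin_single_distributed[of 1 sg] by (auto simp: sg_def)
  have [measurable]: "X 1 \<in> borel_measurable M" by simp
  have up: "p n d \<le> exp (- (v n d)\<^sup>2 / 2)" if v: "0 \<le> v n d" for n
  proof -
    have "p n d = exceed_prob (v n) (d, 1)" using p[OF d, of 1 n] by simp
    also have "\<dots> \<le> \<P>(\<omega> in M. v n d \<le> sg * X 1 \<omega>)"
    proof (rule finite_measure_mono_AE)
      show "AE \<omega> in M. \<omega> \<in> {\<omega> \<in> space M. exceeds (v n) (\<lambda>k. vec k \<omega>) (d, 1)} \<longrightarrow> \<omega> \<in> {\<omega> \<in> space M. v n d \<le> sg * X 1 \<omega>}"
        using S_range[OF order_refl]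
      proof eventually_elim
        case (elim \<omega>)
        have "v n d \<le> y" if *: "v n d < S 1 \<omega> * y" for y
        proof -
          have "0 < S 1 \<omega> * y" using * v by linarith
          then have "0 < y" using elim by (auto simp: zero_less_mult_iff)
          then have "S 1 \<omega> * y \<le> y" using elim by (simp add: mult_left_le_one_le)
          then show ?thesis using * by linarith
        qed
        from this[of "sg * X 1 \<omega>"] show ?case
          by (auto simp: exceeds_def vec_def \<xi> ac_simps)
      qed
    qed measurable
    also have "\<dots> \<le> exp (- (v n d)\<^sup>2 / 2)"
      using normal_upper_tail[OF D _ v] by simp
    finally show ?thesis .
  qed
  have "eventually (\<lambda>n. c d / 2 < real n * p n d) sequentially"
    using c_pos[OF d] by (intro order_tendstoD(1)[OF p_lim[OF d]]) simp
  moreover have "eventually (\<lambda>n. 0 \<le> v n d) sequentially"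
    using level_at_top[OF d] by (auto simp: filterlim_at_top)
  moreover have "eventually (\<lambda>n. ln (2 / c d) \<le> ln (real n)) sequentially"
    using ln_nat_at_top by (auto simp: filterlim_at_top)
  moreover have "eventually (\<lambda>n::nat. 1 \<le> n) sequentially" by (rule eventually_ge_at_top)
  ultimately show ?thesis
  proof eventually_elim
    case (elim n)
    have "c d / 2 < real n * exp (- (v n d)\<^sup>2 / 2)"
      using elim up[of n] mult_left_mono[of "p n d" "exp (- (v n d)\<^sup>2 / 2)" "real n"] by linarith
    then have "ln (c d / 2) < ln (real n * exp (- (v n d)\<^sup>2 / 2))"
      using c_pos[OF d] elim by (subst ln_less_cancel_iff) auto
    then have "ln (c d / 2) < ln (real n) - (v n d)\<^sup>2 / 2"
      using elim by (simp add: ln_mult)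
    moreover have "ln (c d / 2) = - ln (2 / c d)" using c_pos[OF d] by (simp add: ln_div)
    ultimately show ?case using elim by simp
  qed
qed

end

section \<open>Summing the discrepancies and passing to the limit\<close>

context exceedance_levels
begin

text \<open>The bracket with the case distinction is summed over the few pairs at short lag, the
  other one over all pairs; hence the extra n^(-\<kappa>) in the former and the arbitrarily small
  \<eta> in front of n^(-2) in the latter.\<close>

lemma discrepancy_eventually:
  assumes \<theta>: "0 \<le> \<theta>" "\<theta> < 1" "\<forall>k\<ge>1. \<bar>\<rho> k\<bar> \<le> \<theta>"
    and K: "K > 0" "\<forall>n\<ge>1. \<forall>d\<in>{1, 2}. p n d \<le> K / real n"
    and \<kappa>: "\<kappa> = (1 - \<theta>) / 8" and \<eta>: "\<eta> > 0"
  shows "eventually (\<lambda>n. \<forall>i\<in>{1..n}. \<forall>j\<in>{1..n}. \<forall>d\<in>{1, 2}. \<forall>d'\<in>{1, 2}. i \<noteq> j \<longrightarrow>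
    discrepancy (v n) (d, i) (d', j) \<le>
      (if \<bar>real i - real j\<bar> \<le> real n powr \<kappa> then real n powr (- 1 - 2 * \<kappa>) + K\<^sup>2 / (real n)\<^sup>2 else 0) +
      (4 * real n powr (- 3) + K * real n powr (- 5 / 2) + \<eta> / (real n)\<^sup>2)) sequentially"
proof -
  \<comment> \<open>With m^2 = 2 c0 ln n, the value 3/4 turns the two long-lag tails into n^(-3) and
    n^(-3/2), and the second entry turns exp (-m^2 / (1 + \<theta>)) into n^(-1-2\<kappa>). The
    choice of \<kappa> keeps this entry below 1.\<close>
  define c0 where "c0 = max (3 / 4) ((1 + 2 * \<kappa>) * (1 + \<theta>) / 2)"
  have \<kappa>0: "0 < \<kappa>" "\<kappa> \<le> 1 / 8" using \<theta> by (auto simp: \<kappa>)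
  have "(1 + 2 * \<kappa>) * (1 + \<theta>) < 2"
  proof -
    have "0 < (1 - \<theta>) * (3 - \<theta>)" using \<theta> by simp
    then show ?thesis by (simp add: \<kappa> field_simps)
  qed
  then have c0: "3 / 4 \<le> c0" "c0 < 1" "(1 + 2 * \<kappa>) * (1 + \<theta>) / 2 \<le> c0" by (auto simp: c0_def)
  \<comment> \<open>The first entry ensures 4|r|v^2 \<le> 1, the second makes 432 * (4 \<eta>' /
    \<kappa>) * K^2 at most \<eta>.\<close>
  define \<eta>' where "\<eta>' = min (\<kappa> / 16) (\<eta> * \<kappa> / (1728 * K\<^sup>2))"
  have \<eta>': "\<eta>' > 0" "\<eta>' \<le> \<kappa> / 16" "1728 * \<eta>' * K\<^sup>2 \<le> \<eta> * \<kappa>"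
  proof -
    show "\<eta>' > 0" "\<eta>' \<le> \<kappa> / 16" using \<kappa>0 \<eta> K(1) by (auto simp: \<eta>'_def)
    have "\<eta>' \<le> \<eta> * \<kappa> / (1728 * K\<^sup>2)" by (simp add: \<eta>'_def)
    then show "1728 * \<eta>' * K\<^sup>2 \<le> \<eta> * \<kappa>" using K(1) by (simp add: pos_le_divide_eq ac_simps)
  qed
  have "eventually (\<lambda>k. \<bar>\<rho> k\<bar> < 1 / 4) sequentially" "eventually (\<lambda>k. \<bar>\<rho> k * ln (real k)\<bar> < \<eta>') sequentially"
    using rho_tendsto_0 rho_ln \<eta>'(1) unfolding tendsto_iff dist_real_def by (auto dest: spec[of _ "1 / 4"])
  then have "eventually (\<lambda>k. \<bar>\<rho> k\<bar> < 1 / 4 \<and> \<bar>\<rho> k * ln (real k)\<bar> < \<eta>') sequentially"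
    by eventually_elim simp
  then obtain k0 where k0: "\<And>k. k \<ge> k0 \<Longrightarrow> \<bar>\<rho> k\<bar> < 1 / 4 \<and> \<bar>\<rho> k * ln (real k)\<bar> < \<eta>'"
    by (auto simp: eventually_sequentially)
  have "filterlim (\<lambda>n. exp (\<kappa> * ln (real n))) at_top sequentially"
    by (rule filterlim_compose[OF exp_at_top filterlim_tendsto_pos_mult_at_top[OF tendsto_const \<kappa>0(1) ln_nat_at_top]])
  then have "eventually (\<lambda>n. real k0 + 1 \<le> exp (\<kappa> * ln (real n))) sequentially" by (auto simp: filterlim_at_top)
  then have e1: "eventually (\<lambda>n. real k0 + 1 \<le> real n powr \<kappa>) sequentially"
    using eventually_gt_at_top[of 0] by eventually_elim (simp add: powr_def)
  have e2: "eventually (\<lambda>n. sqrt (2 * c0 * ln (real n)) \<le> v n d) sequentially" if "d \<in> {1, 2}" for d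
    using c0 by (intro level_lower[OF that]) auto
  have e3: "eventually (\<lambda>n. 1 \<le> ln (real n)) sequentially"
    using ln_nat_at_top by (auto simp: filterlim_at_top)
  show ?thesis
    using e1 e2[of 1, simplified] e2[of 2, simplified] level_upper[of 1, simplified] level_upper[of 2, simplified] e3 eventually_ge_at_top[of 1]
  proof eventually_elim
    case (elim n)
    define m where "m = sqrt (2 * c0 * ln (real n))"
    have n: "1 \<le> n" "0 < real n" using elim by auto
    have "1 * 1 \<le> (2 * c0) * ln (real n)" using c0 elim by (intro mult_mono) auto
    then have m: "1 \<le> m" "m\<^sup>2 = 2 * c0 * ln (real n)" unfolding m_def by auto
    have mv: "m \<le> v n d" if "d \<in> {1, 2}" for d using that elim by (auto simp: m_def)
    have vu: "(v n d)\<^sup>2 \<le> 4 * ln (real n)" if "d \<in> {1, 2}" for d using that elim by auto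
    have pw: "exp (- (a * m\<^sup>2)) \<le> real n powr (- b)" if "b \<le> a * (2 * c0)" for a b
    proof -
      have "exp (- (a * m\<^sup>2)) = real n powr (- (a * (2 * c0)))"
        using n by (simp add: m(2) powr_def ac_simps)
      also have "\<dots> \<le> real n powr (- b)" using that n by (intro powr_mono) auto
      finally show ?thesis .
    qed
    have "(1 + 2 * \<kappa>) \<le> 1 / (1 + \<theta>) * (2 * c0)" using c0(3) \<theta> by (simp add: field_simps)
    from pw[OF this] have x1: "exp (- m\<^sup>2 / (1 + \<theta>)) \<le> real n powr (- 1 - 2 * \<kappa>)" by simp
    have x2: "exp (- 2 * m\<^sup>2) \<le> real n powr (- 3)" using pw[of 3 2] c0 by simp
    have x3: "exp (- (9 / 8) * m\<^sup>2) \<le> real n powr (- 3 / 2)" using pw[of "3 / 2" "9 / 8"] c0 by simp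
    show ?case
    proof (intro ballI impI)
      fix i j d d' assume ij: "i \<in> {1..n}" "j \<in> {1..n}" "i \<noteq> j" and d: "d \<in> {1, 2::nat}" "d' \<in> {1, 2::nat}"
      have ij1: "1 \<le> i" "1 \<le> j" using ij by auto
      define k where "k = nat \<bar>int i - int j\<bar>"
      have k: "1 \<le> k" "k \<le> n" "corr i j = \<rho> k" "real k = \<bar>real i - real j\<bar>"
        using ij corr_lag[OF ij1 ij(3)] by (auto simp: k_def)
      have p1: "p n d \<le> K / real n" "p n d' \<le> K / real n" "0 \<le> p n d" "0 \<le> p n d'"
        using K(2) d n p_nonneg by auto
      note pe = p[OF d(1) ij1(1), of n] p[OF d(2) ij1(2), of n]
      have rest0: "0 \<le> 4 * real n powr (- 3) + K * real n powr (- 5 / 2) + \<eta> / (real n)\<^sup>2" using K \<eta> by simp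
      show "discrepancy (v n) (d, i) (d', j) \<le>
        (if \<bar>real i - real j\<bar> \<le> real n powr \<kappa> then real n powr (- 1 - 2 * \<kappa>) + K\<^sup>2 / (real n)\<^sup>2 else 0) +
        (4 * real n powr (- 3) + K * real n powr (- 5 / 2) + \<eta> / (real n)\<^sup>2)"
      proof (cases "\<bar>real i - real j\<bar> \<le> real n powr \<kappa>")
        case True
        have "\<P>(\<omega> in M. exceeds (v n) (\<lambda>k. vec k \<omega>) (d, i) \<and> exceeds (v n) (\<lambda>k. vec k \<omega>) (d', j)) \<le> exp (- m\<^sup>2 / (1 + \<theta>))"
          using m(1) mv d \<theta>(3)[rule_format, OF k(1)] k(3)
          by (intro joint_exceedance_bound[OF ij1 ij(3) d]) auto
        moreover have "p n d * p n d' \<le> K / real n * (K / real n)"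
          using p1 by (intro mult_mono) auto
        then have "p n d * p n d' \<le> K\<^sup>2 / (real n)\<^sup>2" by (simp add: power2_eq_square)
        ultimately have "discrepancy (v n) (d, i) (d', j) \<le> real n powr (- 1 - 2 * \<kappa>) + K\<^sup>2 / (real n)\<^sup>2"
          using discrepancy_le_joint[OF ij1 ij(3), of "v n" d d'] x1 unfolding pe by linarith
        then show ?thesis using True rest0 by simp
      next
        case False
        then have kn: "real n powr \<kappa> < real k" using k by simp
        then have "k \<ge> k0" using elim(1) by linarith
        then have r: "\<bar>\<rho> k\<bar> < 1 / 4" "\<bar>\<rho> k * ln (real k)\<bar> < \<eta>'" using k0 by auto
        \<comment> \<open>A lag above n^\<kappa> has logarithm at least \<kappa> ln n, so smallness
          of \<rho>(k) ln k becomes smallness of \<rho>(k) ln n, uniformly over long lags.\<close>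
        have "ln (real n powr \<kappa>) \<le> ln (real k)" using kn n k by (subst ln_le_cancel_iff) auto
        then have "\<kappa> * ln (real n) \<le> ln (real k)" using n by (simp add: ln_powr)
        then have "\<bar>\<rho> k\<bar> * (\<kappa> * ln (real n)) \<le> \<bar>\<rho> k\<bar> * ln (real k)" by (intro mult_left_mono) auto
        also have "\<dots> \<le> \<eta>'" using r(2) k by (simp add: abs_mult)
        finally have rl: "\<bar>\<rho> k\<bar> * ln (real n) \<le> \<eta>' / \<kappa>" using \<kappa>0 by (simp add: pos_le_divide_eq ac_simps)
        have "\<bar>\<rho> k\<bar> * (v n d')\<^sup>2 \<le> \<bar>\<rho> k\<bar> * (4 * ln (real n))" using vu[OF d(2)] by (intro mult_left_mono) auto
        then have rv: "\<bar>\<rho> k\<bar> * (v n d')\<^sup>2 \<le> 4 * \<eta>' / \<kappa>" using rl by simp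
        have "\<eta>' / \<kappa> \<le> 1 / 16" using \<eta>'(2) \<kappa>0 by (simp add: pos_divide_le_eq)
        moreover have "4 * \<eta>' / \<kappa> = 4 * (\<eta>' / \<kappa>)" "4 * \<bar>corr i j\<bar> * (v n d')\<^sup>2 = 4 * (\<bar>\<rho> k\<bar> * (v n d')\<^sup>2)"
          using k(3) by simp_all
        ultimately have r1: "4 * \<bar>corr i j\<bar> * (v n d')\<^sup>2 \<le> 1" using rv by linarith
        have gen: "K / N * (A + 432 * (4 * e / y) * (K / N)) = K * (A / N) + 1728 * e * K\<^sup>2 / y / N\<^sup>2" for A e y N :: real
          by (simp add: distrib_left power2_eq_square ac_simps)
        have "discrepancy (v n) (d, i) (d', j) \<le> 4 * exp (- 2 * m\<^sup>2) +
            p n d * (exp (- (9 / 8) * m\<^sup>2) + 432 * \<bar>corr i j\<bar> * (v n d')\<^sup>2 * p n d')"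
          using discrepancy_le_long[OF ij1 ij(3) d(2) m(1), of "v n" "v n d'" d] mv[OF d(2)] r(1) r1 k(3)
          unfolding pe by simp
        also have "\<dots> \<le> 4 * real n powr (- 3) + K / real n * (real n powr (- 3 / 2) + 432 * (4 * \<eta>' / \<kappa>) * (K / real n))"
        proof -
          have "432 * \<bar>corr i j\<bar> * (v n d')\<^sup>2 = 432 * (\<bar>\<rho> k\<bar> * (v n d')\<^sup>2)" using k(3) by simp
          also have "\<dots> \<le> 432 * (4 * \<eta>' / \<kappa>)" using rv by (rule mult_left_mono) simp
          finally have "432 * \<bar>corr i j\<bar> * (v n d')\<^sup>2 * p n d' \<le> 432 * (4 * \<eta>' / \<kappa>) * (K / real n)"
            by (rule mult_mono) (use p1 \<eta>' \<kappa>0 in auto)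
          then have "p n d * (exp (- (9 / 8) * m\<^sup>2) + 432 * \<bar>corr i j\<bar> * (v n d')\<^sup>2 * p n d') \<le>
              K / real n * (real n powr (- 3 / 2) + 432 * (4 * \<eta>' / \<kappa>) * (K / real n))"
            by (intro mult_mono[OF p1(1) add_mono[OF x3]]) (use p1 K in auto)
          then show ?thesis using x2 by simp
        qed
        also have "K / real n * (real n powr (- 3 / 2) + 432 * (4 * \<eta>' / \<kappa>) * (K / real n)) =
            K * (real n powr (- 3 / 2) / real n) + (1728 * \<eta>' * K\<^sup>2) / \<kappa> / (real n)\<^sup>2"
          using gen .
        also have "real n powr (- 3 / 2) / real n = real n powr (- 5 / 2)"
          using n powr_diff[of "real n" "- 3 / 2" 1] by simp
        also have "(1728 * \<eta>' * K\<^sup>2) / \<kappa> / (real n)\<^sup>2 \<le> \<eta> / (real n)\<^sup>2"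
          using \<eta>'(3) \<kappa>0 by (intro divide_right_mono) (simp_all add: pos_divide_le_eq)
        finally show ?thesis using False by simp
      qed
    qed
  qed
qed

text \<open>The right-hand side of \<open>count_recursion\<close> for
  \<open>J = {1..n}\<close>.\<close>

definition total_error :: "nat \<Rightarrow> real" where
  "total_error n = (\<Sum>e\<in>{1, 2} \<times> {1..n}. (\<Sum>k\<in>{1, 2} \<times> ({1..n} - {snd e}). discrepancy (v n) e k) +
       exceed_prob (v n) e * (exceed_prob (v n) (1, snd e) + exceed_prob (v n) (2, snd e)))"

lemma total_error_nonneg: "0 \<le> total_error n"
  unfolding total_error_def discrepancy_def
  by (intro sum_nonneg add_nonneg_nonneg mult_nonneg_nonneg) auto

text \<open>For each point the short-lag bracket is summed over at most 2 n^\<kappa> + 1 indices and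
  the other over at most n, both for two types; summing over the 2n points leaves only vanishing
  powers of n and 4\<eta>.\<close>

lemma total_error_tendsto_0: "total_error \<longlonglongrightarrow> 0"
proof -
  obtain \<theta> where \<theta>: "0 \<le> \<theta>" "\<theta> < 1" "\<forall>k\<ge>1. \<bar>\<rho> k\<bar> \<le> \<theta>" using rho_bound[OF rho_tendsto_0] by metis
  obtain K where K: "K > 0" "\<forall>n\<ge>1. \<forall>d\<in>{1, 2}. p n d \<le> K / real n" using p_bound by metis
  define \<kappa> where "\<kappa> = (1 - \<theta>) / 8"
  have \<kappa>0: "0 < \<kappa>" "\<kappa> \<le> 1 / 8" using \<theta> by (auto simp: \<kappa>_def)
  \<comment> \<open>Everything except the \<eta> term. The factor 12 is 4 pairs of types times 3,
    from 2 n^\<kappa> + 1 \<le> 3 n^\<kappa>.\<close>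
  define g where "g n = 12 * (real n powr (- \<kappa>) + K\<^sup>2 * real n powr (\<kappa> - 1)) +
    4 * (4 * real n powr (- 1) + K * real n powr (- 1 / 2)) + 4 * K\<^sup>2 * real n powr (- 1)" for n
  have "g \<longlonglongrightarrow> 12 * (0 + K\<^sup>2 * 0) + 4 * (4 * 0 + K * 0) + 4 * K\<^sup>2 * 0"
    unfolding g_def[abs_def] using \<kappa>0
    by (intro tendsto_intros tendsto_neg_powr filterlim_real_sequentially) auto
  then have g0: "g \<longlonglongrightarrow> 0" by simp
  show ?thesis
  proof (rule LIMSEQ_I)
    fix r :: real assume r: "r > 0"
    \<comment> \<open>The \<eta> term sums to 4\<eta>, here half of \<open>r\<close>.\<close>
    define \<eta> where "\<eta> = r / 8"
    have \<eta>: "\<eta> > 0" using r by (simp add: \<eta>_def)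
    have "eventually (\<lambda>n. g n < r / 2) sequentially" using r by (intro order_tendstoD(2)[OF g0]) simp
    with discrepancy_eventually[OF \<theta> K \<kappa>_def \<eta>] eventually_ge_at_top[of 1]
    have "eventually (\<lambda>n. norm (total_error n - 0) < r) sequentially"
    proof eventually_elim
      case (elim n)
      define s where "s = real n powr (- 1 - 2 * \<kappa>) + K\<^sup>2 / (real n)\<^sup>2"
      define l where "l = 4 * real n powr (- 3) + K * real n powr (- 5 / 2) + \<eta> / (real n)\<^sup>2"
      have n: "0 < real n" "1 \<le> real n" using elim by auto
      have s0: "0 \<le> s" and l0: "0 \<le> l" using K \<eta> by (auto simp: s_def l_def)
      have row: "(\<Sum>k\<in>{1, 2} \<times> ({1..n} - {i}). discrepancy (v n) (d, i) k) \<le> 2 * ((2 * real n powr \<kappa> + 1) * s + real n * l)"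
        if di: "d \<in> {1, 2}" "i \<in> {1..n}" for d i
      proof -
        have "(\<Sum>k\<in>{1, 2} \<times> ({1..n} - {i}). discrepancy (v n) (d, i) k) =
            (\<Sum>d'\<in>{1, 2}. \<Sum>j\<in>{1..n} - {i}. discrepancy (v n) (d, i) (d', j))"
          by (simp add: sum.cartesian_product)
        also have "\<dots> \<le> (\<Sum>d'\<in>{1, 2::nat}. \<Sum>j\<in>{1..n} - {i}. (if \<bar>real i - real j\<bar> \<le> real n powr \<kappa> then s else 0) + l)"
        proof (intro sum_mono)
          fix d' j assume "d' \<in> {1, 2::nat}" "j \<in> {1..n} - {i}"
          then show "discrepancy (v n) (d, i) (d', j) \<le> (if \<bar>real i - real j\<bar> \<le> real n powr \<kappa> then s else 0) + l"
            using elim(1)[rule_format, of i j d d'] di unfolding s_def l_def by simp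
        qed
        also have "\<dots> \<le> (\<Sum>d'\<in>{1, 2::nat}. \<Sum>j\<in>{1..n}. (if \<bar>real i - real j\<bar> \<le> real n powr \<kappa> then s else 0) + l)"
          using s0 l0 by (intro sum_mono sum_mono2) auto
        also have "\<dots> = 2 * (real (card {j \<in> {1..n}. \<bar>real i - real j\<bar> \<le> real n powr \<kappa>}) * s + real n * l)"
          by (simp add: sum.distrib sum.If_cases Int_def conj_commute)
        also have "\<dots> \<le> 2 * ((2 * real n powr \<kappa> + 1) * s + real n * l)"
          using s0 by (intro mult_left_mono add_right_mono mult_right_mono card_near_le) auto
        finally show ?thesis .
      qed
      have pp: "exceed_prob (v n) (d, i) * (exceed_prob (v n) (1, i) + exceed_prob (v n) (2, i)) \<le> 2 * K\<^sup>2 / (real n)\<^sup>2"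
        if di: "d \<in> {1, 2}" "i \<in> {1..n}" for d i
      proof -
        have "exceed_prob (v n) (d', i) = p n d'" if "d' \<in> {1, 2}" for d' using di that by (intro p) auto
        moreover have "p n d * (p n 1 + p n 2) \<le> K / real n * (K / real n + K / real n)"
          using di K p_nonneg n elim by (intro mult_mono add_mono) auto
        ultimately show ?thesis using di by (simp add: power2_eq_square ac_simps)
      qed
      have "total_error n \<le> (\<Sum>e\<in>{1, 2::nat} \<times> {1..n}. 2 * ((2 * real n powr \<kappa> + 1) * s + real n * l) + 2 * K\<^sup>2 / (real n)\<^sup>2)"
        unfolding total_error_def using row pp by (intro sum_mono add_mono) auto
      also have "\<dots> = 4 * (real n * (2 * real n powr \<kappa> + 1) * s) + 4 * (real n)\<^sup>2 * l + 4 * K\<^sup>2 * (real n / (real n)\<^sup>2)"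
        by (simp add: algebra_simps power2_eq_square)
      also have "4 * (real n * (2 * real n powr \<kappa> + 1) * s) \<le> 4 * (real n * (3 * real n powr \<kappa>) * s)"
        using s0 n \<kappa>0 ge_one_powr_ge_zero[of "real n" \<kappa>] by (intro mult_left_mono mult_right_mono) auto
      also have "4 * (real n * (3 * real n powr \<kappa>) * s) = 12 * (real n powr (- \<kappa>) + K\<^sup>2 * real n powr (\<kappa> - 1))"
      proof -
        have 1: "real n * real n powr \<kappa> = real n powr (1 + \<kappa>)" using n by (simp add: powr_add)
        have "real n powr (1 + \<kappa>) * real n powr (- 1 - 2 * \<kappa>) = real n powr ((1 + \<kappa>) + (- 1 - 2 * \<kappa>))"
          by (simp only: powr_add)
        then have 2: "real n powr (1 + \<kappa>) * real n powr (- 1 - 2 * \<kappa>) = real n powr (- \<kappa>)" by simp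
        have "(real n)\<^sup>2 = real n powr 2" using n by (simp add: powr_numeral)
        then have "real n powr (1 + \<kappa>) / (real n)\<^sup>2 = real n powr ((1 + \<kappa>) - 2)" by (simp only: powr_diff)
        then have 3: "real n powr (1 + \<kappa>) / (real n)\<^sup>2 = real n powr (\<kappa> - 1)" by simp
        have "4 * (real n * (3 * real n powr \<kappa>) * s) = 12 * ((real n * real n powr \<kappa>) * real n powr (- 1 - 2 * \<kappa>) +
            K\<^sup>2 * ((real n * real n powr \<kappa>) / (real n)\<^sup>2))"
          unfolding s_def by (simp only: divide_inverse) algebra
        then show ?thesis unfolding 1 2 3 .
      qed
      also have "4 * (real n)\<^sup>2 * l = 4 * (4 * real n powr (- 1) + K * real n powr (- 1 / 2)) + 4 * \<eta>"
      proof -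
        have p2: "(real n)\<^sup>2 = real n powr 2" using n by (simp add: powr_numeral)
        have "real n powr 2 * real n powr (- 3) = real n powr (2 + (- 3))" "real n powr 2 * real n powr (- 5 / 2) = real n powr (2 + (- 5 / 2))"
          by (simp_all only: powr_add)
        then have 1: "(real n)\<^sup>2 * real n powr (- 3) = real n powr (- 1)" "(real n)\<^sup>2 * real n powr (- 5 / 2) = real n powr (- 1 / 2)"
          unfolding p2 by simp_all
        have 2: "(real n)\<^sup>2 * (\<eta> / (real n)\<^sup>2) = \<eta>" using n by simp
        have "4 * (real n)\<^sup>2 * l = 4 * (4 * ((real n)\<^sup>2 * real n powr (- 3)) + K * ((real n)\<^sup>2 * real n powr (- 5 / 2))) +
            4 * ((real n)\<^sup>2 * (\<eta> / (real n)\<^sup>2))"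
          unfolding l_def by (simp only: divide_inverse) algebra
        then show ?thesis unfolding 1 2 .
      qed
      also have "real n / (real n)\<^sup>2 = real n powr (- 1)"
        using n by (simp add: powr_minus divide_inverse power2_eq_square)
      finally have "total_error n \<le> g n + 4 * \<eta>" by (simp add: g_def)
      then show ?case using elim(3) total_error_nonneg[of n] by (simp add: \<eta>_def)
    qed
    then show "\<exists>no. \<forall>n\<ge>no. norm (total_error n - 0) < r" by (simp add: eventually_sequentially)
  qed
qed

text \<open>Each cell has a single type, so its mean count is its number of indices times one
  exceedance probability. The approximate recursion and tightness then feed
  \<open>poisson_limit_from_recursion\<close>.\<close>

theorem counts_converge:
  fixes C :: "nat \<Rightarrow> 'b \<Rightarrow> (nat \<times> nat) set" and \<delta> :: "'b \<Rightarrow> nat" and len :: "'b \<Rightarrow> real"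
  assumes B: "finite B" and \<delta>: "\<And>b. b \<in> B \<Longrightarrow> \<delta> b \<in> {1, 2}"
    and C: "\<And>n b. b \<in> B \<Longrightarrow> C n b \<subseteq> {\<delta> b} \<times> {1..n}" "\<And>n. disjoint_family_on (C n) B"
    and len: "\<And>b. b \<in> B \<Longrightarrow> (\<lambda>n. real (card (C n b)) / real n) \<longlonglongrightarrow> len b"
  shows "(\<lambda>n. \<P>(\<omega> in M. \<forall>b\<in>B. card (pat (v n) {1..n} \<omega> \<inter> C n b) = m b)) \<longlonglongrightarrow>
    (\<Prod>b\<in>B. (len b * c (\<delta> b)) ^ m b / fact (m b) * exp (- (len b * c (\<delta> b))))"
proof -
  define W where "W n b \<omega> = card (pat (v n) {1..n} \<omega> \<inter> C n b)" for n b \<omega>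
  have J: "finite {1..n}" "{1..n} \<subseteq> {1..}" for n :: nat by auto
  have C': "C n b \<subseteq> {1, 2} \<times> {1..n}" if "b \<in> B" for n b using C(1)[OF that] \<delta>[OF that] by fast
  have sum_p: "(\<Sum>e\<in>C n b. exceed_prob (v n) e) = real (card (C n b)) * p n (\<delta> b)" if b: "b \<in> B" for n b
  proof -
    have "exceed_prob (v n) e = p n (\<delta> b)" if "e \<in> C n b" for e
      using C(1)[OF b, of n] that \<delta>[OF b] by (cases e) (auto intro!: p simp: subset_iff)
    then show ?thesis by simp
  qed
  have sum_lim: "(\<lambda>n. \<Sum>e\<in>C n b. exceed_prob (v n) e) \<longlonglongrightarrow> len b * c (\<delta> b)" if b: "b \<in> B" for b
  proof (rule Lim_transform_eventually)
    show "(\<lambda>n. real (card (C n b)) / real n * (real n * p n (\<delta> b))) \<longlonglongrightarrow> len b * c (\<delta> b)"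
      by (intro tendsto_mult len[OF b] p_lim[OF \<delta>[OF b]])
    show "\<forall>\<^sub>F n in sequentially. real (card (C n b)) / real n * (real n * p n (\<delta> b)) = (\<Sum>e\<in>C n b. exceed_prob (v n) e)"
      using eventually_gt_at_top[of 0] by eventually_elim (simp add: sum_p[OF b])
  qed
  have W_meas: "W n b \<in> M \<rightarrow>\<^sub>M count_space UNIV" for n b
  proof -
    have "Measurable.pred M (\<lambda>\<omega>. W n b \<omega> = k)" for k
      unfolding W_def using pred_pattern_vec[OF J, where \<Phi> = "\<lambda>A. card (A \<inter> C n b) = k"] by simp
    then show ?thesis by (subst measurable_count_space_eq2_countable) (auto simp: pred_def vimage_def Int_def conj_commute)
  qed
  have "(\<lambda>n. \<Sum>b\<in>B. \<Sum>e\<in>C n b. exceed_prob (v n) e) \<longlonglongrightarrow> (\<Sum>b\<in>B. len b * c (\<delta> b))"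
    by (intro tendsto_sum sum_lim)
  \<comment> \<open>The limit of the total mean plus one serves as the tightness constant for all
    large n.\<close>
  from order_tendstoD(2)[OF this, of "(\<Sum>b\<in>B. len b * c (\<delta> b)) + 1"]
  have bounded: "eventually (\<lambda>n. (\<Sum>b\<in>B. \<Sum>e\<in>C n b. exceed_prob (v n) e) < (\<Sum>b\<in>B. len b * c (\<delta> b)) + 1) sequentially"
    by simp
  have "(\<lambda>n. \<P>(\<omega> in M. \<forall>b\<in>B. W n b \<omega> = m b)) \<longlonglongrightarrow>
    (\<Prod>b\<in>B. (len b * c (\<delta> b)) ^ m b / fact (m b) * exp (- (len b * c (\<delta> b))))"
  proof (rule poisson_limit_from_recursion[OF B])
    show "W n b \<in> M \<rightarrow>\<^sub>M count_space UNIV" for n b by (rule W_meas)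
    fix m :: "'b \<Rightarrow> nat" and b assume b: "b \<in> B"
    let ?P = "\<lambda>n m. \<P>(\<omega> in M. \<forall>b\<in>B. W n b \<omega> = m b)"
    have "(\<lambda>n. real (m b + 1) * ?P n (m(b := m b + 1)) - (\<Sum>e\<in>C n b. exceed_prob (v n) e) * ?P n m) \<longlonglongrightarrow> 0"
    proof (rule Lim_null_comparison[OF _ total_error_tendsto_0])
      have "eventually (\<lambda>n. 0 < v n 1 \<and> 0 < v n 2) sequentially"
        using level_at_top[of 1] level_at_top[of 2]
        by (auto simp: filterlim_at_top_dense intro!: eventually_conj)
      then show "\<forall>\<^sub>F n in sequentially. norm (real (m b + 1) * ?P n (m(b := m b + 1)) -
          (\<Sum>e\<in>C n b. exceed_prob (v n) e) * ?P n m) \<le> total_error n"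
      proof eventually_elim
        case (elim n)
        then show ?case
          using count_recursion[OF J _ _ C'[of _ n] C(2)[of n] b, where v = "v n" and m = m]
          unfolding W_def total_error_def real_norm_def by blast
      qed
    qed
    \<comment> \<open>The recursion holds with the mean at stage n; replacing it by its limit costs
      at most their distance, since the other factor is a probability.\<close>
    moreover have "(\<lambda>n. ((\<Sum>e\<in>C n b. exceed_prob (v n) e) - len b * c (\<delta> b)) * ?P n m) \<longlonglongrightarrow> 0"
    proof (rule Lim_null_comparison)
      have "(\<lambda>n. (\<Sum>e\<in>C n b. exceed_prob (v n) e) - len b * c (\<delta> b)) \<longlonglongrightarrow> 0"
        using sum_lim[OF b] by (simp add: LIM_zero_iff)
      then show "(\<lambda>n. \<bar>(\<Sum>e\<in>C n b. exceed_prob (v n) e) - len b * c (\<delta> b)\<bar>) \<longlonglongrightarrow> 0" by (rule tendsto_rabs_zero)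
      show "\<forall>\<^sub>F n in sequentially. norm (((\<Sum>e\<in>C n b. exceed_prob (v n) e) - len b * c (\<delta> b)) * ?P n m) \<le>
          \<bar>(\<Sum>e\<in>C n b. exceed_prob (v n) e) - len b * c (\<delta> b)\<bar>"
        by (intro always_eventually allI) (simp add: abs_mult mult_right_le_one_le)
    qed
    ultimately have "(\<lambda>n. (real (m b + 1) * ?P n (m(b := m b + 1)) - (\<Sum>e\<in>C n b. exceed_prob (v n) e) * ?P n m) +
        ((\<Sum>e\<in>C n b. exceed_prob (v n) e) - len b * c (\<delta> b)) * ?P n m) \<longlonglongrightarrow> 0 + 0"
      by (rule tendsto_add)
    then show "(\<lambda>n. real (m b + 1) * ?P n (m(b := m b + 1)) - len b * c (\<delta> b) * ?P n m) \<longlonglongrightarrow> 0"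
      by (simp add: algebra_simps)
  next
    fix K
    have count_tail_n: "1 - (\<Sum>b\<in>B. \<Sum>e\<in>C n b. exceed_prob (v n) e) / real (K + 1) \<le>
        \<P>(\<omega> in M. \<forall>b\<in>B. W n b \<omega> \<le> K)" for n
      unfolding W_def by (rule count_tail[OF J B C'])
    show "eventually (\<lambda>n. 1 - ((\<Sum>b\<in>B. len b * c (\<delta> b)) + 1) / real (K + 1) \<le> \<P>(\<omega> in M. \<forall>b\<in>B. W n b \<omega> \<le> K)) sequentially"
      using bounded
    proof eventually_elim
      case (elim n)
      have "(\<Sum>b\<in>B. \<Sum>e\<in>C n b. exceed_prob (v n) e) / real (K + 1) \<le> ((\<Sum>b\<in>B. len b * c (\<delta> b)) + 1) / real (K + 1)"
        using elim by (intro divide_right_mono) auto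
      then show ?case
        using count_tail_n[of n] by linarith
    qed
  qed
  then show ?thesis unfolding W_def .
qed

end

section \<open>The vague topology and dyadic cells\<close>

text \<open>Generation uses only finite intersections and arbitrary unions, both of which preserve
  an eventual inclusion, so subbasic sets suffice.\<close>

lemma topology_generated_by_eventually:
  assumes U: "openin (topology_generated_by \<S>) U" and m: "m \<in> U"
    and basis: "\<And>V. V \<in> \<S> \<Longrightarrow> m \<in> V \<Longrightarrow> eventually (\<lambda>l. \<forall>m'\<in>A l. m' \<in> V) F"
  shows "eventually (\<lambda>l. \<forall>m'\<in>A l. m' \<in> U) F"
proof -
  have "generate_topology_on \<S> U" using U by (simp add: openin_topology_generated_by_iff)
  then show ?thesis using m
  proof (induction rule: generate_topology_on.induct)
    case Empty
    then show ?case by simp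
  next
    case (Int a b)
    then have "eventually (\<lambda>l. \<forall>m'\<in>A l. m' \<in> a) F" "eventually (\<lambda>l. \<forall>m'\<in>A l. m' \<in> b) F" by auto
    then show ?case by eventually_elim auto
  next
    case (UN K)
    then obtain k where "k \<in> K" "m \<in> k" by auto
    with UN have "eventually (\<lambda>l. \<forall>m'\<in>A l. m' \<in> k) F" by auto
    then show ?case by eventually_elim (use \<open>k \<in> K\<close> in auto)
  next
    case (Basis s)
    then show ?case using basis by auto
  qed
qed

text \<open>The index is (position, type), as for points of \<open>biv_space\<close> and opposite to
  the (type, index) order of exceedances.\<close>

definition cell :: "nat \<Rightarrow> nat \<times> nat \<Rightarrow> (real \<times> nat) set" where
  "cell l b = {real (fst b) / 2 ^ l<..real (fst b + 1) / 2 ^ l} \<times> {snd b}"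

definition cells :: "nat \<Rightarrow> (nat \<times> nat) set" where
  "cells l = {..<2 ^ l} \<times> {1, 2}"

lemma finite_cells [simp]: "finite (cells l)" by (simp add: cells_def)

lemma cell_subset: "b \<in> cells l \<Longrightarrow> cell l b \<subseteq> biv_space"
proof
  fix z assume b: "b \<in> cells l" and "z \<in> cell l b"
  then have z: "real (fst b) / 2 ^ l < fst z" "fst z \<le> real (fst b + 1) / 2 ^ l" "snd z = snd b"
    by (auto simp: cell_def)
  have "0 \<le> real (fst b) / 2 ^ l" by simp
  then have "0 < fst z" using z by linarith
  moreover have "fst b + 1 \<le> 2 ^ l" using b by (auto simp: cells_def)
  then have "real (fst b + 1) \<le> 2 ^ l" by (metis of_nat_le_iff of_nat_numeral of_nat_power)
  then have "real (fst b + 1) / 2 ^ l \<le> 1" by (simp add: divide_le_eq)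
  then have "fst z \<le> 1" using z by linarith
  ultimately show "z \<in> biv_space" using z b by (cases z) (auto simp: biv_space_def cells_def)
qed

lemma borel_biv_space: "biv_space \<in> sets borel"
proof -
  have "biv_space \<in> sets (restrict_space borel biv_space)"
    using sets.top[of "restrict_space borel biv_space"] by (simp add: space_restrict_space)
  then show ?thesis by (rule sets_biv_space_borel)
qed

lemma sets_cell: "b \<in> cells l \<Longrightarrow> cell l b \<in> sets (restrict_space borel biv_space)"
proof -
  assume b: "b \<in> cells l"
  have "cell l b \<in> sets ((borel :: real measure) \<Otimes>\<^sub>M (borel :: nat measure))"
    unfolding cell_def by (intro pair_measureI) auto
  then have "cell l b \<in> sets borel" by (simp only: borel_prod)
  then show ?thesis
    using cell_subset[OF b] borel_biv_space by (simp add: sets_restrict_space_iff)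
qed

text \<open>Cells are open on the left and closed on the right, so the position is the ceiling of t
  2^l minus one, and t = 1 lies in the last cell.\<close>

lemma cell_unique:
  fixes l :: nat
  assumes "t \<in> {0<..1}" "d \<in> {1, 2}"
  defines "j \<equiv> nat (\<lceil>t * 2 ^ l\<rceil> - 1)"
  shows "(j, d) \<in> cells l" and "b \<in> cells l \<Longrightarrow> (t, d) \<in> cell l b \<longleftrightarrow> b = (j, d)"
proof -
  have "0 < t * 2 ^ l" using assms by simp
  then have c1: "1 \<le> \<lceil>t * 2 ^ l\<rceil>" by (simp add: one_le_ceiling)
  have "t * 2 ^ l \<le> 2 ^ l" using assms by simp
  then have "\<lceil>t * 2 ^ l\<rceil> \<le> 2 ^ l" by (simp add: ceiling_le_iff)
  then have "j < 2 ^ l" using c1 unfolding j_def by (simp add: nat_less_iff)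
  then show "(j, d) \<in> cells l" using assms by (simp add: cells_def)
  assume b: "b \<in> cells l"
  have "(t, d) \<in> cell l b \<longleftrightarrow> (real (fst b) < t * 2 ^ l \<and> t * 2 ^ l \<le> real (fst b) + 1) \<and> d = snd b"
    by (auto simp: cell_def pos_divide_less_eq pos_le_divide_eq)
  moreover have "real (fst b) < t * 2 ^ l \<and> t * 2 ^ l \<le> real (fst b) + 1 \<longleftrightarrow> \<lceil>t * 2 ^ l\<rceil> = int (fst b) + 1"
    by (auto simp: ceiling_eq_iff)
  moreover have "\<lceil>t * 2 ^ l\<rceil> = int (fst b) + 1 \<longleftrightarrow> fst b = j" using c1 unfolding j_def by auto
  ultimately show "(t, d) \<in> cell l b \<longleftrightarrow> b = (j, d)" by (cases b) auto
qed

lemma disjoint_cells: "disjoint_family_on (cell l) (cells l)"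
  unfolding disjoint_family_on_def
proof (intro ballI impI)
  fix b b' assume b: "b \<in> cells l" "b' \<in> cells l" "b \<noteq> b'"
  show "cell l b \<inter> cell l b' = {}"
  proof (rule ccontr)
    assume "cell l b \<inter> cell l b' \<noteq> {}"
    then obtain t d where z: "(t, d) \<in> cell l b" "(t, d) \<in> cell l b'" by fast
    then have "(t, d) \<in> biv_space" using cell_subset b by blast
    then show False using cell_unique(2)[of t d b, where l = l] cell_unique(2)[of t d b', where l = l] z b
      by (auto simp: biv_space_def)
  qed
qed

lemma UN_cells: "(\<Union>b\<in>cells l. cell l b) = biv_space"
proof
  show "(\<Union>b\<in>cells l. cell l b) \<subseteq> biv_space" using cell_subset by blast
  show "biv_space \<subseteq> (\<Union>b\<in>cells l. cell l b)"
  proof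
    fix z :: "real \<times> nat" assume "z \<in> biv_space"
    then obtain t d where z: "z = (t, d)" "t \<in> {0<..1}" "d \<in> {1, 2}" by (auto simp: biv_space_def)
    then show "z \<in> (\<Union>b\<in>cells l. cell l b)"
      using cell_unique[OF z(2,3), where l = l] by blast
  qed
qed

section \<open>Finite point measures and their cell counts\<close>

definition finite_point_measures :: "(real \<times> nat) measure set" where
  "finite_point_measures = {m \<in> point_measures biv_space. emeasure m biv_space < \<infinity>}"

text \<open>The floor only converts the type: on a finite point measure every measure value is a
  natural number already.\<close>

definition ncount :: "(real \<times> nat) measure \<Rightarrow> (real \<times> nat) set \<Rightarrow> nat" where
  "ncount m B = nat \<lfloor>measure m B\<rfloor>"

lemma finite_point_measuresD:
  assumes "m \<in> finite_point_measures"
  shows "sets m = sets (restrict_space borel biv_space)" "space m = biv_space" "finite_measure m"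
    and "B \<in> sets (restrict_space borel biv_space) \<Longrightarrow> emeasure m B = of_nat (ncount m B)"
    and "B \<in> sets (restrict_space borel biv_space) \<Longrightarrow> measure m B = real (ncount m B)"
proof -
  show s: "sets m = sets (restrict_space borel biv_space)"
    using assms by (simp add: finite_point_measures_def point_measures_def)
  then show sp: "space m = biv_space" using sets_eq_imp_space_eq[OF s] by (simp add: space_restrict_space)
  show fm: "finite_measure m"
    using assms by (intro finite_measureI) (auto simp: sp finite_point_measures_def)
  interpret finite_measure m by fact
  assume B: "B \<in> sets (restrict_space borel biv_space)"
  then have "emeasure m B \<in> insert \<infinity> (range of_nat)"
    using assms s by (auto simp: finite_point_measures_def point_measures_def)
  then obtain k where k: "emeasure m B = of_nat k" using emeasure_finite[of B] by auto
  then have "measure m B = real k" by (simp add: measure_def)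
  then show "emeasure m B = of_nat (ncount m B)" "measure m B = real (ncount m B)"
    using k by (simp_all add: ncount_def)
qed

text \<open>The space is not compact, but the support stays at some distance \<open>a\<close> from
  zero. Uniform continuity on [a/2, 1] covers pairs inside that interval; otherwise both points lie
  below \<open>a\<close>, where \<open>f\<close> vanishes.\<close>

lemma compactly_supported_uniform:
  assumes f: "f \<in> compactly_supported biv_space" and \<eta>: "\<eta> > 0"
  obtains \<delta> where "\<delta> > 0" "\<And>t t' d. t \<in> {0<..1} \<Longrightarrow> t' \<in> {0<..1} \<Longrightarrow> d \<in> {1, 2} \<Longrightarrow> \<bar>t - t'\<bar> < \<delta> \<Longrightarrow>
    \<bar>f (t, d) - f (t', d)\<bar> < \<eta>"
proof -
  obtain K where f: "continuous_on biv_space f" and K: "compact K" "K \<subseteq> biv_space" "\<And>z. z \<in> biv_space - K \<Longrightarrow> f z = 0"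
    using f unfolding compactly_supported_def by auto
  obtain a where a: "0 < a" "\<And>z. z \<in> K \<Longrightarrow> a \<le> fst z"
  proof (cases "K = {}")
    case True
    then show ?thesis using that[of 1] by simp
  next
    case False
    have "compact (fst ` K)" using K(1) by (intro compact_continuous_image continuous_on_fst continuous_on_id)
    from compact_attains_inf[OF this] False obtain z where z: "z \<in> K" "\<forall>t\<in>K. fst z \<le> fst t" by auto
    then show ?thesis using that[of "fst z"] K(2) by (auto simp: biv_space_def)
  qed
  have zero: "f (t, d) = 0" if "t < a" "t \<in> {0<..1}" "d \<in> {1, 2}" for t d
    using that a(2)[of "(t, d)"] K(3)[of "(t, d)"] by (auto simp: biv_space_def)
  have "\<exists>\<delta>>0. \<forall>t\<in>{a / 2..1}. \<forall>t'\<in>{a / 2..1}. \<bar>t' - t\<bar> < \<delta> \<longrightarrow> \<bar>f (t', d) - f (t, d)\<bar> < \<eta>" if d: "d \<in> {1, 2}" for d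
  proof -
    have "continuous_on {a / 2..1} (\<lambda>t. f (t, d))"
      using a d by (intro continuous_on_compose2[OF f]) (auto simp: biv_space_def intro!: continuous_intros)
    then have "uniformly_continuous_on {a / 2..1} (\<lambda>t. f (t, d))"
      by (rule compact_uniformly_continuous) simp
    then show ?thesis unfolding uniformly_continuous_on_def dist_real_def using \<eta> by blast
  qed
  then obtain \<delta> where \<delta>: "\<And>d. d \<in> {1, 2} \<Longrightarrow> \<delta> d > 0 \<and>
      (\<forall>t\<in>{a / 2..1}. \<forall>t'\<in>{a / 2..1}. \<bar>t' - t\<bar> < \<delta> d \<longrightarrow> \<bar>f (t', d) - f (t, d)\<bar> < \<eta>)" by metis
  show ?thesis
  proof (rule that[of "min (min (\<delta> 1) (\<delta> 2)) (a / 2)"])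
    show "min (min (\<delta> 1) (\<delta> 2)) (a / 2) > 0" using \<delta> a by simp
    fix t t' d assume t: "t \<in> {0<..1}" "t' \<in> {0<..1}" "d \<in> {1, 2::nat}" "\<bar>t - t'\<bar> < min (min (\<delta> 1) (\<delta> 2)) (a / 2)"
    show "\<bar>f (t, d) - f (t', d)\<bar> < \<eta>"
    proof (cases "a / 2 \<le> t \<and> a / 2 \<le> t'")
      case True
      have "\<bar>t - t'\<bar> < \<delta> d" using t by auto
      then show ?thesis using \<delta>[OF t(3)] True t by auto
    next
      case False
      \<comment> \<open>One of the points is below a/2 and they are less than a/2 apart.\<close>
      then have "t < a" "t' < a" using t(4) a by linarith+
      then show ?thesis using zero t \<eta> by simp
    qed
  qed
qed

text \<open>On fine cells \<open>f\<close> differs by at most \<eta> from its value at the right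
  endpoint, which belongs to the space. The integral of the step function is determined by the
  counts, and the mesh does not depend on the measure.\<close>

lemma integral_cell_approximation:
  assumes f: "f \<in> compactly_supported biv_space" and \<eta>: "\<eta> > 0"
  shows "eventually (\<lambda>l. \<forall>m\<in>finite_point_measures.
    \<bar>(\<integral>z. f z \<partial>m) - (\<Sum>b\<in>cells l. f (real (fst b + 1) / 2 ^ l, snd b) * real (ncount m (cell l b)))\<bar> \<le>
      \<eta> * (\<Sum>b\<in>cells l. real (ncount m (cell l b)))) sequentially"
proof -
  obtain \<delta> where \<delta>: "\<delta> > 0" "\<And>t t' d. t \<in> {0<..1} \<Longrightarrow> t' \<in> {0<..1} \<Longrightarrow> d \<in> {1, 2} \<Longrightarrow> \<bar>t - t'\<bar> < \<delta> \<Longrightarrow>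
    \<bar>f (t, d) - f (t', d)\<bar> < \<eta>" using compactly_supported_uniform[OF f \<eta>] by metis
  have "(\<lambda>l. (1 / 2) ^ l :: real) \<longlonglongrightarrow> 0" by (intro LIMSEQ_power_zero) auto
  from order_tendstoD(2)[OF this \<delta>(1)] show ?thesis
  proof eventually_elim
    case (elim l)
    show ?case
    proof
      fix m assume m: "m \<in> finite_point_measures"
      note mD = finite_point_measuresD[OF m]
      interpret finite_measure m by (rule mD(3))
      define R where "R z = (\<Sum>b\<in>cells l. f (real (fst b + 1) / 2 ^ l, snd b) * indicator (cell l b) z)" for z
      have near: "\<bar>f z - R z\<bar> \<le> \<eta>" if zE: "z \<in> biv_space" for z
      proof -
        obtain t d where z: "z = (t, d)" "t \<in> {0<..1}" "d \<in> {1, 2}" using zE by (auto simp: biv_space_def)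
        define j where "j = nat (\<lceil>t * 2 ^ l\<rceil> - 1)"
        note cu = cell_unique[OF z(2,3), where l = l, folded j_def]
        have "R z = (\<Sum>b\<in>cells l. if b = (j, d) then f (real (fst b + 1) / 2 ^ l, snd b) else 0)"
          unfolding R_def using cu(2) z by (intro sum.cong) (auto simp: indicator_def)
        then have R: "R z = f (real (j + 1) / 2 ^ l, d)" using cu(1) by simp
        have "z \<in> cell l (j, d)" using cu z by simp
        then have t: "real j / 2 ^ l < t" "t \<le> real (j + 1) / 2 ^ l" using z by (auto simp: cell_def)
        have "j + 1 \<le> 2 ^ l" using cu(1) by (auto simp: cells_def)
        then have "real (j + 1) \<le> 2 ^ l" by (metis of_nat_le_iff of_nat_numeral of_nat_power)
        then have r1: "real (j + 1) / 2 ^ l \<in> {0<..1}" by (simp add: divide_le_eq)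
        have "real (j + 1) / 2 ^ l = real j / 2 ^ l + (1 / 2) ^ l" by (simp add: add_divide_distrib power_divide)
        then have "\<bar>t - real (j + 1) / 2 ^ l\<bar> < \<delta>" using t elim by linarith
        then show ?thesis using \<delta>(2)[OF z(2) r1 z(3)] unfolding R unfolding z(1) by simp
      qed
      have fm [measurable]: "f \<in> borel_measurable m"
      proof -
        have "continuous_on biv_space f" using f by (simp add: compactly_supported_def)
        then have "f \<in> borel_measurable (restrict_space borel biv_space)"
          by (rule borel_measurable_continuous_on_restrict)
        then show ?thesis using measurable_cong_sets[OF mD(1) refl] by blast
      qed
      have cs: "cell l b \<in> sets m" if "b \<in> cells l" for b using sets_cell[OF that] mD(1) by simp
      have iR: "integrable m R" unfolding R_def[abs_def] using cs
        by (intro Bochner_Integration.integrable_sum integrable_mult_right) (simp add: emeasure_eq_measure)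
      have fR: "integrable m (\<lambda>z. f z - R z)"
      proof (rule integrable_const_bound[of _ \<eta>])
        show "AE z in m. norm (f z - R z) \<le> \<eta>" using near by (intro AE_I2) (simp add: mD(2))
      qed (use iR in measurable)
      \<comment> \<open>Integrability of \<open>f\<close> follows by adding the step function to the
        bounded difference.\<close>
      have "integrable m (\<lambda>z. (f z - R z) + R z)" by (intro Bochner_Integration.integrable_add fR iR)
      then have if': "integrable m f" by simp
      have IR: "(\<integral>z. R z \<partial>m) = (\<Sum>b\<in>cells l. f (real (fst b + 1) / 2 ^ l, snd b) * real (ncount m (cell l b)))"
        unfolding R_def using cs mD(5)[OF sets_cell]
        by (subst Bochner_Integration.integral_sum) (auto simp: emeasure_eq_measure intro!: sum.cong)
      have tot: "measure m (space m) = (\<Sum>b\<in>cells l. real (ncount m (cell l b)))"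
        unfolding mD(2) UN_cells[of l, symmetric] using cs mD(5)[OF sets_cell]
        by (subst finite_measure_finite_Union) (auto simp: disjoint_cells)
      have "\<bar>(\<integral>z. f z \<partial>m) - (\<integral>z. R z \<partial>m)\<bar> = \<bar>\<integral>z. f z - R z \<partial>m\<bar>"
        using if' iR by simp
      also have "\<dots> \<le> (\<integral>z. \<bar>f z - R z\<bar> \<partial>m)" by (rule integral_abs_bound)
      also have "\<dots> \<le> (\<integral>z. \<eta> \<partial>m)"
        using near fR by (intro integral_mono_AE integrable_abs) (auto simp: mD(2) intro!: AE_I2)
      also have "\<dots> = \<eta> * measure m (space m)" by simp
      finally show "\<bar>(\<integral>z. f z \<partial>m) - (\<Sum>b\<in>cells l. f (real (fst b + 1) / 2 ^ l, snd b) * real (ncount m (cell l b)))\<bar> \<le>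
        \<eta> * (\<Sum>b\<in>cells l. real (ncount m (cell l b)))"
        unfolding IR tot .
    qed
  qed
qed

lemma total_ncount:
  assumes "m \<in> finite_point_measures"
  shows "(\<Sum>b\<in>cells l. real (ncount m (cell l b))) = measure m biv_space"
proof -
  note mD = finite_point_measuresD[OF assms]
  interpret finite_measure m by (rule mD(3))
  show ?thesis
    unfolding UN_cells[of l, symmetric] using sets_cell mD(1) mD(5)[OF sets_cell]
    by (subst finite_measure_finite_Union) (auto simp: disjoint_cells)
qed

text \<open>Sets of finite measures with prescribed counts in dyadic cells form a neighbourhood base
  at every finite point measure.\<close>

theorem vague_neighbourhood_contains_cell_class:
  assumes U: "openin (vague_topology biv_space) U" and m: "m \<in> U" "m \<in> finite_point_measures"
  shows "eventually (\<lambda>l. \<forall>m'\<in>{m' \<in> finite_point_measures. \<forall>b\<in>cells l. ncount m' (cell l b) = ncount m (cell l b)}.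
    m' \<in> U) sequentially"
proof (rule topology_generated_by_eventually[OF U[unfolded vague_topology_def] m(1)])
  fix V assume "V \<in> {{m \<in> point_measures biv_space. (\<integral>z. f z \<partial>m) \<in> U} | f U. f \<in> compactly_supported biv_space \<and> open U}"
    and mV: "m \<in> V"
  then obtain f O' where V: "V = {m \<in> point_measures biv_space. (\<integral>z. f z \<partial>m) \<in> O'}"
    and f: "f \<in> compactly_supported biv_space" and O': "open O'" by blast
  obtain \<epsilon> where \<epsilon>: "\<epsilon> > 0" "ball (\<integral>z. f z \<partial>m) \<epsilon> \<subseteq> O'"
    using O' mV unfolding V open_contains_ball by auto
  define T where "T = measure m biv_space"
  have T: "T \<ge> 0" by (simp add: T_def)
  \<comment> \<open>Adding one keeps the divisor positive for the zero measure. Each of the two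
    approximations then errs by at most \<epsilon>/4.\<close>
  define T' where "T' = T + 1"
  have T': "T' > 0" "T \<le> T'" using T by (auto simp: T'_def)
  define \<eta> where "\<eta> = \<epsilon> / (4 * T')"
  have \<eta>: "\<eta> > 0" using \<epsilon> T' by (simp add: \<eta>_def)
  have "\<eta> * T \<le> \<eta> * T'" using \<eta> T' by (intro mult_left_mono) auto
  also have "\<dots> = \<epsilon> / 4" using T' by (simp add: \<eta>_def)
  finally have \<eta>T: "\<eta> * T \<le> \<epsilon> / 4" .
  show "eventually (\<lambda>l. \<forall>m'\<in>{m' \<in> finite_point_measures. \<forall>b\<in>cells l. ncount m' (cell l b) = ncount m (cell l b)}.
    m' \<in> V) sequentially"
    using integral_cell_approximation[OF f \<eta>]
  proof eventually_elim
    case (elim l)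
    show ?case
    proof
      fix m' assume "m' \<in> {m' \<in> finite_point_measures. \<forall>b\<in>cells l. ncount m' (cell l b) = ncount m (cell l b)}"
      then have m': "m' \<in> finite_point_measures" "\<And>b. b \<in> cells l \<Longrightarrow> ncount m' (cell l b) = ncount m (cell l b)" by auto
      let ?s = "\<lambda>m. \<Sum>b\<in>cells l. f (real (fst b + 1) / 2 ^ l, snd b) * real (ncount m (cell l b))"
      have eq: "?s m' = ?s m" "(\<Sum>b\<in>cells l. real (ncount m' (cell l b))) = T"
        using m'(2) total_ncount[OF m(2), of l] by (simp_all add: T_def)
      have "\<bar>(\<integral>z. f z \<partial>m') - ?s m\<bar> \<le> \<eta> * T" using elim m'(1) eq by fastforce
      moreover have "\<bar>(\<integral>z. f z \<partial>m) - ?s m\<bar> \<le> \<eta> * T"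
        using elim m(2) total_ncount[OF m(2), of l] by (fastforce simp: T_def)
      ultimately have "\<bar>(\<integral>z. f z \<partial>m) - (\<integral>z. f z \<partial>m')\<bar> < \<epsilon>" using \<eta>T \<epsilon>(1) by linarith
      then have "(\<integral>z. f z \<partial>m') \<in> O'" using \<epsilon>(2) by (auto simp: dist_real_def)
      then show "m' \<in> V" using m'(1) by (auto simp: V finite_point_measures_def)
    qed
  qed
qed

lemma measurable_restrict_count_space:
  fixes W :: "'b \<Rightarrow> 'a \<Rightarrow> nat"
  assumes B: "finite B" and W: "\<And>b. b \<in> B \<Longrightarrow> W b \<in> M \<rightarrow>\<^sub>M count_space UNIV"
  shows "(\<lambda>\<omega>. \<lambda>b\<in>B. W b \<omega>) \<in> M \<rightarrow>\<^sub>M count_space (B \<rightarrow>\<^sub>E UNIV)"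
proof (subst measurable_count_space_eq_countable)
  show "countable (B \<rightarrow>\<^sub>E (UNIV :: nat set))" using B by (intro countable_PiE) auto
  have "(\<lambda>\<omega>. \<lambda>b\<in>B. W b \<omega>) -` {m} \<inter> space M \<in> sets M" if m: "m \<in> B \<rightarrow>\<^sub>E UNIV" for m
  proof -
    have "(\<lambda>\<omega>. \<lambda>b\<in>B. W b \<omega>) -` {m} \<inter> space M = {\<omega> \<in> space M. \<forall>b\<in>B. W b \<omega> = m b}"
      using m by (auto simp: fun_eq_iff PiE_iff extensional_def)
    also have "\<dots> \<in> sets M"
    proof (intro sets.sets_Collect_finite_All B)
      fix b assume "b \<in> B"
      then show "{\<omega> \<in> space M. W b \<omega> = m b} \<in> sets M"
        using measurable_sets[OF W, of b "{m b}"] by (simp add: vimage_def Int_def conj_commute)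
    qed
    finally show ?thesis .
  qed
  then show "(\<lambda>\<omega>. \<lambda>b\<in>B. W b \<omega>) \<in> space M \<rightarrow> (B \<rightarrow>\<^sub>E UNIV) \<and>
      (\<forall>m\<in>B \<rightarrow>\<^sub>E UNIV. (\<lambda>\<omega>. \<lambda>b\<in>B. W b \<omega>) -` {m} \<inter> space M \<in> sets M)" by auto
qed

text \<open>The vector of counts has countably many values, so \<open>h\<close> needs no
  regularity.\<close>

lemma measurable_function_of_counts:
  fixes W :: "'b \<Rightarrow> 'a \<Rightarrow> nat"
  assumes B: "finite B" and W: "\<And>b. b \<in> B \<Longrightarrow> W b \<in> M \<rightarrow>\<^sub>M count_space UNIV" and h: "\<And>m. h m \<in> space N"
  shows "(\<lambda>\<omega>. h (\<lambda>b\<in>B. W b \<omega>)) \<in> M \<rightarrow>\<^sub>M N"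
  by (rule measurable_compose[OF measurable_restrict_count_space[OF B W]]) (use h in auto)

definition cell_class :: "nat \<Rightarrow> (nat \<times> nat \<Rightarrow> nat) \<Rightarrow> (real \<times> nat) measure set" where
  "cell_class l c = {m \<in> finite_point_measures. \<forall>b\<in>cells l. ncount m (cell l b) = c b}"

definition cell_counts :: "nat \<Rightarrow> (real \<times> nat) measure \<Rightarrow> nat \<times> nat \<Rightarrow> nat" where
  "cell_counts l m = (\<lambda>b\<in>cells l. ncount m (cell l b))"

lemma cell_class_counts: "m \<in> finite_point_measures \<Longrightarrow> m \<in> cell_class l (cell_counts l m)"
  by (simp add: cell_class_def cell_counts_def)

lemma vague_neighbourhood:
  assumes "openin (vague_topology biv_space) U" "m \<in> U" "m \<in> finite_point_measures"
  shows "eventually (\<lambda>l. cell_class l (cell_counts l m) \<subseteq> U) sequentially"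
  using vague_neighbourhood_contains_cell_class[OF assms]
  by eventually_elim (auto simp: cell_class_def cell_counts_def)

section \<open>Measurability and convergence through cell counts\<close>

lemma space_borel_of: "space (borel_of T) = topspace T"
  unfolding borel_of_def by (rule space_measure_of) (auto dest: openin_subset)

lemma sets_borel_of: "sets (borel_of T) = sigma_sets (topspace T) {U. openin T U}"
  unfolding borel_of_def by (rule sets_measure_of) (auto dest: openin_subset)

lemma borel_measurable_continuous_map:
  fixes G :: "'b \<Rightarrow> real"
  assumes "continuous_map T euclideanreal G"
  shows "G \<in> borel_measurable (borel_of T)"
proof (rule borel_measurableI)
  fix V :: "real set" assume "open V"
  then have "openin T {x \<in> topspace T. G x \<in> V}"
    using assms by (auto simp: continuous_map_def)
  moreover have "G -` V \<inter> space (borel_of T) = {x \<in> topspace T. G x \<in> V}" by (auto simp: space_borel_of)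
  ultimately show "G -` V \<inter> space (borel_of T) \<in> sets (borel_of T)" by (auto simp: sets_borel_of)
qed

text \<open>A finite point measure lies in an open set exactly when its class at some level is
  contained in it. The preimage is thus a countable union of events about counts.\<close>

lemma measurable_vague:
  assumes Z: "\<And>\<omega>. \<omega> \<in> space M \<Longrightarrow> Z \<omega> \<in> finite_point_measures"
    and counts: "\<And>l b. b \<in> cells l \<Longrightarrow> (\<lambda>\<omega>. ncount (Z \<omega>) (cell l b)) \<in> M \<rightarrow>\<^sub>M count_space UNIV"
  shows "Z \<in> M \<rightarrow>\<^sub>M borel_of (vague_topology biv_space)"
  unfolding borel_of_def
proof (rule measurable_measure_of)
  show "{U. openin (vague_topology biv_space) U} \<subseteq> Pow (topspace (vague_topology biv_space))"
    by (auto dest: openin_subset)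
  show "Z \<in> space M \<rightarrow> topspace (vague_topology biv_space)"
    using Z by (auto simp: topspace_vague_topology finite_point_measures_def)
  fix U assume "U \<in> {U. openin (vague_topology biv_space) U}"
  then have U: "openin (vague_topology biv_space) U" by simp
  have "Z -` U \<inter> space M = (\<Union>l. {\<omega> \<in> space M. cell_class l (cell_counts l (Z \<omega>)) \<subseteq> U})"
  proof (intro equalityI subsetI)
    fix \<omega> assume "\<omega> \<in> Z -` U \<inter> space M"
    then show "\<omega> \<in> (\<Union>l. {\<omega> \<in> space M. cell_class l (cell_counts l (Z \<omega>)) \<subseteq> U})"
      using eventually_happens'[OF sequentially_bot vague_neighbourhood[OF U, of "Z \<omega>"]] Z[of \<omega>] by auto
  next
    fix \<omega> assume "\<omega> \<in> (\<Union>l. {\<omega> \<in> space M. cell_class l (cell_counts l (Z \<omega>)) \<subseteq> U})"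
    then show "\<omega> \<in> Z -` U \<inter> space M" using cell_class_counts[OF Z[of \<omega>]] by blast
  qed
  also have "\<dots> \<in> sets M"
  proof (rule sets.countable_UN)
    have "{\<omega> \<in> space M. cell_class l (cell_counts l (Z \<omega>)) \<subseteq> U} \<in> sets M" for l
    proof -
      have "(\<lambda>\<omega>. cell_class l (\<lambda>b\<in>cells l. ncount (Z \<omega>) (cell l b)) \<subseteq> U) \<in> M \<rightarrow>\<^sub>M count_space UNIV"
        by (rule measurable_function_of_counts[where h = "\<lambda>c. cell_class l c \<subseteq> U"]) (use counts in auto)
      then show ?thesis unfolding cell_counts_def by (simp add: pred_def)
    qed
    then show "range (\<lambda>l. {\<omega> \<in> space M. cell_class l (cell_counts l (Z \<omega>)) \<subseteq> U}) \<subseteq> sets M" by blast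
  qed
  finally show "Z -` U \<inter> space M \<in> sets M" .
qed

text \<open>At a fixed level the infimum and supremum of \<open>G\<close> over a class are bounded
  functions of finitely many counts, whose expectations converge in \<open>n\<close>. The level is
  then refined under the limit law only.\<close>

theorem vague_convergence_from_cell_counts:
  fixes Z :: "nat \<Rightarrow> 'a \<Rightarrow> (real \<times> nat) measure" and W :: "'c \<Rightarrow> (real \<times> nat) measure"
  assumes M: "prob_space M" and Q: "prob_space Q"
    and Z: "\<And>n \<omega>. \<omega> \<in> space M \<Longrightarrow> Z n \<omega> \<in> finite_point_measures"
    and W: "\<And>\<omega>. \<omega> \<in> space Q \<Longrightarrow> W \<omega> \<in> finite_point_measures"
    and cZ: "\<And>n l b. b \<in> cells l \<Longrightarrow> (\<lambda>\<omega>. ncount (Z n \<omega>) (cell l b)) \<in> M \<rightarrow>\<^sub>M count_space UNIV"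
    and cW: "\<And>l b. b \<in> cells l \<Longrightarrow> (\<lambda>\<omega>. ncount (W \<omega>) (cell l b)) \<in> Q \<rightarrow>\<^sub>M count_space UNIV"
    and lim: "\<And>l m. (\<lambda>n. \<P>(\<omega> in M. \<forall>b\<in>cells l. ncount (Z n \<omega>) (cell l b) = m b)) \<longlonglongrightarrow>
      \<P>(\<omega> in Q. \<forall>b\<in>cells l. ncount (W \<omega>) (cell l b) = m b)"
  shows "converges_in_distribution (vague_topology biv_space) M Z Q W"
  unfolding converges_in_distribution_def
proof (intro conjI allI impI)
  interpret M: prob_space M by fact
  interpret Q: prob_space Q by fact
  show Zm: "Z n \<in> M \<rightarrow>\<^sub>M borel_of (vague_topology biv_space)" for n
    by (rule measurable_vague[OF Z cZ])
  show Wm: "W \<in> Q \<rightarrow>\<^sub>M borel_of (vague_topology biv_space)"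
    by (rule measurable_vague[OF W cW])
  fix G :: "(real \<times> nat) measure \<Rightarrow> real"
  let ?T = "vague_topology biv_space"
  assume "continuous_map ?T euclideanreal G \<and> bounded (G ` topspace ?T)"
  then have G: "continuous_map ?T euclideanreal G" and "bounded (G ` topspace ?T)" by auto
  then obtain C where C': "\<And>m. m \<in> topspace ?T \<Longrightarrow> \<bar>G m\<bar> \<le> C" by (auto simp: bounded_iff)
  have FP: "m \<in> finite_point_measures \<Longrightarrow> m \<in> topspace ?T" for m
    by (simp add: topspace_vague_topology finite_point_measures_def)
  have C: "\<bar>G m\<bar> \<le> C" if "m \<in> finite_point_measures" for m using C' FP that by blast
  obtain \<omega>0 where "\<omega>0 \<in> space M" using M.not_empty by blast
  then have C0: "0 \<le> C" using C[OF Z[of \<omega>0 0]] by linarith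
  have bdd: "bdd_above (G ` cell_class l c)" "bdd_below (G ` cell_class l c)" for l c
    using C unfolding cell_class_def
    by (auto intro!: bdd_aboveI2[where M = C] bdd_belowI2[where m = "- C"] simp: abs_le_iff minus_le_iff)
  \<comment> \<open>The value 0 on empty classes keeps both functions bounded by \<open>C\<close>
    for all arguments.\<close>
  define hi where "hi l c = (if cell_class l c = {} then 0 else Sup (G ` cell_class l c))" for l c
  define lo where "lo l c = (if cell_class l c = {} then 0 else Inf (G ` cell_class l c))" for l c
  have "- C \<le> hi l c \<and> hi l c \<le> C \<and> - C \<le> lo l c \<and> lo l c \<le> C" for l c
  proof (cases "cell_class l c = {}")
    case False
    then obtain m where m: "m \<in> cell_class l c" by auto
    have b: "- C \<le> G x \<and> G x \<le> C" if "x \<in> cell_class l c" for x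
      using C[of x] that by (auto simp: cell_class_def abs_le_iff)
    have "Sup (G ` cell_class l c) \<le> C" using False b by (intro cSup_least) auto
    moreover have "- C \<le> Inf (G ` cell_class l c)" using False b by (intro cInf_greatest) auto
    moreover have "G m \<le> Sup (G ` cell_class l c)" using m bdd by (intro cSup_upper) auto
    moreover have "Inf (G ` cell_class l c) \<le> G m" using m bdd by (intro cInf_lower) auto
    ultimately show ?thesis using False b[OF m] by (simp add: hi_def lo_def)
  qed (use C0 in \<open>simp add: hi_def lo_def\<close>)
  then have hiC: "\<bar>hi l c\<bar> \<le> C" and loC: "\<bar>lo l c\<bar> \<le> C" for l c by (auto simp: abs_le_iff minus_le_iff)
  have sandwich: "lo l (cell_counts l m) \<le> G m" "G m \<le> hi l (cell_counts l m)" if "m \<in> finite_point_measures" for l m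
  proof -
    have m: "m \<in> cell_class l (cell_counts l m)" using that by (rule cell_class_counts)
    then show "G m \<le> hi l (cell_counts l m)" unfolding hi_def using bdd by (auto intro!: cSup_upper)
    from m show "lo l (cell_counts l m) \<le> G m" unfolding lo_def using bdd by (auto intro!: cInf_lower)
  qed
  have mZ: "(\<lambda>\<omega>. h (cell_counts l (Z n \<omega>))) \<in> borel_measurable M" for h :: "(nat \<times> nat \<Rightarrow> nat) \<Rightarrow> real" and l n
    unfolding cell_counts_def by (rule measurable_function_of_counts) (use cZ in auto)
  have mW: "(\<lambda>\<omega>. h (cell_counts l (W \<omega>))) \<in> borel_measurable Q" for h :: "(nat \<times> nat \<Rightarrow> nat) \<Rightarrow> real" and l
    unfolding cell_counts_def by (rule measurable_function_of_counts) (use cW in auto)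
  have conv: "(\<lambda>n. \<integral>\<omega>. h (cell_counts l (Z n \<omega>)) \<partial>M) \<longlonglongrightarrow> (\<integral>\<omega>. h (cell_counts l (W \<omega>)) \<partial>Q)"
    if h: "\<And>c. \<bar>h c\<bar> \<le> C" for h :: "(nat \<times> nat \<Rightarrow> nat) \<Rightarrow> real" and l
    unfolding cell_counts_def
  proof (rule expectation_converges_from_joint_values[OF M Q finite_cells cZ cW h _ _ lim])
    show "(\<lambda>\<omega>. h (\<lambda>b\<in>cells l. ncount (Z n \<omega>) (cell l b))) \<in> borel_measurable M" for n
      using mZ[of h l n] unfolding cell_counts_def .
    show "(\<lambda>\<omega>. h (\<lambda>b\<in>cells l. ncount (W \<omega>) (cell l b))) \<in> borel_measurable Q"
      using mW[of h l] unfolding cell_counts_def .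
  qed
  have GZ: "(\<lambda>\<omega>. G (Z n \<omega>)) \<in> borel_measurable M" for n
    by (rule measurable_compose[OF Zm borel_measurable_continuous_map[OF G]])
  have GW: "(\<lambda>\<omega>. G (W \<omega>)) \<in> borel_measurable Q"
    by (rule measurable_compose[OF Wm borel_measurable_continuous_map[OF G]])
  have iZ: "integrable M (\<lambda>\<omega>. h (cell_counts l (Z n \<omega>)))" if "\<And>c. \<bar>h c\<bar> \<le> C" for h :: "(nat \<times> nat \<Rightarrow> nat) \<Rightarrow> real" and l n
    using that mZ by (intro M.integrable_const_bound[of _ C]) auto
  have iGZ: "integrable M (\<lambda>\<omega>. G (Z n \<omega>))" for n
    using C Z GZ by (intro M.integrable_const_bound[of _ C]) auto
  have point: "(\<lambda>l. hi l (cell_counts l m)) \<longlonglongrightarrow> G m" "(\<lambda>l. lo l (cell_counts l m)) \<longlonglongrightarrow> G m" if m: "m \<in> finite_point_measures" for m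
  proof -
    \<comment> \<open>Continuity makes the oscillation of \<open>G\<close> on the class of
      \<open>m\<close> vanish, because these classes shrink into every neighbourhood of
      \<open>m\<close>.\<close>
    have ev: "eventually (\<lambda>l. \<bar>hi l (cell_counts l m) - G m\<bar> < e \<and> \<bar>lo l (cell_counts l m) - G m\<bar> < e) sequentially" if e: "e > 0" for e
    proof -
      define U where "U = {x \<in> topspace ?T. G x \<in> {G m - e / 2<..<G m + e / 2}}"
      have "openin ?T U"
        using G unfolding U_def continuous_map_def by (auto dest!: spec[of _ "{G m - e / 2<..<G m + e / 2}"])
      moreover have "m \<in> U" using FP[OF m] e by (simp add: U_def)
      ultimately have "eventually (\<lambda>l. cell_class l (cell_counts l m) \<subseteq> U) sequentially"
        using vague_neighbourhood m by blast
      then show ?thesis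
      proof eventually_elim
        case (elim l)
        let ?A = "G ` cell_class l (cell_counts l m)"
        have ne: "cell_class l (cell_counts l m) \<noteq> {}" using cell_class_counts[OF m] by auto
        have b: "G m - e / 2 \<le> y \<and> y \<le> G m + e / 2" if "y \<in> ?A" for y
          using elim that unfolding U_def by force
        have "Sup ?A \<le> G m + e / 2" using ne b by (intro cSup_least) auto
        moreover have "G m - e / 2 \<le> Inf ?A" using ne b by (intro cInf_greatest) auto
        ultimately show ?case using sandwich[OF m, of l] ne e by (auto simp: hi_def lo_def)
      qed
    qed
    show "(\<lambda>l. hi l (cell_counts l m)) \<longlonglongrightarrow> G m" "(\<lambda>l. lo l (cell_counts l m)) \<longlonglongrightarrow> G m"
      unfolding tendsto_iff dist_real_def by (auto elim!: eventually_mono[OF ev])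
  qed
  \<comment> \<open>Dominated convergence in the level, with the constant \<open>C\<close> as
    majorant.\<close>
  have "(\<lambda>l. \<integral>\<omega>. hi l (cell_counts l (W \<omega>)) \<partial>Q) \<longlonglongrightarrow> (\<integral>\<omega>. G (W \<omega>) \<partial>Q)"
    by (rule integral_dominated_convergence[where w = "\<lambda>_. C"]) (use GW mW point W hiC in auto)
  moreover have "(\<lambda>l. \<integral>\<omega>. lo l (cell_counts l (W \<omega>)) \<partial>Q) \<longlonglongrightarrow> (\<integral>\<omega>. G (W \<omega>) \<partial>Q)"
    by (rule integral_dominated_convergence[where w = "\<lambda>_. C"]) (use GW mW point W loC in auto)
  ultimately have lims: "(\<lambda>l. \<integral>\<omega>. hi l (cell_counts l (W \<omega>)) \<partial>Q) \<longlonglongrightarrow> (\<integral>\<omega>. G (W \<omega>) \<partial>Q)"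
    "(\<lambda>l. \<integral>\<omega>. lo l (cell_counts l (W \<omega>)) \<partial>Q) \<longlonglongrightarrow> (\<integral>\<omega>. G (W \<omega>) \<partial>Q)" by auto
  show "(\<lambda>n. \<integral>\<omega>. G (Z n \<omega>) \<partial>M) \<longlonglongrightarrow> (\<integral>\<omega>. G (W \<omega>) \<partial>Q)"
  proof (rule order_tendstoI)
    fix a assume "a < (\<integral>\<omega>. G (W \<omega>) \<partial>Q)"
    then obtain l where "a < (\<integral>\<omega>. lo l (cell_counts l (W \<omega>)) \<partial>Q)"
      using eventually_happens'[OF sequentially_bot order_tendstoD(1)[OF lims(2)]] by blast
    from order_tendstoD(1)[OF conv[of "lo l", OF loC] this]
    show "eventually (\<lambda>n. a < (\<integral>\<omega>. G (Z n \<omega>) \<partial>M)) sequentially"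
    proof eventually_elim
      case (elim n)
      also have "(\<integral>\<omega>. lo l (cell_counts l (Z n \<omega>)) \<partial>M) \<le> (\<integral>\<omega>. G (Z n \<omega>) \<partial>M)"
        using sandwich(1)[OF Z] by (intro integral_mono iZ iGZ loC) auto
      finally show ?case .
    qed
  next
    fix a assume "(\<integral>\<omega>. G (W \<omega>) \<partial>Q) < a"
    then obtain l where "(\<integral>\<omega>. hi l (cell_counts l (W \<omega>)) \<partial>Q) < a"
      using eventually_happens'[OF sequentially_bot order_tendstoD(2)[OF lims(1)]] by blast
    from order_tendstoD(2)[OF conv[of "hi l", OF hiC] this]
    show "eventually (\<lambda>n. (\<integral>\<omega>. G (Z n \<omega>) \<partial>M) < a) sequentially"
    proof eventually_elim
      case (elim n)
      have "(\<integral>\<omega>. G (Z n \<omega>) \<partial>M) \<le> (\<integral>\<omega>. hi l (cell_counts l (Z n \<omega>)) \<partial>M)"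
        using sandwich(2)[OF Z] by (intro integral_mono iZ iGZ hiC) auto
      then show ?case using elim by simp
    qed
  qed
qed

section \<open>Construction of the Poisson process\<close>

definition visits :: "nat \<Rightarrow> 'a stream \<Rightarrow> 'a set \<Rightarrow> nat" where
  "visits k s A = card {i \<in> {..<k}. s !! i \<in> A}"

lemma visits_Suc: "visits (Suc k) (t ## s) A = (if t \<in> A then 1 else 0) + visits k s A"
proof -
  have "{i \<in> {..<Suc k}. (t ## s) !! i \<in> A} = (if t \<in> A then {0} else {}) \<union> Suc ` {i \<in> {..<k}. s !! i \<in> A}"
    by (auto simp: Stream_snth image_iff split: nat.splits) (metis Suc_less_eq gr0_conv_Suc lessThan_iff not0_implies_Suc)+
  then have "visits (Suc k) (t ## s) A = card ((if t \<in> A then {0} else {}) \<union> Suc ` {i \<in> {..<k}. s !! i \<in> A})"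
    by (simp add: visits_def)
  also have "\<dots> = (if t \<in> A then 1 else 0) + card (Suc ` {i \<in> {..<k}. s !! i \<in> A})"
    by (subst card_Un_disjoint) auto
  also have "card (Suc ` {i \<in> {..<k}. s !! i \<in> A}) = visits k s A"
    by (simp add: visits_def card_image)
  finally show ?thesis .
qed

text \<open>The counts are determined by the finite set of pairs (sample number, set) that are hit,
  so \<open>pred_finite_pattern\<close> applies.\<close>

lemma pred_visits:
  assumes J: "finite J" and B: "\<And>b. b \<in> J \<Longrightarrow> B b \<in> sets M"
  shows "Measurable.pred (stream_space M) (\<lambda>s. \<Phi> (\<lambda>b\<in>J. visits k s (B b)))"
proof -
  have "(\<lambda>b\<in>J. visits k s (B b)) = (\<lambda>b\<in>J. card {i. (i, b) \<in> {x \<in> {..<k} \<times> J. s !! fst x \<in> B (snd x)}})" for s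
    by (auto simp: visits_def fun_eq_iff intro!: arg_cong[where f = card])
  moreover have "Measurable.pred (stream_space M) (\<lambda>s. s !! fst x \<in> B (snd x))" if "x \<in> {..<k} \<times> J" for x
    using that B by (intro pred_sets2[where N = M]) auto
  then have "Measurable.pred (stream_space M) (\<lambda>s. (\<lambda>A. \<Phi> (\<lambda>b\<in>J. card {i. (i, b) \<in> A})) {x \<in> {..<k} \<times> J. s !! fst x \<in> B (snd x)})"
    using J by (intro pred_finite_pattern) auto
  ultimately show ?thesis by simp
qed

text \<open>The multinomial formula, with the mass \<open>p0\<close> outside all sets as an extra
  category. Induction conditions on the first sample point, which either falls into one set and
  lowers its target count or falls outside.\<close>

lemma (in prob_space) prob_visits:
  fixes B :: "'b \<Rightarrow> 'a set"
  assumes J: "finite J" and B: "\<And>b. b \<in> J \<Longrightarrow> B b \<in> events" "disjoint_family_on B J"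
  defines "p0 \<equiv> 1 - (\<Sum>b\<in>J. prob (B b))" and "w \<equiv> \<lambda>m. \<Prod>b\<in>J. prob (B b) ^ m b / fact (m b)"
  shows "\<P>(s in stream_space M. \<forall>b\<in>J. visits k s (B b) = m b) =
    (if (\<Sum>b\<in>J. m b) \<le> k then fact k / fact (k - (\<Sum>b\<in>J. m b)) * p0 ^ (k - (\<Sum>b\<in>J. m b)) * w m else 0)"
proof (induction k arbitrary: m)
  case 0
  interpret S: prob_space "stream_space M" by (rule prob_space_stream_space)
  show ?case
  proof (cases "\<forall>b\<in>J. m b = 0")
    case True
    then show ?thesis using J by (simp add: visits_def w_def S.prob_space)
  next
    case False
    then have "(\<Sum>b\<in>J. m b) \<noteq> 0" using J by simp
    moreover have "{s \<in> space (stream_space M). \<forall>b\<in>J. visits 0 s (B b) = m b} = {}"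
      using False by (auto simp: visits_def)
    ultimately show ?thesis by (simp only: measure_empty le_zero_eq if_False simp_thms)
  qed
next
  case (Suc k)
  interpret S: prob_space "stream_space M" by (rule prob_space_stream_space)
  define c where "c m = \<P>(s in stream_space M. \<forall>b\<in>J. visits k s (B b) = m b)" for m
  define q where "q m n = fact n / fact (n - (\<Sum>b\<in>J. m b)) * p0 ^ (n - (\<Sum>b\<in>J. m b)) * w m" for m n
  \<comment> \<open>The case distinction guards against truncated subtraction: a set with target 0
    must not be hit.\<close>
  define g where "g a = (if 0 < m a then c (m(a := m a - 1)) else 0)" for a
  have c: "c m = (if (\<Sum>b\<in>J. m b) \<le> k then q m k else 0)" for m
    unfolding c_def q_def by (rule Suc)
  have c0: "0 \<le> c m" for m by (simp add: c_def)
  have g0: "0 \<le> g a" for a by (simp add: g_def c0)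
  have sumB: "(\<Sum>b\<in>J. prob (B b)) = prob (\<Union>b\<in>J. B b)"
    using J B by (subst finite_measure_finite_Union) auto
  then have p0: "0 \<le> p0" by (simp add: p0_def)
  have meas: "{s \<in> space (stream_space M). \<forall>b\<in>J. visits n s (B b) = m b} \<in> sets (stream_space M)" for n m
  proof -
    have "Measurable.pred (stream_space M) (\<lambda>s. (\<lambda>f. \<forall>b\<in>J. f b = m b) (\<lambda>b\<in>J. visits n s (B b)))"
      using J B(1) by (rule pred_visits)
    then show ?thesis by (simp add: pred_def)
  qed
  have step: "\<P>(s in stream_space M. \<forall>b\<in>J. visits (Suc k) (t ## s) (B b) = m b) =
      (\<Sum>a\<in>J. g a * indicator (B a) t) + c m * indicator (space M - (\<Union>b\<in>J. B b)) t" if t: "t \<in> space M" for t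
  proof (cases "t \<in> (\<Union>b\<in>J. B b)")
    case True
    then obtain a where a: "a \<in> J" "t \<in> B a" by auto
    have other: "t \<in> B b \<longleftrightarrow> b = a" if "b \<in> J" for b
      using B(2) a that unfolding disjoint_family_on_def by blast
    have "(\<Sum>a'\<in>J. g a' * indicator (B a') t) = (\<Sum>a'\<in>J. if a' = a then g a' else 0)"
      using other by (intro sum.cong) (auto simp: indicator_def)
    then have rhs: "(\<Sum>a\<in>J. g a * indicator (B a) t) + c m * indicator (space M - (\<Union>b\<in>J. B b)) t = g a"
      using True J a by simp
    have "(\<forall>b\<in>J. visits (Suc k) (t ## s) (B b) = m b) \<longleftrightarrow> 0 < m a \<and> (\<forall>b\<in>J. visits k s (B b) = (m(a := m a - 1)) b)" for s
      using a other by (auto simp: visits_Suc)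
    note iff = this
    show ?thesis
    proof (cases "0 < m a")
      case True
      then show ?thesis unfolding rhs unfolding g_def c_def iff by simp
    next
      case False
      then have "{s \<in> space (stream_space M). \<forall>b\<in>J. visits (Suc k) (t ## s) (B b) = m b} = {}" unfolding iff by simp
      then show ?thesis unfolding rhs unfolding g_def using False by (simp only: measure_empty if_False)
    qed
  next
    case False
    then have "(\<Sum>a\<in>J. g a * indicator (B a) t) = 0" by (intro sum.neutral) (auto simp: indicator_def)
    moreover have "visits (Suc k) (t ## s) (B b) = visits k s (B b)" if "b \<in> J" for s b
      using False that by (auto simp: visits_Suc)
    ultimately show ?thesis using False t by (simp add: c_def)
  qed
  have U: "(\<Union>b\<in>J. B b) \<in> events" using J B by auto
  have pU: "prob (space M - (\<Union>b\<in>J. B b)) = p0"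
    using U by (subst prob_compl) (auto simp: p0_def sumB)
  have iB: "integrable M (\<lambda>t. g a * indicator (B a) t)" if "a \<in> J" for a
    using B(1)[OF that] by (intro integrable_mult_right) (simp add: emeasure_eq_measure)
  have iU: "integrable M (\<lambda>t. c m * indicator (space M - (\<Union>b\<in>J. B b)) t)"
    using U by (intro integrable_mult_right) (auto simp: emeasure_eq_measure)
  have "ennreal (\<P>(s in stream_space M. \<forall>b\<in>J. visits (Suc k) s (B b) = m b)) =
      (\<integral>\<^sup>+t. ennreal ((\<Sum>a\<in>J. g a * indicator (B a) t) + c m * indicator (space M - (\<Union>b\<in>J. B b)) t) \<partial>M)"
    unfolding prob_stream_space[OF meas] by (intro nn_integral_cong) (simp add: step)
  also have "\<dots> = ennreal (\<integral>t. (\<Sum>a\<in>J. g a * indicator (B a) t) + c m * indicator (space M - (\<Union>b\<in>J. B b)) t \<partial>M)"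
    using iB iU g0 c0 by (intro nn_integral_eq_integral Bochner_Integration.integrable_add Bochner_Integration.integrable_sum)
      (auto intro!: AE_I2 add_nonneg_nonneg sum_nonneg)
  also have "(\<integral>t. (\<Sum>a\<in>J. g a * indicator (B a) t) + c m * indicator (space M - (\<Union>b\<in>J. B b)) t \<partial>M) =
      (\<Sum>a\<in>J. g a * prob (B a)) + c m * p0"
    using iB iU U B(1) pU
    by (subst Bochner_Integration.integral_add; (intro Bochner_Integration.integrable_sum)?)
       (simp_all add: Bochner_Integration.integral_sum)
  finally have rec: "\<P>(s in stream_space M. \<forall>b\<in>J. visits (Suc k) s (B b) = m b) = (\<Sum>a\<in>J. g a * prob (B a)) + c m * p0"
    using g0 c0 p0 by (subst (asm) ennreal_inj) (auto intro!: add_nonneg_nonneg sum_nonneg mult_nonneg_nonneg)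
  let ?s = "\<Sum>b\<in>J. m b"
  have ga: "g a * prob (B a) = (if ?s \<le> Suc k then real (m a) * (fact k / fact (Suc k - ?s) * p0 ^ (Suc k - ?s) * w m) else 0)"
    if a: "a \<in> J" for a
  proof (cases "m a")
    case (Suc j)
    define m' where "m' = m(a := m a - 1)"
    have s: "?s = Suc (\<Sum>b\<in>J. m' b)"
      using Suc by (simp add: sum.remove[OF J a] m'_def)
    have "w m' * prob (B a) = real (m a) * w m"
    proof -
      have "w m = (\<Prod>b\<in>J - {a}. prob (B b) ^ m' b / fact (m' b)) * (prob (B a) ^ m a / fact (m a))"
        unfolding w_def by (subst prod.remove[OF J a]) (auto simp: m'_def intro!: prod.cong)
      moreover have "w m' = (\<Prod>b\<in>J - {a}. prob (B b) ^ m' b / fact (m' b)) * (prob (B a) ^ m' a / fact (m' a))"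
        unfolding w_def by (subst prod.remove[OF J a]) (auto intro!: prod.cong)
      moreover have "prob (B a) ^ m' a / fact (m' a) * prob (B a) = real (m a) * (prob (B a) ^ m a / fact (m a))"
        using Suc by (simp add: m'_def field_simps del: of_nat_Suc)
      moreover have "x * u' * y = r * (x * u)" if "u' * y = r * u" for x u u' y r :: real
        using that by (metis mult.assoc mult.left_commute)
      ultimately show ?thesis by (simp only:)
    qed
    moreover have "g a = c m'" using Suc by (simp add: g_def m'_def)
    ultimately show ?thesis
      unfolding c q_def s by (simp add: ac_simps)
  qed (simp add: g_def)
  show ?case
  proof (cases "?s \<le> Suc k")
    case True
    \<comment> \<open>The common factor in the recursion of the multinomial coefficients: the sets
      contribute \<open>?s\<close> copies, the outside \<open>Suc k - ?s\<close>, together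
      \<open>Suc k\<close>.\<close>
    define A where "A = fact k / fact (Suc k - ?s) * p0 ^ (Suc k - ?s) * w m"
    have "(\<Sum>a\<in>J. g a * prob (B a)) = (\<Sum>a\<in>J. real (m a) * A)"
      using True ga unfolding A_def by (intro sum.cong refl) presburger
    then have "(\<Sum>a\<in>J. g a * prob (B a)) = real ?s * A"
      by (simp only: sum_distrib_right[symmetric] of_nat_sum)
    moreover have "c m * p0 = real (Suc k - ?s) * A"
    proof (cases "?s \<le> k")
      case t: True
      then obtain r where r: "k = ?s + r" using le_Suc_ex by blast
      then have "Suc k - ?s = Suc r" "k - ?s = r" by simp_all
      then show ?thesis using t unfolding c q_def A_def by (simp add: field_simps del: of_nat_Suc)
    next
      \<comment> \<open>Here the targets use up all \<open>Suc k\<close> samples, so the outside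
        contributes zero on both sides.\<close>
      case False
      then have "Suc k - ?s = 0" using True by simp
      then show ?thesis using False unfolding c by simp
    qed
    ultimately have "(\<Sum>a\<in>J. g a * prob (B a)) + c m * p0 = real (Suc k) * A"
      using True by (simp add: of_nat_diff distrib_right[symmetric])
    then show ?thesis unfolding rec using True by (simp add: A_def)
  next
    case False
    then show ?thesis unfolding rec using c[of m] by (simp add: ga)
  qed
qed

text \<open>The factor k! cancels, and shifting the index by \<open>s\<close> leaves the exponential
  series of L p0.\<close>

lemma poisson_mixture_sums:
  fixes L p0 w :: real and s :: nat
  shows "(\<lambda>k. L ^ k / fact k * exp (- L) * (if s \<le> k then fact k / fact (k - s) * p0 ^ (k - s) * w else 0)) sums
    (L ^ s * w * exp (- (L * (1 - p0))))"
proof -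
  let ?f = "\<lambda>k. L ^ k / fact k * exp (- L) * (if s \<le> k then fact k / fact (k - s) * p0 ^ (k - s) * w else 0)"
  have "(\<lambda>j. (L ^ s * w * exp (- L)) * ((L * p0) ^ j /\<^sub>R fact j)) sums ((L ^ s * w * exp (- L)) * exp (L * p0))"
    by (intro sums_mult exp_converges)
  moreover have "(L ^ s * w * exp (- L)) * ((L * p0) ^ j /\<^sub>R fact j) = ?f (j + s)" for j
    by (simp add: power_add power_mult_distrib field_simps)
  moreover have "(L ^ s * w * exp (- L)) * exp (L * p0) = L ^ s * w * exp (- (L * (1 - p0)))"
    by (simp add: exp_add[symmetric] algebra_simps)
  ultimately have "(\<lambda>j. ?f (j + s)) sums (L ^ s * w * exp (- (L * (1 - p0))))" by (simp only:)
  then have "?f sums (L ^ s * w * exp (- (L * (1 - p0))) + (\<Sum>i<s. ?f i))" by (rule sums_iff_shift[THEN iffD1])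
  moreover have "(\<Sum>i<s. ?f i) = 0" by (intro sum.neutral) auto
  ultimately show ?thesis by (simp only: add_0_right)
qed

text \<open>Poissonisation: a Poisson number of samples turns multinomial counts into independent
  Poisson counts, since L (1 - p0) is the sum of the individual means.\<close>

lemma (in prob_space) prob_poisson_visits:
  fixes B :: "'b \<Rightarrow> 'a set"
  assumes L: "L > 0" and J: "finite J" and B: "\<And>b. b \<in> J \<Longrightarrow> B b \<in> events" "disjoint_family_on B J"
  shows "\<P>(z in measure_pmf (poisson_pmf L) \<Otimes>\<^sub>M stream_space M. \<forall>b\<in>J. visits (fst z) (snd z) (B b) = m b) =
    (\<Prod>b\<in>J. (L * prob (B b)) ^ m b / fact (m b) * exp (- (L * prob (B b))))"
proof -
  interpret S: prob_space "stream_space M" by (rule prob_space_stream_space)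
  let ?E = "{z \<in> space (measure_pmf (poisson_pmf L) \<Otimes>\<^sub>M stream_space M). \<forall>b\<in>J. visits (fst z) (snd z) (B b) = m b}"
  let ?s = "\<Sum>b\<in>J. m b"
  define p0 where "p0 = 1 - (\<Sum>b\<in>J. prob (B b))"
  define w where "w = (\<Prod>b\<in>J. prob (B b) ^ m b / fact (m b))"
  have E: "?E \<in> sets (measure_pmf (poisson_pmf L) \<Otimes>\<^sub>M stream_space M)"
  proof -
    have "Measurable.pred (stream_space M) (\<lambda>s. (\<lambda>f. \<forall>b\<in>J. f b = m b) (\<lambda>b\<in>J. visits k s (B b)))" for k
      using J B(1) by (rule pred_visits)
    then have [measurable]: "Measurable.pred (stream_space M) (\<lambda>s. \<forall>b\<in>J. visits k s (B b) = m b)" for k by simp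
    have "Measurable.pred (count_space UNIV \<Otimes>\<^sub>M stream_space M) (\<lambda>z. \<forall>b\<in>J. visits (fst z) (snd z) (B b) = m b)"
      by (rule measurable_pair_measure_countable1) auto
    moreover have "sets (measure_pmf (poisson_pmf L) \<Otimes>\<^sub>M stream_space M) = sets (count_space UNIV \<Otimes>\<^sub>M stream_space M)"
      by (intro sets_pair_measure_cong) simp_all
    ultimately show ?thesis by (simp add: pred_def space_pair_measure)
  qed
  define c where "c k = \<P>(s in stream_space M. \<forall>b\<in>J. visits k s (B b) = m b)" for k
  have c: "c k = (if ?s \<le> k then fact k / fact (k - ?s) * p0 ^ (k - ?s) * w else 0)" for k
    unfolding c_def p0_def w_def by (rule prob_visits[OF J B])
  have "emeasure (measure_pmf (poisson_pmf L) \<Otimes>\<^sub>M stream_space M) ?E =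
      (\<integral>\<^sup>+k. emeasure (stream_space M) (Pair k -` ?E) \<partial>measure_pmf (poisson_pmf L))"
    by (rule S.emeasure_pair_measure_alt[OF E])
  also have "\<dots> = (\<integral>\<^sup>+k. ennreal (c k) \<partial>measure_pmf (poisson_pmf L))"
    by (intro nn_integral_cong) (auto simp: c_def S.emeasure_eq_measure space_pair_measure intro!: arg_cong[where f = S.prob])
  also have "\<dots> = (\<integral>\<^sup>+k. ennreal (pmf (poisson_pmf L) k) * ennreal (c k) \<partial>count_space UNIV)"
    by (rule nn_integral_measure_pmf)
  also have "\<dots> = (\<Sum>k. ennreal (L ^ k / fact k * exp (- L) * c k))"
  proof -
    have "ennreal (pmf (poisson_pmf L) k) * ennreal (c k) = ennreal (L ^ k / fact k * exp (- L) * c k)" for k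
    proof -
      have "0 \<le> c k" "0 \<le> L ^ k / fact k * exp (- L)" using L by (simp_all add: c_def)
      then show ?thesis by (simp only: pmf_poisson[OF L] ennreal_mult)
    qed
    then show ?thesis by (simp only: nn_integral_count_space_nat)
  qed
  also have "\<dots> = ennreal (L ^ ?s * w * exp (- (L * (1 - p0))))"
  proof (rule suminf_ennreal_eq)
    show "0 \<le> L ^ k / fact k * exp (- L) * c k" for k using L by (simp add: c_def)
    show "(\<lambda>k. L ^ k / fact k * exp (- L) * c k) sums (L ^ ?s * w * exp (- (L * (1 - p0))))"
      unfolding c by (rule poisson_mixture_sums)
  qed
  finally have "\<P>(z in measure_pmf (poisson_pmf L) \<Otimes>\<^sub>M stream_space M. \<forall>b\<in>J. visits (fst z) (snd z) (B b) = m b) =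
      L ^ ?s * w * exp (- (L * (1 - p0)))"
    using L by (simp add: measure_def w_def prod_nonneg)
  also have "\<dots> = (\<Prod>b\<in>J. (L * prob (B b)) ^ m b / fact (m b) * exp (- (L * prob (B b))))"
  proof -
    have "(\<Prod>b\<in>J. exp (- (L * prob (B b)))) = exp (- (L * (1 - p0)))"
      unfolding p0_def exp_sum[OF J, symmetric] by (simp add: sum_negf sum_distrib_left)
    moreover have "L ^ ?s = (\<Prod>b\<in>J. L ^ m b)" by (rule power_sum)
    moreover have "(\<Prod>b\<in>J. (L * prob (B b)) ^ m b / fact (m b) * exp (- (L * prob (B b)))) =
        (\<Prod>b\<in>J. L ^ m b) * (\<Prod>b\<in>J. prob (B b) ^ m b / fact (m b)) * (\<Prod>b\<in>J. exp (- (L * prob (B b))))"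
      by (simp only: prod.distrib[symmetric]) (simp add: power_mult_distrib)
    ultimately show ?thesis by (simp only: w_def)
  qed
  finally show ?thesis .
qed

section \<open>From random samples to a Poisson process\<close>

lemma finite_point_measuresI:
  assumes s: "sets m = sets (restrict_space borel biv_space)"
    and n: "\<And>B. B \<in> sets (restrict_space borel biv_space) \<Longrightarrow> emeasure m B = of_nat (n B)"
  shows "m \<in> finite_point_measures"
    and "B \<in> sets (restrict_space borel biv_space) \<Longrightarrow> ncount m B = n B"
proof -
  have sp: "space m = biv_space" using sets_eq_imp_space_eq[OF s] by (simp add: space_restrict_space)
  have top: "biv_space \<in> sets (restrict_space borel biv_space)" using sets.top[of m] s sp by simp
  have fin: "emeasure m K < \<infinity>" for K
    using emeasure_space[of m K] n[OF top] unfolding sp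
    by (metis ennreal_of_nat_neq_top infinity_ennreal_def le_less_trans less_top)
  then show "m \<in> finite_point_measures"
    using n s by (auto simp: finite_point_measures_def point_measures_def)
  assume "B \<in> sets (restrict_space borel biv_space)"
  then show "ncount m B = n B" using n by (simp add: ncount_def measure_def)
qed

definition sample_measure :: "nat \<times> (real \<times> nat) stream \<Rightarrow> (real \<times> nat) measure" where
  "sample_measure z = biv_measure (\<lambda>B. \<Sum>i\<in>{..<fst z}. indicator B (snd z !! i))"

lemma emeasure_sample_measure:
  assumes "B \<in> sets (restrict_space borel biv_space)"
  shows "emeasure (sample_measure z) B = of_nat (visits (fst z) (snd z) B)"
proof -
  have "emeasure (sample_measure z) B = (\<Sum>i\<in>{..<fst z}. indicator B (snd z !! i))"
    unfolding sample_measure_def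
  proof (rule emeasure_biv_measure[where J = "{..<fst z}" and c = "\<lambda>_. 1" and L = "\<lambda>i. return borel (snd z !! i)", OF _ _ assms])
    fix B assume "B \<in> sets (restrict_space borel biv_space)"
    then have "B \<in> sets borel" by (rule sets_biv_space_borel)
    then show "(\<Sum>i\<in>{..<fst z}. indicator B (snd z !! i)) = (\<Sum>j\<in>{..<fst z}. 1 * emeasure (return borel (snd z !! j)) B)"
      by simp
  qed simp
  also have "\<dots> = of_nat (visits (fst z) (snd z) B)"
    by (simp add: visits_def indicator_def sum.If_cases of_bool_def Int_def)
  finally show ?thesis .
qed

lemma sample_measure: "sample_measure z \<in> finite_point_measures"
  "B \<in> sets (restrict_space borel biv_space) \<Longrightarrow> ncount (sample_measure z) B = visits (fst z) (snd z) B"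
proof -
  have s: "sets (sample_measure z) = sets (restrict_space borel biv_space)" by (simp add: sample_measure_def)
  show "sample_measure z \<in> finite_point_measures"
    "B \<in> sets (restrict_space borel biv_space) \<Longrightarrow> ncount (sample_measure z) B = visits (fst z) (snd z) B"
    using finite_point_measuresI[OF s emeasure_sample_measure] by auto
qed

text \<open>The required type leaves only measures on the set of measures, so the law of the sampled
  configuration is pushed forward along \<open>sample_measure\<close>, with all sets having a measurable
  preimage as \<open>\<sigma>\<close>-algebra.\<close>

lemma exists_poisson_law:
  assumes \<mu>: "sets \<mu> = sets (restrict_space borel biv_space)" "finite_measure \<mu>" "0 < measure \<mu> biv_space"
  obtains P :: "(real \<times> nat) measure measure"
  where "prob_space P" "space P = finite_point_measures"
    "\<And>B. B \<in> sets \<mu> \<Longrightarrow> (\<lambda>w. ncount w B) \<in> P \<rightarrow>\<^sub>M count_space UNIV"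
    "\<And>\<B> m. finite \<B> \<Longrightarrow> \<B> \<subseteq> sets \<mu> \<Longrightarrow> disjoint \<B> \<Longrightarrow>
      \<P>(w in P. \<forall>B\<in>\<B>. ncount w B = m B) = (\<Prod>B\<in>\<B>. measure \<mu> B ^ m B / fact (m B) * exp (- measure \<mu> B))"
proof -
  interpret \<mu>: finite_measure \<mu> by fact
  have sp: "space \<mu> = biv_space" using sets_eq_imp_space_eq[OF \<mu>(1)] by (simp add: space_restrict_space)
  define L where "L = measure \<mu> biv_space"
  have L: "L > 0" using \<mu>(3) by (simp add: L_def)
  \<comment> \<open>The law of a single sample point is the normalised intensity; the number of
    points is Poisson with mean \<open>L\<close>, independent of them.\<close>
  define \<nu> where "\<nu> = scale_measure (ennreal (1 / L)) \<mu>"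
  have s\<nu>: "sets \<nu> = sets \<mu>" "space \<nu> = biv_space" by (simp_all add: \<nu>_def sp space_scale_measure)
  have m\<nu>: "emeasure \<nu> B = ennreal (measure \<mu> B / L)" if "B \<in> sets \<mu>" for B
  proof -
    have "emeasure \<nu> B = ennreal (1 / L) * ennreal (measure \<mu> B)"
      by (simp add: \<nu>_def \<mu>.emeasure_eq_measure)
    then show ?thesis using L by (simp add: ennreal_mult[symmetric])
  qed
  have "biv_space \<in> sets \<mu>" using sets.top[of \<mu>] sp by simp
  then have "prob_space \<nu>" using m\<nu>[of biv_space] L by (intro prob_spaceI) (simp add: s\<nu> L_def)
  then interpret \<nu>: prob_space \<nu> .
  have L\<nu>: "L * \<nu>.prob B = measure \<mu> B" if "B \<in> sets \<mu>" for B
    using m\<nu>[OF that] L by (simp add: \<nu>.emeasure_eq_measure)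
  interpret S: prob_space "stream_space \<nu>" by (rule \<nu>.prob_space_stream_space)
  define Q where "Q = measure_pmf (poisson_pmf L) \<Otimes>\<^sub>M stream_space \<nu>"
  interpret K: prob_space "measure_pmf (poisson_pmf L)" by (rule prob_space_measure_pmf)
  interpret Q: pair_prob_space "measure_pmf (poisson_pmf L)" "stream_space \<nu>" ..
  have Q: "prob_space Q" unfolding Q_def by (rule Q.prob_space_axioms)
  define \<A> where "\<A> = {A. A \<subseteq> finite_point_measures \<and> sample_measure -` A \<inter> space Q \<in> sets Q}"
  define \<Sigma> where "\<Sigma> = measure_of finite_point_measures \<A> (\<lambda>_. 0)"
  have \<A>: "\<A> \<subseteq> Pow finite_point_measures" by (auto simp: \<A>_def)
  have sp\<Sigma>: "space \<Sigma> = finite_point_measures" unfolding \<Sigma>_def by (rule space_measure_of[OF \<A>])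
  have sample [measurable]: "sample_measure \<in> Q \<rightarrow>\<^sub>M \<Sigma>"
    unfolding \<Sigma>_def using sample_measure(1) by (intro measurable_measure_of \<A>) (auto simp: \<A>_def)
  have \<A>\<Sigma>: "A \<in> sets \<Sigma>" if "A \<in> \<A>" for A unfolding \<Sigma>_def sets_measure_of[OF \<A>] using that by auto
  define P where "P = distr Q \<Sigma> sample_measure"
  \<comment> \<open>Allowing any property of finitely many counts yields measurability and
    probabilities together.\<close>
  have event: "{w \<in> finite_point_measures. \<Phi> (\<lambda>B\<in>\<B>. ncount w B)} \<in> sets \<Sigma> \<and>
      \<P>(w in P. \<Phi> (\<lambda>B\<in>\<B>. ncount w B)) = \<P>(z in Q. \<Phi> (\<lambda>B\<in>\<B>. visits (fst z) (snd z) B))"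
    if \<B>: "finite \<B>" "\<B> \<subseteq> sets \<mu>" for \<B> \<Phi>
  proof -
    let ?A = "{w \<in> finite_point_measures. \<Phi> (\<lambda>B\<in>\<B>. ncount w B)}"
    have vis: "(\<lambda>B\<in>\<B>. ncount (sample_measure z) B) = (\<lambda>B\<in>\<B>. visits (fst z) (snd z) B)" for z
      using \<B> \<mu>(1) by (intro restrict_ext sample_measure(2)) auto
    have pre: "sample_measure -` ?A \<inter> space Q = {z \<in> space Q. \<Phi> (\<lambda>B\<in>\<B>. visits (fst z) (snd z) B)}"
      using sample_measure(1) vis by auto
    have "Measurable.pred (stream_space \<nu>) (\<lambda>s. \<Phi> (\<lambda>B\<in>\<B>. visits k s B))" for k
      using \<B> s\<nu> by (intro pred_visits[where B = "\<lambda>B. B"]) auto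
    then have "Measurable.pred (count_space UNIV \<Otimes>\<^sub>M stream_space \<nu>) (\<lambda>z. \<Phi> (\<lambda>B\<in>\<B>. visits (fst z) (snd z) B))"
      by (intro measurable_pair_measure_countable1) auto
    moreover have "sets Q = sets (count_space UNIV \<Otimes>\<^sub>M stream_space \<nu>)"
      unfolding Q_def by (intro sets_pair_measure_cong) simp_all
    ultimately have "{z \<in> space Q. \<Phi> (\<lambda>B\<in>\<B>. visits (fst z) (snd z) B)} \<in> sets Q"
      using sets_eq_imp_space_eq[of Q "count_space UNIV \<Otimes>\<^sub>M stream_space \<nu>"] by (simp add: pred_def)
    then have "?A \<in> \<A>" using pre by (simp add: \<A>_def)
    then have A: "?A \<in> sets \<Sigma>" by (rule \<A>\<Sigma>)
    have "\<P>(w in P. \<Phi> (\<lambda>B\<in>\<B>. ncount w B)) = measure P ?A" by (simp add: P_def sp\<Sigma>)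
    also have "\<dots> = measure Q (sample_measure -` ?A \<inter> space Q)"
      unfolding P_def by (rule measure_distr[OF sample A])
    finally show ?thesis using A pre by simp
  qed
  show ?thesis
  proof (rule that[of P])
    show "prob_space P" unfolding P_def using Q by (rule prob_space.prob_space_distr) simp
    show spP: "space P = finite_point_measures" by (simp add: P_def sp\<Sigma>)
    show "(\<lambda>w. ncount w B) \<in> P \<rightarrow>\<^sub>M count_space UNIV" if B: "B \<in> sets \<mu>" for B
    proof (subst measurable_count_space_eq2_countable, intro conjI ballI)
      fix k
      have "{w \<in> finite_point_measures. (\<lambda>B\<in>{B}. ncount w B) B = k} \<in> sets \<Sigma>"
        using event[of "{B}" "\<lambda>f. f B = k"] B by auto
      moreover have "(\<lambda>w. ncount w B) -` {k} \<inter> space P = {w \<in> finite_point_measures. (\<lambda>B\<in>{B}. ncount w B) B = k}"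
        using spP by auto
      ultimately show "(\<lambda>w. ncount w B) -` {k} \<inter> space P \<in> sets P" by (simp add: P_def)
    qed auto
    fix \<B> and m :: "(real \<times> nat) set \<Rightarrow> nat" assume \<B>: "finite \<B>" "\<B> \<subseteq> sets \<mu>" "disjoint \<B>"
    have "\<P>(w in P. \<forall>B\<in>\<B>. ncount w B = m B) = \<P>(z in Q. \<forall>B\<in>\<B>. visits (fst z) (snd z) B = m B)"
      using event[OF \<B>(1,2), of "\<lambda>f. \<forall>B\<in>\<B>. f B = m B"] by (simp add: restrict_apply cong: ball_cong)
    also have "\<dots> = (\<Prod>B\<in>\<B>. (L * \<nu>.prob B) ^ m B / fact (m B) * exp (- (L * \<nu>.prob B)))"
      unfolding Q_def using \<B> s\<nu>
      by (intro \<nu>.prob_poisson_visits[where B = "\<lambda>B. B", OF L]) (auto simp: disjoint_family_on_def disjoint_def)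
    also have "\<dots> = (\<Prod>B\<in>\<B>. measure \<mu> B ^ m B / fact (m B) * exp (- measure \<mu> B))"
      using \<B> by (intro prod.cong refl) (simp add: L\<nu> subset_iff)
    finally show "\<P>(w in P. \<forall>B\<in>\<B>. ncount w B = m B) = (\<Prod>B\<in>\<B>. measure \<mu> B ^ m B / fact (m B) * exp (- measure \<mu> B))" .
  qed
qed

text \<open>Joint point probabilities on disjoint families suffice: singletons generate the
  \<sigma>-algebra of the counts, so the product formula on them already gives independence.\<close>

lemma poisson_processI:
  assumes P: "prob_space P" and N: "\<And>w. w \<in> space P \<Longrightarrow> N w \<in> finite_point_measures"
    and \<mu>: "sets \<mu> = sets (restrict_space borel biv_space)"
    and meas: "\<And>B. B \<in> sets \<mu> \<Longrightarrow> (\<lambda>w. ncount (N w) B) \<in> P \<rightarrow>\<^sub>M count_space UNIV"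
    and law: "\<And>\<B> m. finite \<B> \<Longrightarrow> \<B> \<subseteq> sets \<mu> \<Longrightarrow> disjoint \<B> \<Longrightarrow>
      \<P>(w in P. \<forall>B\<in>\<B>. ncount (N w) B = m B) = (\<Prod>B\<in>\<B>. measure \<mu> B ^ m B / fact (m B) * exp (- measure \<mu> B))"
  shows "poisson_process biv_space P N \<mu>"
proof -
  interpret P: prob_space P by fact
  have em: "emeasure (N w) B = of_nat (ncount (N w) B)" if "w \<in> space P" "B \<in> sets \<mu>" for w B
    using finite_point_measuresD(4)[OF N] that \<mu> by simp
  have of_nat_meas: "(of_nat :: nat \<Rightarrow> ennreal) \<in> count_space UNIV \<rightarrow>\<^sub>M borel" by simp
  have single: "\<P>(w in P. ncount (N w) B = k) = measure \<mu> B ^ k / fact k * exp (- measure \<mu> B)" if "B \<in> sets \<mu>" for B k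
    using law[of "{B}" "\<lambda>_. k"] that by (simp add: disjoint_def)
  show ?thesis
    unfolding poisson_process_def
  proof (intro conjI ballI allI impI)
    show "prob_space P" "sets \<mu> = sets (restrict_space borel biv_space)" by fact+
    show "N w \<in> point_measures biv_space" if "w \<in> space P" for w
      using N[OF that] by (simp add: finite_point_measures_def)
    fix B assume B: "B \<in> sets \<mu>"
    have "(\<lambda>w. of_nat (ncount (N w) B) :: ennreal) \<in> borel_measurable P"
      using measurable_compose[OF meas[OF B] of_nat_meas] .
    then show "(\<lambda>w. emeasure (N w) B) \<in> borel_measurable P"
      using em[OF _ B] by (subst measurable_cong) auto
  next
    fix B k assume B: "B \<in> sets \<mu>" "emeasure \<mu> B < \<infinity>"
    have "\<P>(w in P. emeasure (N w) B = of_nat k) = \<P>(w in P. ncount (N w) B = k)"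
      using em[OF _ B(1)] by (intro arg_cong[where f = P.prob]) auto
    then show "\<P>(w in P. emeasure (N w) B = of_nat k) = measure \<mu> B ^ k / fact k * exp (- measure \<mu> B)"
      using single[OF B(1)] by simp
  next
    fix \<B> assume "finite \<B> \<and> \<B> \<subseteq> sets \<mu> \<and> disjoint \<B>"
    then have \<B>: "finite \<B>" "\<B> \<subseteq> sets \<mu>" "disjoint \<B>" by auto
    show "P.indep_vars (\<lambda>_. borel) (\<lambda>B w. emeasure (N w) B) \<B>"
    proof (cases "\<B> = {}")
      case True
      then show ?thesis by (simp add: P.indep_vars_def P.indep_sets_def)
    next
      case False
      \<comment> \<open>The empty set closes the singletons under intersection; \<open>UNIV\<close>
        is the whole space and stands for no condition.\<close>
      let ?G = "insert UNIV (insert {} (range (\<lambda>k::nat. {k})))"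
      have gen: "sets (count_space UNIV) = sigma_sets (space (count_space (UNIV :: nat set))) ?G"
      proof -
        have "A \<in> sigma_sets UNIV ?G" for A :: "nat set"
        proof -
          have "(\<Union>k. if k \<in> A then {k} else {}) \<in> sigma_sets UNIV ?G"
            by (intro sigma_sets.Union) (auto intro: sigma_sets.Basic)
          moreover have "(\<Union>k. if k \<in> A then {k} else {}) = A" by auto
          ultimately show ?thesis by simp
        qed
        then show ?thesis by auto
      qed
      have "P.indep_vars (\<lambda>_. count_space UNIV) (\<lambda>B w. ncount (N w) B) \<B>"
      proof (subst P.indep_vars_finite[where E = "\<lambda>_. ?G", OF False \<B>(1) gen])
        show "(\<lambda>w. ncount (N w) B) \<in> P \<rightarrow>\<^sub>M count_space UNIV" if "B \<in> \<B>" for B using that \<B> meas by auto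
        show "Int_stable ?G" by (auto simp: Int_stable_def)
        show "\<forall>A\<in>\<B> \<rightarrow> ?G. P.prob (\<Inter>B\<in>\<B>. (\<lambda>w. ncount (N w) B) -` A B \<inter> space P) =
            (\<Prod>B\<in>\<B>. P.prob ((\<lambda>w. ncount (N w) B) -` A B \<inter> space P))"
        proof
          fix A assume A: "A \<in> \<B> \<rightarrow> ?G"
          show "P.prob (\<Inter>B\<in>\<B>. (\<lambda>w. ncount (N w) B) -` A B \<inter> space P) =
            (\<Prod>B\<in>\<B>. P.prob ((\<lambda>w. ncount (N w) B) -` A B \<inter> space P))"
          proof (cases "\<exists>B\<in>\<B>. A B = {}")
            case True
            then obtain B where B: "B \<in> \<B>" "A B = {}" by auto
            then have "(\<Prod>B\<in>\<B>. P.prob ((\<lambda>w. ncount (N w) B) -` A B \<inter> space P)) = 0"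
              using \<B>(1) by (intro prod_zero bexI[of _ B]) auto
            moreover have "(\<Inter>B\<in>\<B>. (\<lambda>w. ncount (N w) B) -` A B \<inter> space P) = {}" using B by auto
            ultimately show ?thesis by simp
          next
            case nonempty: False
            \<comment> \<open>The sets with a genuine condition, which here fixes one value; the
              others contribute factors 1.\<close>
            define \<C> where "\<C> = {B \<in> \<B>. A B \<noteq> UNIV}"
            have \<C>: "finite \<C>" "\<C> \<subseteq> sets \<mu>" "disjoint \<C>" "\<C> \<subseteq> \<B>"
              using \<B> by (auto simp: \<C>_def disjoint_def)
            have "\<forall>B\<in>\<C>. \<exists>k. A B = {k}" using A nonempty by (auto simp: \<C>_def Pi_def)
            then obtain m where m: "\<And>B. B \<in> \<C> \<Longrightarrow> A B = {m B}" by metis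
            have "(\<Inter>B\<in>\<B>. (\<lambda>w. ncount (N w) B) -` A B \<inter> space P) = {w \<in> space P. \<forall>B\<in>\<C>. ncount (N w) B = m B}"
            proof -
              have memb: "ncount (N w) B \<in> A B \<longleftrightarrow> (B \<in> \<C> \<longrightarrow> ncount (N w) B = m B)" if "B \<in> \<B>" for w B
              proof (cases "B \<in> \<C>")
                case True
                then show ?thesis using m[OF True] by simp
              next
                case False
                then show ?thesis using that by (simp add: \<C>_def)
              qed
              have "(\<Inter>B\<in>\<B>. (\<lambda>w. ncount (N w) B) -` A B \<inter> space P) = {w \<in> space P. \<forall>B\<in>\<B>. ncount (N w) B \<in> A B}"
                using \<open>\<B> \<noteq> {}\<close> by auto
              also have "\<dots> = {w \<in> space P. \<forall>B\<in>\<C>. ncount (N w) B = m B}"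
                using memb \<C>(4) by blast
              finally show ?thesis .
            qed
            then have "P.prob (\<Inter>B\<in>\<B>. (\<lambda>w. ncount (N w) B) -` A B \<inter> space P) =
                (\<Prod>B\<in>\<C>. measure \<mu> B ^ m B / fact (m B) * exp (- measure \<mu> B))"
              using law[OF \<C>(1-3)] by simp
            also have "\<dots> = (\<Prod>B\<in>\<C>. P.prob ((\<lambda>w. ncount (N w) B) -` A B \<inter> space P))"
            proof (intro prod.cong refl)
              fix B assume B: "B \<in> \<C>"
              have "(\<lambda>w. ncount (N w) B) -` A B \<inter> space P = {w \<in> space P. ncount (N w) B = m B}" using m[OF B] by auto
              then show "measure \<mu> B ^ m B / fact (m B) * exp (- measure \<mu> B) = P.prob ((\<lambda>w. ncount (N w) B) -` A B \<inter> space P)"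
                using single B \<C>(2) by auto
            qed
            also have "\<dots> = (\<Prod>B\<in>\<B>. P.prob ((\<lambda>w. ncount (N w) B) -` A B \<inter> space P))"
              using \<B>(1) by (intro prod.mono_neutral_left) (auto simp: \<C>_def P.prob_space)
            finally show ?thesis .
          qed
        qed
      qed auto
      then have "P.indep_vars (\<lambda>_. borel) (\<lambda>B w. of_nat (ncount (N w) B) :: ennreal) \<B>"
        by (rule P.indep_vars_compose2) simp
      moreover have pre: "(\<lambda>w. of_nat (ncount (N w) B) :: ennreal) -` A \<inter> space P = (\<lambda>w. emeasure (N w) B) -` A \<inter> space P"
        if "B \<in> \<B>" for A B
        using em that \<B>(2) by auto
      have "(\<lambda>w. emeasure (N w) B) \<in> borel_measurable P" if "B \<in> \<B>" for B
      proof -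
        have "(\<lambda>w. of_nat (ncount (N w) B) :: ennreal) \<in> borel_measurable P"
          using measurable_compose[OF meas of_nat_meas] that \<B>(2) by auto
        then show ?thesis using em that \<B>(2) by (subst measurable_cong[where g = "\<lambda>w. of_nat (ncount (N w) B)"]) auto
      qed
      ultimately show ?thesis
        unfolding P.indep_vars_def2 by (auto simp: pre cong: P.indep_sets_cong)
    qed
  qed
qed

section \<open>Convergence of the exceedance process\<close>

text \<open>Above 1 the distribution function equals one, and the bounds 1 + 1/(k+1) combine over
  all k. Below 1 some larger point still has distribution function less than one.\<close>

lemma (in prob_space) upper_endpoint_1:
  assumes [measurable]: "Z \<in> borel_measurable M" and e: "upper_endpoint (cdf (distr M borel Z)) = 1"
  shows "AE \<omega> in M. Z \<omega> \<le> 1" and "s < 1 \<Longrightarrow> 0 < \<P>(\<omega> in M. s < Z \<omega>)"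
proof -
  let ?F = "cdf (distr M borel Z)"
  interpret D: real_distribution "distr M borel Z" by simp
  have tail: "\<P>(\<omega> in M. s < Z \<omega>) = 1 - ?F s" for s
  proof -
    have "?F s = prob {\<omega> \<in> space M. Z \<omega> \<le> s}"
      by (simp add: cdf_def measure_distr) (auto intro!: arg_cong[where f = prob])
    moreover have "prob {\<omega> \<in> space M. s < Z \<omega>} = 1 - prob {\<omega> \<in> space M. Z \<omega> \<le> s}"
      by (subst prob_compl[symmetric]) (auto intro!: arg_cong[where f = prob])
    ultimately show ?thesis by simp
  qed
  show "0 < \<P>(\<omega> in M. s < Z \<omega>)" if "s < 1"
  proof -
    have "ereal s < Sup (ereal ` {x. ?F x < 1})" using e that by (simp add: upper_endpoint_def one_ereal_def)
    then obtain x where "?F x < 1" "s < x" by (auto simp: less_Sup_iff)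
    then show ?thesis using D.cdf_nondecreasing[of s x] unfolding tail by simp
  qed
  have "AE \<omega> in M. Z \<omega> \<le> 1 + 1 / real (Suc k)" for k
  proof -
    let ?x = "1 + 1 / real (Suc k)"
    have "\<not> ?F ?x < 1"
    proof
      assume "?F ?x < 1"
      then have "ereal ?x \<le> Sup (ereal ` {x. ?F x < 1})" by (intro Sup_upper) auto
      then show False using e by (simp add: upper_endpoint_def one_ereal_def)
    qed
    then have "\<P>(\<omega> in M. ?x < Z \<omega>) = 0" using D.cdf_bounded_prob[of ?x] unfolding tail by simp
    then have "AE \<omega> in M. \<not> ?x < Z \<omega>" by (subst (asm) prob_eq_0) auto
    then show ?thesis by eventually_elim simp
  qed
  then have "AE \<omega> in M. \<forall>k. Z \<omega> \<le> 1 + 1 / real (Suc k)" unfolding AE_all_countable by blast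
  then show "AE \<omega> in M. Z \<omega> \<le> 1"
  proof eventually_elim
    case (elim \<omega>)
    have "(\<lambda>k. 1 + 1 / real (Suc k)) \<longlonglongrightarrow> 1 + 0"
      by (intro tendsto_intros LIMSEQ_Suc[OF lim_1_over_n])
    then show ?case using elim by (intro LIMSEQ_le_const[of _ 1]) auto
  qed
qed

text \<open>A heavier tail at \<open>1\<close> has the smaller index: otherwise the tail ratio along
  \<open>u = 2 ^ k\<close> would grow geometrically.\<close>

lemma (in prob_space) index_mono_at_1:
  assumes S1: "regularly_varying_at_1 M S1 \<gamma>" and S2: "regularly_varying_at_1 M S2 \<tau>"
    and le: "eventually (\<lambda>s. \<P>(\<omega> in M. s < S1 \<omega>) \<le> \<P>(\<omega> in M. s < S2 \<omega>)) (at_left 1)"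
  shows "\<tau> \<le> \<gamma>"
proof (rule ccontr)
  assume "\<not> \<tau> \<le> \<gamma>"
  define g where "g Z k = \<P>(\<omega> in M. 1 - 1 / 2 ^ k < Z \<omega>)" for Z :: "'a \<Rightarrow> real" and k :: nat
  have pow: "filterlim (\<lambda>k. 2 ^ k :: real) at_top sequentially"
    by (rule filterlim_at_top_mono[OF filterlim_real_sequentially]) (simp add: less_imp_le of_nat_less_two_power)
  have pos: "0 < g Z k" if "regularly_varying_at_1 M Z \<alpha>" for Z \<alpha> k
    using that unfolding g_def regularly_varying_at_1_def by (intro upper_endpoint_1(2)) auto
  have ratio: "(\<lambda>k. g Z (Suc k) / g Z k) \<longlonglongrightarrow> (1 / 2) powr \<alpha>" if "regularly_varying_at_1 M Z \<alpha>" for Z \<alpha>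
  proof -
    have "((\<lambda>u. \<P>(\<omega> in M. Z \<omega> > 1 - (1 / 2) / u) / \<P>(\<omega> in M. Z \<omega> > 1 - 1 / u)) \<longlongrightarrow> (1 / 2) powr \<alpha>) at_top"
      using that unfolding regularly_varying_at_1_def by (auto dest!: spec[of _ "1 / 2"])
    from filterlim_compose[OF this pow] show ?thesis by (simp add: g_def)
  qed
  \<comment> \<open>Eventually at most 1 by the tail comparison, while its consecutive ratios tend
    to 2 to the power \<tau> - \<gamma>, which would exceed 1.\<close>
  define f where "f k = g S1 k / g S2 k" for k
  have f0: "0 < f k" for k using pos[OF S1] pos[OF S2] by (simp add: f_def)
  have "filterlim (\<lambda>k. 1 - 1 / 2 ^ k :: real) (at_left 1) sequentially"
    unfolding filterlim_at
  proof (intro conjI)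
    show "\<forall>\<^sub>F k in sequentially. (1 - 1 / 2 ^ k :: real) \<in> {..<1} \<and> (1 - 1 / 2 ^ k :: real) \<noteq> 1" by simp
    have "(\<lambda>k. 1 - (1 / 2) ^ k :: real) \<longlonglongrightarrow> 1 - 0" by (intro tendsto_intros LIMSEQ_power_zero) simp
    then show "(\<lambda>k. 1 - 1 / 2 ^ k :: real) \<longlonglongrightarrow> 1" by (simp add: power_divide)
  qed
  from eventually_compose_filterlim[OF le this] have f1: "eventually (\<lambda>k. f k \<le> 1) sequentially"
    by eventually_elim (use pos[OF S2] in \<open>simp add: f_def g_def\<close>)
  have "(\<lambda>k. (g S1 (Suc k) / g S1 k) / (g S2 (Suc k) / g S2 k)) \<longlonglongrightarrow> (1 / 2) powr \<gamma> / (1 / 2) powr \<tau>"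
    by (intro tendsto_divide ratio S1 S2) simp
  moreover have "(g S1 (Suc k) / g S1 k) / (g S2 (Suc k) / g S2 k) = f (Suc k) / f k" for k
    by (simp add: f_def)
  ultimately have lim: "(\<lambda>k. f (Suc k) / f k) \<longlonglongrightarrow> (1 / 2) powr (\<gamma> - \<tau>)" by (simp add: powr_diff)
  have "1 < (2 :: real) powr (\<tau> - \<gamma>)" using \<open>\<not> \<tau> \<le> \<gamma>\<close> by simp
  also have "(2 :: real) powr (\<tau> - \<gamma>) = (1 / 2) powr (\<gamma> - \<tau>)"
    by (simp add: powr_divide powr_minus_divide[symmetric])
  finally obtain c where c: "1 < c" "c < (1 / 2) powr (\<gamma> - \<tau>)" using dense by blast
  from f1 order_tendstoD(1)[OF lim c(2)] have "eventually (\<lambda>k. f k \<le> 1 \<and> c < f (Suc k) / f k) sequentially"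
    by eventually_elim simp
  then obtain K where K: "\<And>k. k \<ge> K \<Longrightarrow> f k \<le> 1 \<and> c < f (Suc k) / f k" by (auto simp: eventually_sequentially)
  have grow: "c ^ j * f K \<le> f (K + j)" for j
  proof (induction j)
    case (Suc j)
    have "c * f (K + j) \<le> f (Suc (K + j))" using K[of "K + j"] f0[of "K + j"] by (simp add: pos_less_divide_eq)
    moreover have "c * (c ^ j * f K) \<le> c * f (K + j)" using Suc c by (intro mult_left_mono) auto
    ultimately show ?case by (simp add: mult.assoc)
  qed simp
  obtain j where "1 / f K < c ^ j" using real_arch_pow[OF c(1)] by blast
  then have "1 < c ^ j * f K" using f0[of K] by (simp add: pos_divide_less_eq)
  then show False using grow[of j] K[of "K + j"] by simp
qed

text \<open>Independence makes the joint law the product of the marginals. This carries the limit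
  relation for the levels from Y = S X to every signed Y_n.\<close>

lemma (in prob_space) prob_product_exceeds_cong:
  fixes A A' B B' :: "'a \<Rightarrow> real"
  assumes ind: "indep_var borel A borel B" "indep_var borel A' borel B'"
    and eq: "distr M borel A = distr M borel A'" "distr M borel B = distr M borel B'"
  shows "\<P>(\<omega> in M. w < A \<omega> * B \<omega>) = \<P>(\<omega> in M. w < A' \<omega> * B' \<omega>)"
proof -
  have *: "\<P>(\<omega> in M. w < C \<omega> * D \<omega>) = measure (distr M borel C \<Otimes>\<^sub>M distr M borel D) {p. w < fst p * snd p}"
    if CD: "indep_var borel C borel D" for C D :: "'a \<Rightarrow> real"
  proof -
    have [measurable]: "C \<in> borel_measurable M" "D \<in> borel_measurable M"
      using CD by (auto dest: indep_var_rv1 indep_var_rv2)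
    have "{p. w < fst p * snd p} \<in> sets (borel \<Otimes>\<^sub>M borel :: (real \<times> real) measure)"
    proof -
      have "{p \<in> space (borel \<Otimes>\<^sub>M borel :: (real \<times> real) measure). w < fst p * snd p} \<in> sets (borel \<Otimes>\<^sub>M borel)" by measurable
      then show ?thesis by (simp add: space_pair_measure)
    qed
    then have "measure (distr M (borel \<Otimes>\<^sub>M borel) (\<lambda>\<omega>. (C \<omega>, D \<omega>))) {p. w < fst p * snd p} = \<P>(\<omega> in M. w < C \<omega> * D \<omega>)"
      by (subst measure_distr) (auto intro!: arg_cong[where f = prob])
    then show ?thesis using CD by (simp add: indep_var_distribution_eq)
  qed
  show ?thesis unfolding *[OF ind(1)] *[OF ind(2)] eq ..
qed

section \<open>Cell counts of the time lattice and of the intensity\<close>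

definition indices_in :: "nat \<Rightarrow> (real \<times> nat) set \<Rightarrow> (nat \<times> nat) set" where
  "indices_in n B = {(d, i). d \<in> {1, 2} \<and> i \<in> {1..n} \<and> (real i / real n, d) \<in> B}"

text \<open>Clearing denominators shows that i/n \<le> k / 2^l means i \<le> \<open>q k n\<close>,
  the integer part of k n / 2^l. The count is a difference of two such numbers, each within 1 of its
  real value.\<close>

lemma card_indices_in_cell:
  assumes b: "b \<in> cells l"
  shows "(\<lambda>n. real (card (indices_in n (cell l b))) / real n) \<longlonglongrightarrow> 1 / 2 ^ l"
proof -
  obtain j d where jd: "b = (j, d)" "j < 2 ^ l" "d \<in> {1, 2}" using b by (auto simp: cells_def)
  define q where "q k n = (k * n) div 2 ^ l" for k n :: nat
  have card_eq: "card (indices_in n (cell l b)) = q (Suc j) n - q j n" if n: "1 \<le> n" for n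
  proof -
    have iff: "real j / 2 ^ l < real i / real n \<longleftrightarrow> q j n < i" "real i / real n \<le> real (j + 1) / 2 ^ l \<longleftrightarrow> i \<le> q (Suc j) n" for i
    proof -
      have "real j / 2 ^ l < real i / real n \<longleftrightarrow> real (j * n) < real (i * 2 ^ l)"
        using n by (simp add: pos_divide_less_eq pos_less_divide_eq field_simps)
      also have "\<dots> \<longleftrightarrow> j * n < i * 2 ^ l" by (rule of_nat_less_iff)
      also have "\<dots> \<longleftrightarrow> q j n < i" unfolding q_def by (simp add: div_less_iff_less_mult)
      finally show "real j / 2 ^ l < real i / real n \<longleftrightarrow> q j n < i" .
      have "real i / real n \<le> real (j + 1) / 2 ^ l \<longleftrightarrow> real (i * 2 ^ l) \<le> real (Suc j * n)"
        using n by (simp add: field_simps)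
      also have "\<dots> \<longleftrightarrow> i * 2 ^ l \<le> Suc j * n" by (rule of_nat_le_iff)
      also have "\<dots> \<longleftrightarrow> i \<le> q (Suc j) n" unfolding q_def by (simp add: less_eq_div_iff_mult_less_eq)
      finally show "real i / real n \<le> real (j + 1) / 2 ^ l \<longleftrightarrow> i \<le> q (Suc j) n" .
    qed
    have "q (Suc j) n \<le> n"
    proof -
      have "Suc j * n \<le> 2 ^ l * n" using jd by (intro mult_right_mono) auto
      then have "q (Suc j) n \<le> (2 ^ l * n) div 2 ^ l" unfolding q_def by (rule div_le_mono)
      then show ?thesis by simp
    qed
    then have "indices_in n (cell l b) = {d} \<times> {q j n<..q (Suc j) n}"
      unfolding indices_in_def cell_def using jd(3) iff by (auto simp: jd(1) simp del: of_nat_Suc of_nat_add)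
    then show ?thesis by (simp add: card_cartesian_product)
  qed
  have q_lim: "(\<lambda>n. real (q k n) / real n) \<longlonglongrightarrow> real k / 2 ^ l" for k
  proof (rule real_tendsto_sandwich)
    have "(\<lambda>n. real k / 2 ^ l - 1 / real n) \<longlonglongrightarrow> real k / 2 ^ l - 0" by (intro tendsto_intros lim_1_over_n)
    then show "(\<lambda>n. real k / 2 ^ l - 1 / real n) \<longlonglongrightarrow> real k / 2 ^ l" by simp
    show "(\<lambda>n. real k / 2 ^ l) \<longlonglongrightarrow> real k / 2 ^ l" by simp
    have bounds: "real (k * n) / 2 ^ l - 1 \<le> real (q k n)" "real (q k n) \<le> real (k * n) / 2 ^ l" for n
    proof -
      have "real (q k n * 2 ^ l) \<le> real (k * n)" unfolding q_def of_nat_le_iff by (rule div_times_less_eq_dividend)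
      then show "real (q k n) \<le> real (k * n) / 2 ^ l" by (simp add: pos_le_divide_eq)
      have "k * n < 2 ^ l + 2 ^ l * q k n" unfolding q_def by (rule dividend_less_times_div) simp
      then have "real (k * n) < real (2 ^ l + 2 ^ l * q k n)" by (rule of_nat_less_iff[THEN iffD2])
      then have "real (k * n) < (real (q k n) + 1) * 2 ^ l" by (simp add: algebra_simps)
      then have "real (k * n) / 2 ^ l < real (q k n) + 1" by (simp add: pos_divide_less_eq)
      then show "real (k * n) / 2 ^ l - 1 \<le> real (q k n)" by simp
    qed
    show "\<forall>\<^sub>F n in sequentially. real k / 2 ^ l - 1 / real n \<le> real (q k n) / real n"
      using eventually_ge_at_top[of 1]
    proof eventually_elim
      case (elim n)
      have "real k / 2 ^ l - 1 / real n = (real (k * n) / 2 ^ l - 1) / real n" using elim by (simp add: diff_divide_distrib)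
      also have "\<dots> \<le> real (q k n) / real n" using bounds(1)[of n] by (intro divide_right_mono) auto
      finally show ?case .
    qed
    show "\<forall>\<^sub>F n in sequentially. real (q k n) / real n \<le> real k / 2 ^ l"
      using eventually_ge_at_top[of 1]
    proof eventually_elim
      case (elim n)
      have "real (q k n) / real n \<le> (real (k * n) / 2 ^ l) / real n" using bounds(2)[of n] by (intro divide_right_mono) auto
      also have "\<dots> = real k / 2 ^ l" using elim by simp
      finally show ?case .
    qed
  qed
  have "(\<lambda>n. real (q (Suc j) n) / real n - real (q j n) / real n) \<longlonglongrightarrow> real (Suc j) / 2 ^ l - real j / 2 ^ l"
    by (intro tendsto_diff q_lim)
  also have "real (Suc j) / 2 ^ l - real j / 2 ^ l = 1 / 2 ^ l" by (simp add: add_divide_distrib)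
  finally show ?thesis
  proof (rule Lim_transform_eventually)
    show "\<forall>\<^sub>F n in sequentially. real (q (Suc j) n) / real n - real (q j n) / real n = real (card (indices_in n (cell l b))) / real n"
      using eventually_ge_at_top[of 1]
    proof eventually_elim
      case (elim n)
      have "q j n \<le> q (Suc j) n" unfolding q_def by (intro div_le_mono) simp
      then show ?case unfolding card_eq[OF elim] by (simp add: of_nat_diff diff_divide_distrib)
    qed
  qed
qed

lemma measure_biv_intensity:
  shows "finite_measure (biv_intensity x)" "measure (biv_intensity x) biv_space = exp (- x 1) + exp (- x 2)"
    and "b \<in> cells l \<Longrightarrow> measure (biv_intensity x) (cell l b) = 1 / 2 ^ l * exp (- x (snd b))"
proof -
  have s: "sets (biv_intensity x) = sets (restrict_space borel biv_space)" by (simp add: biv_intensity_def)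
  have sp: "space (biv_intensity x) = biv_space" using sets_eq_imp_space_eq[OF s] by (simp add: space_restrict_space)
  have top: "biv_space \<in> sets (restrict_space borel biv_space)" using sets.top[of "biv_intensity x"] s sp by simp
  have "component biv_space 1 = {0<..1}" "component biv_space 2 = {0<..1}" by (auto simp: component_def biv_space_def)
  then have e: "emeasure (biv_intensity x) biv_space = ennreal (exp (- x 1) + exp (- x 2))"
    by (simp add: emeasure_biv_intensity[OF top] numeral_2_eq_2[symmetric])
  then show "finite_measure (biv_intensity x)" by (intro finite_measureI) (simp add: sp)
  show "measure (biv_intensity x) biv_space = exp (- x 1) + exp (- x 2)"
    using e by (simp add: measure_def del: ennreal_plus)
  assume b: "b \<in> cells l"
  obtain j d where jd: "b = (j, d)" "d \<in> {1, 2}" using b by (auto simp: cells_def)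
  define I where "I = {real j / 2 ^ l<..real (j + 1) / 2 ^ l}"
  have "component (cell l b) d' = (if d' = d then I else {})" for d'
    by (auto simp: component_def cell_def jd I_def)
  moreover have "emeasure lborel I = ennreal (1 / 2 ^ l)"
    by (simp add: I_def divide_right_mono diff_divide_distrib[symmetric])
  ultimately have "emeasure (biv_intensity x) (cell l b) = ennreal (exp (- x d)) * ennreal (1 / 2 ^ l)"
    using jd(2) by (auto simp: emeasure_biv_intensity[OF sets_cell[OF b]])
  also have "\<dots> = ennreal (1 / 2 ^ l * exp (- x d))" by (simp add: ennreal_mult[symmetric] mult.commute)
  finally show "measure (biv_intensity x) (cell l b) = 1 / 2 ^ l * exp (- x (snd b))"
    by (simp add: measure_def jd)
qed

text \<open>Needed to pass between counts indexed by cells and the law of the Poisson process, which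
  is stated for families of sets. Each cell contains its right endpoint, so disjoint cells are
  distinct.\<close>

lemma inj_on_cell: "inj_on (cell l) (cells l)"
proof (rule inj_onI)
  fix b b' assume b: "b \<in> cells l" "b' \<in> cells l" "cell l b = cell l b'"
  have "(real (fst b + 1) / 2 ^ l, snd b) \<in> cell l b" by (auto simp: cell_def divide_strict_right_mono)
  then have "cell l b \<inter> cell l b' \<noteq> {}" using b(3) by auto
  then show "b = b'" using disjoint_cells[of l] b(1,2) unfolding disjoint_family_on_def by blast
qed

theorem theorem2p4:
  fixes M :: "'a measure"
    and X S :: "'a \<Rightarrow> real" and Xn Sn :: "nat \<Rightarrow> 'a \<Rightarrow> real"
    and S\<^sub>\<gamma> S\<^sub>\<tau> :: "'a \<Rightarrow> real"
    and Y :: "'a \<Rightarrow> real" and Yn :: "nat \<Rightarrow> 'a \<Rightarrow> real"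
    and F :: "real \<Rightarrow> real" and \<rho> :: "nat \<Rightarrow> real"
    and \<nu> \<gamma> \<tau> \<epsilon> \<Delta> :: real
    and a b :: "nat \<Rightarrow> real" and u :: "nat \<Rightarrow> real \<Rightarrow> real"
    and x :: "nat \<Rightarrow> real"
  assumes "prob_space M"
    and "standard_stationary_gaussian M Xn \<rho>"
    and "distributed M lborel X std_normal_density"
    and "prob_space.indep_vars M (\<lambda>_. borel) (Sn(0 := S)) UNIV"
    and "AE \<omega> in M. S \<omega> \<ge> 0"
    and "\<And>n. n \<ge> 1 \<Longrightarrow> AE \<omega> in M. Sn n \<omega> \<ge> 0"
    and "cdf (distr M borel S) = F"
    and "\<And>n. n \<ge> 1 \<Longrightarrow> cdf (distr M borel (Sn n)) = F"
    and "upper_endpoint F = 1"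
    and "prob_space.indep_elements M
           (PiM UNIV (\<lambda>_. borel)) (\<lambda>\<omega> n. (Sn(0 := S)) n \<omega>)
           (PiM {1..} (\<lambda>_. borel)) (\<lambda>\<omega>. \<lambda>n\<in>{1..}. Xn n \<omega>)"
    and "prob_space.indep_elements M
           (PiM UNIV (\<lambda>_. borel)) (\<lambda>\<omega> n. (Sn(0 := S)) n \<omega>) borel X"
    and "0 < \<nu>" and "\<nu> < 1" and "\<gamma> \<ge> 0" and "\<tau> \<ge> 0"
    and "AE \<omega> in M. S\<^sub>\<gamma> \<omega> \<ge> 0" and "AE \<omega> in M. S\<^sub>\<tau> \<omega> \<ge> 0"
    and "regularly_varying_at_1 M S\<^sub>\<gamma> \<gamma>" and "regularly_varying_at_1 M S\<^sub>\<tau> \<tau>"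
    and "\<And>v. v \<in> {\<nu><..<1} \<Longrightarrow> \<P>(\<omega> in M. S\<^sub>\<tau> \<omega> > v) \<ge> \<P>(\<omega> in M. S \<omega> > v)"
    and "\<And>v. v \<in> {\<nu><..<1} \<Longrightarrow> \<P>(\<omega> in M. S \<omega> > v) \<ge> \<P>(\<omega> in M. S\<^sub>\<gamma> \<omega> > v)"
    and "\<epsilon> > 0" and "\<Delta> = 2 * (\<gamma> - \<tau>) + \<epsilon>"
    and "(\<lambda>n. \<rho> n * ln (real n) powr (1 + \<Delta>)) \<longlonglongrightarrow> 0"
    and "\<And>\<omega>. Y \<omega> = S \<omega> * X \<omega>"
    and "\<And>n \<omega>. Yn n \<omega> = Sn n \<omega> * Xn n \<omega>"
    and "\<And>n. n \<ge> 1 \<Longrightarrow> a n > 0"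
    and "\<And>n y. u n y = a n * y + b n"
    and "\<And>y. (\<lambda>n. real n * \<P>(\<omega> in M. Y \<omega> > u n y)) \<longlonglongrightarrow> exp (- y)"
  shows "\<exists>(P :: (real \<times> nat) measure measure) N.
           poisson_process biv_space P N (biv_intensity x) \<and>
           converges_in_distribution (vague_topology biv_space)
             M (exceedance_process Yn u x) P N"
proof -
  interpret prob_space M by fact
  note gauss = assms(2) and X_law = assms(3) and indep = assms(4)
  define T where "T = Sn(0 := S)"
  have T: "T 0 = S" "\<And>n. 1 \<le> n \<Longrightarrow> T n = Sn n" by (auto simp: T_def)
  have T_meas [measurable]: "T n \<in> borel_measurable M" for n
    using indep unfolding indep_vars_def T_def by blast
  have T_distr: "distr M borel (T n) = distr M borel S" for n
  proof (cases "n = 0")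
    case False
    have "cdf (distr M borel (T n)) = cdf (distr M borel (T 0))"
      using False T assms(7) assms(8)[of n] by simp
    moreover have "real_distribution (distr M borel (T n))" "real_distribution (distr M borel (T 0))" by simp_all
    ultimately show ?thesis using cdf_unique T by metis
  qed (simp add: T)
  have top: "upper_endpoint (cdf (distr M borel (T n))) = 1" for n
    using T_distr[of n] assms(7,9) by simp
  have T_range: "AE \<omega> in M. 0 \<le> T n \<omega> \<and> T n \<omega> \<le> 1" for n
  proof -
    have "AE \<omega> in M. 0 \<le> T n \<omega>" using assms(5) assms(6)[of n] T by (cases "n = 0") auto
    moreover have "AE \<omega> in M. T n \<omega> \<le> 1" using top by (intro upper_endpoint_1(1)) auto
    ultimately show ?thesis by eventually_elim simp
  qed
  have "\<tau> \<le> \<gamma>"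
  proof (rule index_mono_at_1[OF assms(18,19)])
    have "eventually (\<lambda>s. s \<in> {\<nu><..<1}) (at_left 1)"
      using \<open>\<nu> < 1\<close> by (rule eventually_at_left_real)
    then show "eventually (\<lambda>s. \<P>(\<omega> in M. s < S\<^sub>\<gamma> \<omega>) \<le> \<P>(\<omega> in M. s < S\<^sub>\<tau> \<omega>)) (at_left 1)"
      by eventually_elim (use assms(20,21) in \<open>meson order_trans\<close>)
  qed
  \<comment> \<open>The term 2(\<gamma> - \<tau>) is nonnegative and \<epsilon> is positive, so the
    assumed rate is at least as strong as \<open>\<rho> n * ln (real n)\<close> tending to
    0.\<close>
  then have \<Delta>: "1 \<le> 1 + \<Delta>" using assms(22,23) by simp
  have rho_ln: "(\<lambda>n. \<rho> n * ln (real n)) \<longlonglongrightarrow> 0"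
  proof (rule Lim_null_comparison[OF _ tendsto_rabs_zero[OF assms(24)]])
    show "\<forall>\<^sub>F n in sequentially. norm (\<rho> n * ln (real n)) \<le> \<bar>\<rho> n * ln (real n) powr (1 + \<Delta>)\<bar>"
      using eventually_ge_at_top[of 3]
    proof eventually_elim
      case (elim n)
      have "exp 1 \<le> real n" using exp_le elim by linarith
      then have ln1: "1 \<le> ln (real n)" using elim by (subst ln_ge_iff) auto
      then have "ln (real n) powr 1 \<le> ln (real n) powr (1 + \<Delta>)" using \<Delta> by (intro powr_mono) auto
      then show ?case using ln1 by (simp add: abs_mult mult_left_mono)
    qed
  qed
  define v where "v n d = u n (x d)" for n d
  define p where "p n d = \<P>(\<omega> in M. Y \<omega> > v n d)" for n d
  interpret G: bounded_scale_mixture M Xn T \<rho>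
  proof
    show "standard_stationary_gaussian M Xn \<rho>" by (rule gauss)
    show "indep_vars (\<lambda>_. borel) T UNIV" using indep by (simp add: T_def)
    show "indep_elements (PiM UNIV (\<lambda>_. borel)) (\<lambda>\<omega> n. T n \<omega>) (PiM {1..} (\<lambda>_. borel)) (\<lambda>\<omega>. \<lambda>n\<in>{1..}. Xn n \<omega>)"
      using assms(10) by (simp add: T_def)
    show "AE \<omega> in M. 0 \<le> T i \<omega> \<and> T i \<omega> \<le> 1" for i by (rule T_range)
  qed
  interpret L: exceedance_levels M Xn T \<rho> v p "\<lambda>d. exp (- x d)"
  proof
    fix d i n :: nat assume d: "d \<in> {1, 2}" and i: "1 \<le> i"
    define sg where "sg = (if d = 1 then 1 else - 1 :: real)"
    have \<xi>: "\<xi> d z = sg * z" for z using d by (auto simp: \<xi>_def sg_def)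
    have D: "distributed M lborel (\<lambda>\<omega>. sg * Xn i \<omega>) std_normal_density"
      using i by (rule G.lin_single_distributed) (auto simp: sg_def)
    have lin: "G.lin {i} (\<lambda>_. sg) = (\<lambda>\<omega>. sg * Xn i \<omega>)" by (simp add: G.lin_def fun_eq_iff)
    have ind1: "indep_var borel (T i) borel (\<lambda>\<omega>. sg * Xn i \<omega>)"
      using G.indep_S_lin[of "{i}" i "\<lambda>_. sg"] i unfolding lin by simp
    have "(\<lambda>s. s 0) \<in> borel_measurable (PiM UNIV (\<lambda>_. borel :: real measure))"
      by (rule measurable_component_singleton) simp
    from indep_elements_compose[OF assms(11) this measurable_ident_sets[OF refl]]
    have ind2: "indep_var borel (T 0) borel X" by (simp only: T_def)
    \<comment> \<open>The standard normal law is symmetric, so exceedances by -Y_n obey the same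
      limit relation as those by Y_n.\<close>
    have "distr M borel (\<lambda>\<omega>. sg * Xn i \<omega>) = distr M borel X"
    proof -
      have "distr M borel Z = density lborel std_normal_density" if "distributed M lborel Z std_normal_density" for Z
      proof -
        have "distr M borel Z = distr M lborel Z" by (intro distr_cong) auto
        then show ?thesis using that by (simp add: distributed_def)
      qed
      then show ?thesis using D X_law by simp
    qed
    then have "\<P>(\<omega> in M. v n d < T i \<omega> * (sg * Xn i \<omega>)) = \<P>(\<omega> in M. v n d < T 0 \<omega> * X \<omega>)"
      using T_distr by (intro prob_product_exceeds_cong[OF ind1 ind2]) simp_all
    then show "G.exceed_prob (v n) (d, i) = p n d"
      by (simp add: exceeds_def G.vec_def \<xi> p_def assms(25) T ac_simps)
  next
    fix d assume "d \<in> {1, 2 :: nat}"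
    show "(\<lambda>n. real n * p n d) \<longlonglongrightarrow> exp (- x d)" unfolding p_def v_def by (rule assms(29))
  next
    show "0 < \<P>(\<omega> in M. s < T 1 \<omega>)" if "s < 1" for s
      using top that by (intro upper_endpoint_1(2)) auto
  qed (use rho_ln in auto)
  have pat: "pattern (v n) {1..n} (\<lambda>k. G.vec k \<omega>) = {(d, i). d \<in> {1, 2} \<and> i \<in> {1..n} \<and> u n (x d) < \<xi> d (Yn i \<omega>)}" for n \<omega>
    by (auto simp: pattern_def exceeds_def G.vec_def v_def assms(26) T)
  have em: "emeasure (exceedance_process Yn u x n \<omega>) B = of_nat (card (G.pat (v n) {1..n} \<omega> \<inter> indices_in n B))"
    if B: "B \<in> sets (restrict_space borel biv_space)" for n \<omega> B
  proof -
    have "G.pat (v n) {1..n} \<omega> \<inter> indices_in n B = {k \<in> {1, 2} \<times> {1..n}. u n (x (fst k)) < \<xi> (fst k) (Yn (snd k) \<omega>) \<and>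
        real (snd k) / real n \<in> component B (fst k)}"
      unfolding pat by (auto simp: indices_in_def component_def)
    moreover have "emeasure (exceedance_process Yn u x n \<omega>) B =
        (\<Sum>k\<in>{1, 2} \<times> {1..n}. if u n (x (fst k)) < \<xi> (fst k) (Yn (snd k) \<omega>) \<and>
          real (snd k) / real n \<in> component B (fst k) then 1 else 0)"
      unfolding emeasure_exceedance_process[OF B] by (simp add: sum.cartesian_product case_prod_beta)
    ultimately show ?thesis by (simp add: sum.If_cases Int_def)
  qed
  have s: "sets (exceedance_process Yn u x n \<omega>) = sets (restrict_space borel biv_space)" for n \<omega>
    by (simp add: exceedance_process_def)
  have Z: "exceedance_process Yn u x n \<omega> \<in> finite_point_measures" for n \<omega>
    by (rule finite_point_measuresI(1)[OF s]) (rule em)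
  have Z_count: "ncount (exceedance_process Yn u x n \<omega>) B = card (G.pat (v n) {1..n} \<omega> \<inter> indices_in n B)"
    if "B \<in> sets (restrict_space borel biv_space)" for n \<omega> B
    by (rule finite_point_measuresI(2)[OF s _ that]) (rule em)
  note \<mu> = measure_biv_intensity[where x = x]
  have s\<mu>: "sets (biv_intensity x) = sets (restrict_space borel biv_space)" by (simp add: biv_intensity_def)
  have "0 < measure (biv_intensity x) biv_space" unfolding \<mu>(2) by (intro add_pos_pos) auto
  from exists_poisson_law[OF s\<mu> \<mu>(1) this] obtain P :: "(real \<times> nat) measure measure"
    where P: "prob_space P" "space P = finite_point_measures"
      "\<And>B. B \<in> sets (biv_intensity x) \<Longrightarrow> (\<lambda>w. ncount w B) \<in> P \<rightarrow>\<^sub>M count_space UNIV"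
      "\<And>\<B> m. finite \<B> \<Longrightarrow> \<B> \<subseteq> sets (biv_intensity x) \<Longrightarrow> disjoint \<B> \<Longrightarrow>
        \<P>(w in P. \<forall>B\<in>\<B>. ncount w B = m B) =
        (\<Prod>B\<in>\<B>. measure (biv_intensity x) B ^ m B / fact (m B) * exp (- measure (biv_intensity x) B))"
    by blast
  \<comment> \<open>The law lives on the measures themselves, so the process is the identity
    map.\<close>
  have "poisson_process biv_space P (\<lambda>w. w) (biv_intensity x)"
    using P s\<mu> by (intro poisson_processI) auto
  moreover have "converges_in_distribution (vague_topology biv_space) M (exceedance_process Yn u x) P (\<lambda>w. w)"
  proof (rule vague_convergence_from_cell_counts[OF \<open>prob_space M\<close> P(1)])
    show "exceedance_process Yn u x n \<omega> \<in> finite_point_measures" for n \<omega> by (rule Z)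
    show "w \<in> finite_point_measures" if "w \<in> space P" for w using that P(2) by simp
    show "(\<lambda>w. ncount w (cell l b)) \<in> P \<rightarrow>\<^sub>M count_space UNIV" if "b \<in> cells l" for l b
      using sets_cell[OF that] s\<mu> by (intro P(3)) simp
    show "(\<lambda>\<omega>. ncount (exceedance_process Yn u x n \<omega>) (cell l b)) \<in> M \<rightarrow>\<^sub>M count_space UNIV" if "b \<in> cells l" for n l b
      unfolding Z_count[OF sets_cell[OF that]]
    proof (subst measurable_count_space_eq2_countable, intro conjI ballI)
      fix k
      have "Measurable.pred M (\<lambda>\<omega>. card (G.pat (v n) {1..n} \<omega> \<inter> indices_in n (cell l b)) = k)"
        by (rule G.pred_pattern_vec[where \<Phi> = "\<lambda>A. card (A \<inter> indices_in n (cell l b)) = k"]) auto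
      then show "(\<lambda>\<omega>. card (G.pat (v n) {1..n} \<omega> \<inter> indices_in n (cell l b))) -` {k} \<inter> space M \<in> events"
        by (simp add: pred_def vimage_def Int_def conj_commute)
    qed auto
    fix l and m :: "nat \<times> nat \<Rightarrow> nat"
    have "(\<lambda>n. \<P>(\<omega> in M. \<forall>b\<in>cells l. card (G.pat (v n) {1..n} \<omega> \<inter> indices_in n (cell l b)) = m b)) \<longlonglongrightarrow>
      (\<Prod>b\<in>cells l. (1 / 2 ^ l * exp (- x (snd b))) ^ m b / fact (m b) * exp (- (1 / 2 ^ l * exp (- x (snd b)))))"
    proof (rule L.counts_converge[OF finite_cells])
      show "snd b \<in> {1, 2}" if "b \<in> cells l" for b using that by (auto simp: cells_def)
      show "indices_in n (cell l b) \<subseteq> {snd b} \<times> {1..n}" for n b by (auto simp: indices_in_def cell_def)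
      show "disjoint_family_on (\<lambda>b. indices_in n (cell l b)) (cells l)" for n
        using disjoint_cells[of l] unfolding disjoint_family_on_def indices_in_def by fast
      show "(\<lambda>n. real (card (indices_in n (cell l b))) / real n) \<longlonglongrightarrow> 1 / 2 ^ l" if "b \<in> cells l" for b
        by (rule card_indices_in_cell[OF that])
    qed
    also have "(\<Prod>b\<in>cells l. (1 / 2 ^ l * exp (- x (snd b))) ^ m b / fact (m b) * exp (- (1 / 2 ^ l * exp (- x (snd b))))) =
        \<P>(w in P. \<forall>b\<in>cells l. ncount w (cell l b) = m b)"
    proof -
      \<comment> \<open>The prescribed counts, transported from cell indices to the cells as
        sets.\<close>
      define m' where "m' B = m (the_inv_into (cells l) (cell l) B)" for B
      have m': "m' (cell l b) = m b" if "b \<in> cells l" for b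
        using that by (simp add: m'_def the_inv_into_f_f[OF inj_on_cell])
      have "\<P>(w in P. \<forall>b\<in>cells l. ncount w (cell l b) = m b) = \<P>(w in P. \<forall>B\<in>cell l ` cells l. ncount w B = m' B)"
        using m' by (intro arg_cong[where f = "measure P"]) auto
      also have "\<dots> = (\<Prod>B\<in>cell l ` cells l. measure (biv_intensity x) B ^ m' B / fact (m' B) * exp (- measure (biv_intensity x) B))"
      proof (rule P(4))
        show "cell l ` cells l \<subseteq> sets (biv_intensity x)" using sets_cell s\<mu> by auto
        show "disjoint (cell l ` cells l)" using disjoint_cells[of l] by (rule disjoint_family_on_disjoint_image)
      qed simp
      also have "\<dots> = (\<Prod>b\<in>cells l. (1 / 2 ^ l * exp (- x (snd b))) ^ m b / fact (m b) * exp (- (1 / 2 ^ l * exp (- x (snd b)))))"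
        unfolding prod.reindex[OF inj_on_cell] o_def using m' \<mu>(3) by (intro prod.cong refl) simp
      finally show ?thesis ..
    qed
    finally show "(\<lambda>n. \<P>(\<omega> in M. \<forall>b\<in>cells l. ncount (exceedance_process Yn u x n \<omega>) (cell l b) = m b)) \<longlonglongrightarrow>
      \<P>(w in P. \<forall>b\<in>cells l. ncount w (cell l b) = m b)"
      using Z_count[OF sets_cell] by (simp cong: ball_cong)
  qed
  ultimately show ?thesis by blast
qed

end
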